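(* Let $M^n$ be a Riemannian manifold with positive Ricci curvature and $f:M^n\to\mathbb{R}^{n+p}$ an isometric immersion. Then $f$ is singularly genuinely rigid in $\mathbb{R}^{n+q}$ for every $q<n-p$.
   Context: Superscripts denote dimension; manifolds and maps are smooth. Singular isometric extension: a pair of isometric immersions $f:M^n\to\mathbb{R}^{n+p}$ and $\hat f:M^n\to\mathbb{R}^{n+q}$ singularly extends isometrically if there are a manifold $N^{n+s}$ with $s>0$, an embedding $j:M^n\hookrightarrow N^{n+s}$, and isometric maps $F:N^{n+s}\to\mathbb{R}^{n+p}$ and $\hat F:N^{n+s}\to\mathbb{R}^{n+q}$ (i.e. smooth maps inducing the same, possibly degenerate, metric on $N^{n+s}$) such that $f=F\circ j$ and $\hat f=\hat F\circ j$, and the set of points where $F$ and $\hat F$ fail to be immersions (possibly empty) is contained in $j(M)$. Singular genuine rigidity: $f:M^n\to\mathbb{R}^{n+p}$ is singularly genuinely rigid in $\mathbb{R}^{n+q}$, for a fixed integer $q$, if for any isometric immersion $\hat f:M^n\to\mathbb{R}^{n+q}$ there is an open dense subset $U\subset M^n$ such that $f|_U$ and $\hat f|_U$ singularly extend isometrically. *)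

theory Defs
  imports "HOL-Analysis.Analysis"
begin

section \<open>Smooth functions on open subsets of Euclidean space\<close>

text \<open>
  The dimension of one manifold below is bound by an existential quantifier, so it cannot be a type.
  Hence \<open>\<real>\<^sup>m\<close> is the library's \<^const>\<open>Euclidean_space\<close> \<open>m\<close>: the functions \<open>nat \<Rightarrow> real\<close> vanishing
  at all indices \<open>\<ge> m\<close>.
\<close>

definition partial :: "nat \<Rightarrow> ((nat \<Rightarrow> real) \<Rightarrow> real) \<Rightarrow> (nat \<Rightarrow> real) \<Rightarrow> real" where
  "partial i h u = deriv (\<lambda>t. h (u(i := t))) (u i)"

text \<open>The sets \<open>S\<close> are always open in \<open>\<real>\<^sup>m\<close>, so that only values of \<open>h\<close> on \<open>S\<close> matter.\<close>

primrec Ck_on :: "nat \<Rightarrow> nat \<Rightarrow> (nat \<Rightarrow> real) set \<Rightarrow> ((nat \<Rightarrow> real) \<Rightarrow> real) \<Rightarrow> bool" where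
  "Ck_on 0 m S h \<longleftrightarrow> continuous_map (subtopology (Euclidean_space m) S) euclideanreal h"
| "Ck_on (Suc k) m S h \<longleftrightarrow>
     continuous_map (subtopology (Euclidean_space m) S) euclideanreal h \<and>
     (\<forall>i<m. (\<forall>u\<in>S. (\<lambda>t. h (u(i := t))) differentiable at (u i)) \<and> Ck_on k m S (partial i h))"

definition smooth_on :: "nat \<Rightarrow> (nat \<Rightarrow> real) set \<Rightarrow> ((nat \<Rightarrow> real) \<Rightarrow> real) \<Rightarrow> bool" where
  "smooth_on m S h \<longleftrightarrow> (\<forall>k. Ck_on k m S h)"


section \<open>Smooth manifolds and smooth maps\<close>

text \<open>A chart \<open>(U, \<phi>)\<close> is a domain with a coordinate map; \<open>inv_into U \<phi>\<close> is the parametrization.\<close>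

type_synonym 'a chart = "'a set \<times> ('a \<Rightarrow> nat \<Rightarrow> real)"

record 'a manifold =
  mtop :: "'a topology"
  mdim :: nat
  charts :: "'a chart set"

definition second_countable :: "'a topology \<Rightarrow> bool" where
  "second_countable X \<longleftrightarrow>
     (\<exists>\<B>. countable \<B> \<and> (\<forall>B\<in>\<B>. openin X B) \<and>
          (\<forall>W x. openin X W \<and> x \<in> W \<longrightarrow> (\<exists>B\<in>\<B>. x \<in> B \<and> B \<subseteq> W)))"

text \<open>The set \<open>charts M\<close> is an atlas, not necessarily a maximal one.\<close>

definition smooth_manifold :: "'a manifold \<Rightarrow> bool" where
  "smooth_manifold M \<longleftrightarrow>
     Hausdorff_space (mtop M) \<and> second_countable (mtop M) \<and>
     (\<Union>(U, \<phi>)\<in>charts M. U) = topspace (mtop M) \<and>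
     (\<forall>(U, \<phi>)\<in>charts M.
        openin (mtop M) U \<and> openin (Euclidean_space (mdim M)) (\<phi> ` U) \<and>
        homeomorphic_map (subtopology (mtop M) U)
          (subtopology (Euclidean_space (mdim M)) (\<phi> ` U)) \<phi>) \<and>
     (\<forall>(U, \<phi>)\<in>charts M. \<forall>(V, \<psi>)\<in>charts M. \<forall>k<mdim M.
        smooth_on (mdim M) (\<phi> ` (U \<inter> V)) (\<lambda>u. \<psi> (inv_into U \<phi> u) k))"

definition euclidean_manifold :: "nat \<Rightarrow> (nat \<Rightarrow> real) manifold" where
  "euclidean_manifold m =
     \<lparr>mtop = Euclidean_space m, mdim = m, charts = {(topspace (Euclidean_space m), \<lambda>x. x)}\<rparr>"

definition open_submanifold :: "'a manifold \<Rightarrow> 'a set \<Rightarrow> 'a manifold" where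
  "open_submanifold M W =
     \<lparr>mtop = subtopology (mtop M) W, mdim = mdim M, charts = (\<lambda>(U, \<phi>). (U \<inter> W, \<phi>)) ` charts M\<rparr>"

definition smooth_map :: "'a manifold \<Rightarrow> 'b manifold \<Rightarrow> ('a \<Rightarrow> 'b) \<Rightarrow> bool" where
  "smooth_map M N F \<longleftrightarrow>
     continuous_map (mtop M) (mtop N) F \<and>
     (\<forall>(U, \<phi>)\<in>charts M. \<forall>(V, \<psi>)\<in>charts N. \<forall>k<mdim N.
        smooth_on (mdim M) (\<phi> ` (U \<inter> F -` V)) (\<lambda>u. \<psi> (F (inv_into U \<phi> u)) k))"

text \<open>The functions smooth on some neighbourhood of \<open>x\<close>, i.e. the representatives of smooth germs.\<close>

definition smooth_at :: "'a manifold \<Rightarrow> 'a \<Rightarrow> ('a \<Rightarrow> real) \<Rightarrow> bool" where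
  "smooth_at M x h \<longleftrightarrow>
     (\<exists>W. openin (mtop M) W \<and> x \<in> W \<and>
        (\<forall>(U, \<phi>)\<in>charts M. smooth_on (mdim M) (\<phi> ` (U \<inter> W)) (\<lambda>u. h (inv_into U \<phi> u))))"


section \<open>Tangent vectors and differentials\<close>

text \<open>
  Tangent vectors at \<open>x\<close> are the derivations of the algebra of smooth germs at \<open>x\<close>. That a derivation
  depends only on the germ follows from the Leibniz rule, as the indicator function of the complement
  of a neighbourhood of \<open>x\<close> is smooth at \<open>x\<close>. The value \<open>0\<close> at functions not smooth at \<open>x\<close> is a
  convention that makes equality of tangent vectors equality of functionals.
\<close>

type_synonym 'a tangent_vector = "('a \<Rightarrow> real) \<Rightarrow> real"

definition tangent_space :: "'a manifold \<Rightarrow> 'a \<Rightarrow> 'a tangent_vector set" where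
  "tangent_space M x =
     {v. (\<forall>h. \<not> smooth_at M x h \<longrightarrow> v h = 0) \<and>
         (\<forall>h k a b. smooth_at M x h \<and> smooth_at M x k \<longrightarrow>
            v (\<lambda>y. a * h y + b * k y) = a * v h + b * v k) \<and>
         (\<forall>h k. smooth_at M x h \<and> smooth_at M x k \<longrightarrow>
            v (\<lambda>y. h y * k y) = h x * v k + k x * v h)}"

definition differential ::
  "'a manifold \<Rightarrow> 'b manifold \<Rightarrow> ('a \<Rightarrow> 'b) \<Rightarrow> 'a \<Rightarrow> 'a tangent_vector \<Rightarrow> 'b tangent_vector" where
  "differential M N F x v = (\<lambda>h. if smooth_at N (F x) h then v (\<lambda>y. h (F y)) else 0)"

definition immersion_at :: "'a manifold \<Rightarrow> 'b manifold \<Rightarrow> ('a \<Rightarrow> 'b) \<Rightarrow> 'a \<Rightarrow> bool" where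
  "immersion_at M N F x \<longleftrightarrow> inj_on (differential M N F x) (tangent_space M x)"

definition smooth_embedding :: "'a manifold \<Rightarrow> 'b manifold \<Rightarrow> ('a \<Rightarrow> 'b) \<Rightarrow> bool" where
  "smooth_embedding M N j \<longleftrightarrow>
     smooth_map M N j \<and> (\<forall>x\<in>topspace (mtop M). immersion_at M N j x) \<and>
     embedding_map (mtop M) (mtop N) j"

definition coord_vector :: "'a manifold \<Rightarrow> 'a chart \<Rightarrow> 'a \<Rightarrow> nat \<Rightarrow> 'a tangent_vector" where
  "coord_vector M c x i = (case c of (U, \<phi>) \<Rightarrow>
     (\<lambda>h. if smooth_at M x h then partial i (\<lambda>u. h (inv_into U \<phi> u)) (\<phi> x) else 0))"


section \<open>Riemannian metrics and Ricci curvature\<close>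

type_synonym 'a metric = "'a \<Rightarrow> 'a tangent_vector \<Rightarrow> 'a tangent_vector \<Rightarrow> real"

definition metric_coeff ::
  "'a manifold \<Rightarrow> 'a metric \<Rightarrow> 'a chart \<Rightarrow> nat \<Rightarrow> nat \<Rightarrow> (nat \<Rightarrow> real) \<Rightarrow> real" where
  "metric_coeff M g c i j u = (case c of (U, \<phi>) \<Rightarrow>
     (let x = inv_into U \<phi> u in g x (coord_vector M c x i) (coord_vector M c x j)))"

definition riemannian_metric :: "'a manifold \<Rightarrow> 'a metric \<Rightarrow> bool" where
  "riemannian_metric M g \<longleftrightarrow>
     (\<forall>x\<in>topspace (mtop M).
        (\<forall>v\<in>tangent_space M x. \<forall>w\<in>tangent_space M x. g x v w = g x w v) \<and>
        (\<forall>v\<in>tangent_space M x. \<forall>v'\<in>tangent_space M x. \<forall>w\<in>tangent_space M x. \<forall>a b.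
           g x (\<lambda>h. a * v h + b * v' h) w = a * g x v w + b * g x v' w) \<and>
        (\<forall>v\<in>tangent_space M x. v \<noteq> (\<lambda>h. 0) \<longrightarrow> g x v v > 0)) \<and>
     (\<forall>c\<in>charts M. \<forall>i<mdim M. \<forall>j<mdim M.
        smooth_on (mdim M) (snd c ` fst c) (metric_coeff M g c i j))"

definition riemannian_manifold :: "'a manifold \<Rightarrow> 'a metric \<Rightarrow> bool" where
  "riemannian_manifold M g \<longleftrightarrow> smooth_manifold M \<and> riemannian_metric M g"

text \<open>The entries \<open>g\<^sup>i\<^sup>j\<close> of the inverse matrix of \<open>(g\<^sub>i\<^sub>j)\<close>.\<close>

definition inverse_metric ::
  "'a manifold \<Rightarrow> 'a metric \<Rightarrow> 'a chart \<Rightarrow> (nat \<Rightarrow> real) \<Rightarrow> nat \<Rightarrow> nat \<Rightarrow> real" where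
  "inverse_metric M g c u = (THE G.
     (\<forall>i j. i \<ge> mdim M \<or> j \<ge> mdim M \<longrightarrow> G i j = 0) \<and>
     (\<forall>i<mdim M. \<forall>j<mdim M.
        (\<Sum>k<mdim M. G i k * metric_coeff M g c k j u) = (if i = j then 1 else 0)))"

text \<open>\<open>christoffel M g c k i j\<close> is \<open>\<Gamma>\<^sup>k\<^sub>i\<^sub>j\<close> of the Levi-Civita connection: \<open>\<nabla>\<^sub>i \<partial>\<^sub>j = \<Sum>\<^sub>k \<Gamma>\<^sup>k\<^sub>i\<^sub>j \<partial>\<^sub>k\<close>.\<close>

definition christoffel ::
  "'a manifold \<Rightarrow> 'a metric \<Rightarrow> 'a chart \<Rightarrow> nat \<Rightarrow> nat \<Rightarrow> nat \<Rightarrow> (nat \<Rightarrow> real) \<Rightarrow> real" where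
  "christoffel M g c k i j u =
     (\<Sum>l<mdim M. inverse_metric M g c u k l *
        (partial i (metric_coeff M g c j l) u + partial j (metric_coeff M g c i l) u
         - partial l (metric_coeff M g c i j) u)) / 2"

text \<open>
  \<open>curvature_coeff M g c l i j k\<close> is the \<open>\<partial>\<^sub>l\<close>-component of \<open>R(\<partial>\<^sub>i, \<partial>\<^sub>j) \<partial>\<^sub>k\<close>, where
  \<open>R(X, Y) Z = \<nabla>\<^sub>X \<nabla>\<^sub>Y Z - \<nabla>\<^sub>Y \<nabla>\<^sub>X Z - \<nabla>\<^bsub>[X, Y]\<^esub> Z\<close>. The Ricci tensor \<open>Ric(Y, Z)\<close> is the trace of
  \<open>X \<mapsto> R(X, Y) Z\<close>; with these signs round spheres have positive Ricci curvature.
\<close>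

definition curvature_coeff ::
  "'a manifold \<Rightarrow> 'a metric \<Rightarrow> 'a chart \<Rightarrow> nat \<Rightarrow> nat \<Rightarrow> nat \<Rightarrow> nat \<Rightarrow> (nat \<Rightarrow> real) \<Rightarrow> real" where
  "curvature_coeff M g c l i j k u =
     partial i (christoffel M g c l j k) u - partial j (christoffel M g c l i k) u
     + (\<Sum>m<mdim M. christoffel M g c l i m u * christoffel M g c m j k u
                   - christoffel M g c l j m u * christoffel M g c m i k u)"

definition ricci_coeff ::
  "'a manifold \<Rightarrow> 'a metric \<Rightarrow> 'a chart \<Rightarrow> nat \<Rightarrow> nat \<Rightarrow> (nat \<Rightarrow> real) \<Rightarrow> real" where
  "ricci_coeff M g c j k u = (\<Sum>i<mdim M. curvature_coeff M g c i i j k u)"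

text \<open>The components of a tangent vector \<open>v\<close> in a chart are the values of \<open>v\<close> at the coordinate functions.\<close>

definition ricci ::
  "'a manifold \<Rightarrow> 'a metric \<Rightarrow> 'a chart \<Rightarrow> 'a \<Rightarrow> 'a tangent_vector \<Rightarrow> 'a tangent_vector \<Rightarrow> real" where
  "ricci M g c x v w =
     (\<Sum>j<mdim M. \<Sum>k<mdim M.
        ricci_coeff M g c j k (snd c x) * v (\<lambda>y. snd c y j) * w (\<lambda>y. snd c y k))"

text \<open>Since \<^const>\<open>ricci\<close> does not depend on the chart, one could equally ask for some chart around \<open>x\<close>.\<close>

definition positive_ricci_curvature :: "'a manifold \<Rightarrow> 'a metric \<Rightarrow> bool" where
  "positive_ricci_curvature M g \<longleftrightarrow>
     (\<forall>x\<in>topspace (mtop M). \<forall>c\<in>charts M. x \<in> fst c \<longrightarrow>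
        (\<forall>v\<in>tangent_space M x. v \<noteq> (\<lambda>h. 0) \<longrightarrow> ricci M g c x v v > 0))"


section \<open>Isometric immersions and singular genuine rigidity\<close>

definition euclidean_metric :: "nat \<Rightarrow> (nat \<Rightarrow> real) metric" where
  "euclidean_metric m y a b = (\<Sum>k<m. a (\<lambda>z. z k) * b (\<lambda>z. z k))"

text \<open>The possibly degenerate metric on \<open>M\<close> induced by \<open>F : M \<rightarrow> \<real>\<^sup>m\<close>.\<close>

definition induced_metric :: "'a manifold \<Rightarrow> nat \<Rightarrow> ('a \<Rightarrow> nat \<Rightarrow> real) \<Rightarrow> 'a metric" where
  "induced_metric M m F x v w =
     euclidean_metric m (F x)
       (differential M (euclidean_manifold m) F x v) (differential M (euclidean_manifold m) F x w)"

definition isometric_immersion ::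
  "'a manifold \<Rightarrow> 'a metric \<Rightarrow> nat \<Rightarrow> ('a \<Rightarrow> nat \<Rightarrow> real) \<Rightarrow> bool" where
  "isometric_immersion M g m f \<longleftrightarrow>
     smooth_map M (euclidean_manifold m) f \<and>
     (\<forall>x\<in>topspace (mtop M).
        immersion_at M (euclidean_manifold m) f x \<and>
        (\<forall>v\<in>tangent_space M x. \<forall>w\<in>tangent_space M x. induced_metric M m f x v w = g x v w))"

text \<open>
  The points of the extension \<open>N\<close> are taken from \<open>nat \<Rightarrow> real\<close>. This is no restriction, as a second
  countable Hausdorff manifold has at most as many points as there are real numbers.
\<close>

definition singularly_extend_isometrically ::
  "'a manifold \<Rightarrow> nat \<Rightarrow> ('a \<Rightarrow> nat \<Rightarrow> real) \<Rightarrow> nat \<Rightarrow> ('a \<Rightarrow> nat \<Rightarrow> real) \<Rightarrow> bool" where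
  "singularly_extend_isometrically M m f m' f' \<longleftrightarrow>
     (\<exists>(N :: (nat \<Rightarrow> real) manifold) s j F F'.
        smooth_manifold N \<and> s > 0 \<and> mdim N = mdim M + s \<and>
        smooth_embedding M N j \<and>
        smooth_map N (euclidean_manifold m) F \<and> smooth_map N (euclidean_manifold m') F' \<and>
        (\<forall>y\<in>topspace (mtop N). \<forall>v\<in>tangent_space N y. \<forall>w\<in>tangent_space N y.
           induced_metric N m F y v w = induced_metric N m' F' y v w) \<and>
        (\<forall>x\<in>topspace (mtop M). f x = F (j x) \<and> f' x = F' (j x)) \<and>
        (\<forall>y\<in>topspace (mtop N).
           \<not> immersion_at N (euclidean_manifold m) F y \<or> \<not> immersion_at N (euclidean_manifold m') F' y
           \<longrightarrow> y \<in> j ` topspace (mtop M)))"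

text \<open>
  Here \<open>f : M \<rightarrow> \<real>\<^sup>m\<close>. The integer \<open>q\<close> may be negative, but \<open>mdim M + q \<ge> 0\<close> is understood.
\<close>

definition singularly_genuinely_rigid ::
  "'a manifold \<Rightarrow> 'a metric \<Rightarrow> nat \<Rightarrow> ('a \<Rightarrow> nat \<Rightarrow> real) \<Rightarrow> int \<Rightarrow> bool" where
  "singularly_genuinely_rigid M g m f q \<longleftrightarrow>
     (let m' = nat (int (mdim M) + q) in
      \<forall>f'. isometric_immersion M g m' f' \<longrightarrow>
        (\<exists>U. openin (mtop M) U \<and> mtop M closure_of U = topspace (mtop M) \<and>
           singularly_extend_isometrically (open_submanifold M U) m f m' f'))"

end

theory Submission
  imports Defs
begin

text \<open>
  Let \<open>\<alpha>\<close>, \<open>\<alpha>'\<close> be the second fundamental forms of \<open>f\<close> and \<open>f'\<close>. By the Gauss equation the form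
  \<open>\<beta> = (\<alpha>, \<alpha>')\<close>, with values in the sum of the normal spaces with the signature \<open>(p, q)\<close> inner product, is
  flat. As \<open>p + q < n\<close>, each \<open>\<beta>(Y, \<cdot>)\<close> has a nontrivial kernel, and Gaussian elimination gives on some open
  set a nonvanishing solution \<open>Z(x, Y)\<close> of \<open>\<beta>(Y, Z) = 0\<close> depending smoothly on the point \<open>x\<close> and on \<open>Y\<close>.
  Differentiating in \<open>Y\<close> and using flatness, \<open>\<beta>(\<cdot>, Z)\<close> is null, i.e. \<open>\<alpha>(\<cdot>, Z)\<close> and \<open>\<alpha>'(\<cdot>, Z)\<close> have the
  same inner products. Hence \<open>F(x, t) = f(x) + t f\<^sub>*Z(x)\<close> and \<open>F'(x, t) = f'(x) + t f'\<^sub>*Z(x)\<close> induce the same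
  metric. Positive Ricci curvature gives \<open>\<alpha>(Z, Z) \<noteq> 0 \<noteq> \<alpha>'(Z, Z)\<close>, so that \<open>F\<close> and \<open>F'\<close> are immersions for
  small \<open>t \<noteq> 0\<close>. Disjoint coordinate pieces with such fields \<open>Z\<close> have a dense union.
\<close>

section \<open>Calculus on open subsets of Euclidean space\<close>

text \<open>The second fundamental forms take values in normal bundles, for which no smooth frames
  are chosen. All equations are written in ambient components instead:
  \<open>\<beta>(Y, Z) = 0\<close> says that the second derivatives of both immersions in the
  directions \<open>Y\<close>, \<open>Z\<close> are tangent, and the tangential coefficients join
  \<open>Z\<close> as unknowns. These are 3n unknowns against (n + p) + (n + q) scalar equations,
  and q < n - p is exactly the inequality that leaves a nonzero solution. The vector
  \<open>Y\<close> stays variable until the equation has been differentiated: if \<open>V\<close> is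
  a derivative of \<open>Z\<close> in \<open>Y\<close>, then
  \<open>\<beta>(X, Z) = - \<beta>(Y, V)\<close>, and flatness turns the product of
  \<open>\<beta>(Y, V)\<close> and \<open>\<beta>(X', Z)\<close> into that of
  \<open>\<beta>(X', V)\<close> and \<open>\<beta>(Y, Z) = 0\<close>. Then \<open>Y\<close> is
  frozen. Along t = 0 the t-derivative of \<open>F\<close> is tangent to \<open>f\<close>, so
  \<open>F\<close> is singular there. The combination of derivatives of \<open>F\<close> that
  vanishes at t = 0 is t times a vector whose normal part is \<alpha>(Z, Z); replacing the
  t-derivative by this vector gives a frame that survives at t = 0. Each generic step shrinks the
  open set, which is harmless because only a dense union is wanted.\<close>

definition espace :: "nat \<Rightarrow> (nat \<Rightarrow> real) set" where
  "espace m = {x. \<forall>i\<ge>m. x i = 0}"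

lemma topspace_espace: "topspace (Euclidean_space m) = espace m"
  by (simp add: topspace_Euclidean_space espace_def)

lemma Euclidean_space_top_of_set: "Euclidean_space m = top_of_set (espace m)"
  by (simp add: Euclidean_space_def euclidean_product_topology espace_def)

abbreviation eopen :: "nat \<Rightarrow> (nat \<Rightarrow> real) set \<Rightarrow> bool" where
  "eopen m \<equiv> openin (Euclidean_space m)"

lemma espace_upd: "x \<in> espace m \<Longrightarrow> i < m \<Longrightarrow> x(i := t) \<in> espace m"
  by (simp add: espace_def)

lemma eopen_subset: "eopen m S \<Longrightarrow> S \<subseteq> espace m"
  using openin_subset topspace_espace by blast

lemma eopen_espace: "eopen m (espace m)"
  by (metis openin_topspace topspace_espace)

lemma continuous_on_coord: "continuous_on S (\<lambda>u. u i :: real)"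
  by (rule continuous_on_product_coordinates [THEN continuous_on_subset]) auto

lemma open_box: "open {w::nat \<Rightarrow> real. \<forall>i<m. \<bar>w i - u i\<bar> < e}"
proof -
  have "{w::nat \<Rightarrow> real. \<forall>i<m. \<bar>w i - u i\<bar> < e} = (\<Inter>i\<in>{..<m}. {w. \<bar>w i - u i\<bar> < e})"
    by auto
  moreover have "open {w::nat \<Rightarrow> real. \<bar>w i - u i\<bar> < e}" for i
    by (intro open_Collect_less continuous_intros continuous_on_coord)
  ultimately show ?thesis by auto
qed

text \<open>Within \<open>espace m\<close> the coordinates from \<open>m\<close> on are fixed at 0,
  so a basic product neighbourhood contains a box in the first \<open>m\<close> coordinates.\<close>

lemma eopen_box:
  "eopen m S \<longleftrightarrow> S \<subseteq> espace m \<and>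
     (\<forall>u\<in>S. \<exists>e>0. \<forall>w\<in>espace m. (\<forall>i<m. \<bar>w i - u i\<bar> < e) \<longrightarrow> w \<in> S)"
proof (intro iffI conjI ballI)
  assume S: "eopen m S"
  show "S \<subseteq> espace m" using S by (rule eopen_subset)
  obtain T where T: "open T" "S = T \<inter> espace m"
    using S by (auto simp: Euclidean_space_top_of_set openin_open)
  fix u assume u: "u \<in> S"
  have uT: "openin (product_topology (\<lambda>i. euclidean) UNIV) T"
    using T(1) by (simp add: euclidean_product_topology)
  obtain X where X: "u \<in> Pi\<^sub>E UNIV X" "\<And>i. open (X i)" "Pi\<^sub>E UNIV X \<subseteq> T"
    using product_topology_open_contains_basis[OF uT, of u] u T by auto
  have "\<exists>e>0. \<forall>t. \<bar>t - u i\<bar> < e \<longrightarrow> t \<in> X i" for i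
    using X(1,2) unfolding open_dist dist_real_def by auto
  then obtain e where e: "\<And>i. e i > 0" "\<And>i t. \<bar>t - u i\<bar> < e i \<Longrightarrow> t \<in> X i" by metis
  \<comment> \<open>The inserted 1 keeps the set nonempty when m = 0.\<close>
  define d where "d = Min (insert 1 (e ` {..<m}))"
  have d: "d > 0" "\<And>i. i < m \<Longrightarrow> d \<le> e i"
    using e(1) by (auto simp: d_def)
  show "\<exists>e>0. \<forall>w\<in>espace m. (\<forall>i<m. \<bar>w i - u i\<bar> < e) \<longrightarrow> w \<in> S"
  proof (intro exI conjI ballI impI)
    show "d > 0" by fact
    fix w assume w: "w \<in> espace m" "\<forall>i<m. \<bar>w i - u i\<bar> < d"
    have "w i \<in> X i" for i
    proof (cases "i < m")
      case True then show ?thesis using w d e by (meson less_le_trans)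
    next
      case False
      then have "w i = u i" using w(1) u T by (auto simp: espace_def)
      then show ?thesis using X(1) by auto
    qed
    then show "w \<in> S" using X(3) T w by auto
  qed
next
  assume R: "S \<subseteq> espace m \<and> (\<forall>u\<in>S. \<exists>e>0. \<forall>w\<in>espace m. (\<forall>i<m. \<bar>w i - u i\<bar> < e) \<longrightarrow> w \<in> S)"
  then obtain e where e: "\<And>u. u \<in> S \<Longrightarrow> e u > 0"
    "\<And>u w. u \<in> S \<Longrightarrow> w \<in> espace m \<Longrightarrow> (\<forall>i<m. \<bar>w i - u i\<bar> < e u) \<Longrightarrow> w \<in> S"
    by metis
  define T where "T = (\<Union>u\<in>S. {w. \<forall>i<m. \<bar>w i - u i\<bar> < e u})"
  have "open T" unfolding T_def by (intro open_UN ballI open_box)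
  moreover have "S = espace m \<inter> T" using R e by (auto simp: T_def)
  ultimately show "eopen m S" by (auto simp: Euclidean_space_top_of_set openin_open)
qed

lemma Euclidean_space_continuous_iff:
  assumes "S \<subseteq> espace m"
  shows "continuous_map (subtopology (Euclidean_space m) S) euclideanreal h \<longleftrightarrow> continuous_on S h"
proof -
  have "espace m \<inter> S = S" using assms by auto
  then show ?thesis
    by (simp add: Euclidean_space_top_of_set subtopology_subtopology)
qed

lemma eopen_Collect_neq:
  fixes h :: "(nat \<Rightarrow> real) \<Rightarrow> real"
  assumes "eopen m S" "continuous_on S h"
  shows "eopen m {u\<in>S. h u \<noteq> 0}"
proof -
  have "openin (top_of_set S) (S \<inter> h -` (-{0}))"
    by (rule continuous_openin_preimage_gen[OF assms(2)]) auto
  moreover have "S \<inter> h -` (-{0}) = {u\<in>S. h u \<noteq> 0}" by auto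
  ultimately show ?thesis
    using assms(1) by (metis Euclidean_space_top_of_set openin_trans)
qed

text \<open>Connects open sets of \<open>\<real>\<^sup>m\<close> with filters on the real line, so
  that one-variable derivatives depend only on the values on the open set.\<close>

lemma eopen_upd_eventually:
  assumes "eopen m S" "u \<in> S" "i < m"
  shows "\<forall>\<^sub>F t in nhds (u i). u(i := t) \<in> S"
proof -
  obtain e where e: "e > 0" "\<And>w. w\<in>espace m \<Longrightarrow> (\<forall>i<m. \<bar>w i - u i\<bar> < e) \<Longrightarrow> w \<in> S"
    using assms(1,2) unfolding eopen_box by metis
  have "u \<in> espace m" using assms eopen_subset by auto
  then show ?thesis
    unfolding eventually_nhds_metric dist_real_def
    using e assms(3) espace_upd by (intro exI[of _ e]) auto
qed

section \<open>Partial derivatives and the classes \<open>Ck_on\<close>\<close>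

text \<open>Relational counterpart of \<open>partial\<close>: it includes differentiability, which
  the total function \<open>deriv\<close> hides, and so the rules of calculus become introduction
  rules.\<close>

definition has_partial :: "nat \<Rightarrow> ((nat \<Rightarrow> real) \<Rightarrow> real) \<Rightarrow> real \<Rightarrow> (nat \<Rightarrow> real) \<Rightarrow> bool" where
  "has_partial i h D u \<longleftrightarrow> ((\<lambda>t. h (u(i := t))) has_real_derivative D) (at (u i))"

lemma partialI: "has_partial i h D u \<Longrightarrow> partial i h u = D"
  by (simp add: has_partial_def partial_def DERIV_imp_deriv)

lemma has_partial_partial:
  "(\<lambda>t. h (u(i := t))) differentiable at (u i) \<longleftrightarrow> has_partial i h (partial i h u) u"
  unfolding has_partial_def partial_def
  by (metis DERIV_imp_deriv real_differentiable_def)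

lemma has_partial_cong:
  assumes "eopen m S" "u \<in> S" "i < m" "\<And>w. w \<in> S \<Longrightarrow> h w = h' w"
  shows "has_partial i h D u \<longleftrightarrow> has_partial i h' D u"
  unfolding has_partial_def
  by (rule DERIV_cong_ev)
     (use eventually_mono[OF eopen_upd_eventually[OF assms(1-3)]] assms(4) in auto)

lemma partial_cong:
  assumes "eopen m S" "u \<in> S" "i < m" "\<And>w. w \<in> S \<Longrightarrow> h w = h' w"
  shows "partial i h u = partial i h' u"
  unfolding partial_def
  by (rule deriv_cong_ev)
     (use eventually_mono[OF eopen_upd_eventually[OF assms(1-3)]] assms(4) in auto)

lemma has_partial_const: "has_partial i (\<lambda>u. c) 0 u"
  by (simp add: has_partial_def)

lemma has_partial_coord: "has_partial i (\<lambda>u. u k) (if k = i then 1 else 0) u"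
  by (simp add: has_partial_def)

lemma has_partial_add:
  "has_partial i h D u \<Longrightarrow> has_partial i k E u \<Longrightarrow> has_partial i (\<lambda>u. h u + k u) (D + E) u"
  unfolding has_partial_def by (rule DERIV_add)

lemma has_partial_diff:
  "has_partial i h D u \<Longrightarrow> has_partial i k E u \<Longrightarrow> has_partial i (\<lambda>u. h u - k u) (D - E) u"
  unfolding has_partial_def by (rule DERIV_diff)

lemma has_partial_mult:
  "has_partial i h D u \<Longrightarrow> has_partial i k E u \<Longrightarrow>
   has_partial i (\<lambda>u. h u * k u) (D * k u + E * h u) u"
  unfolding has_partial_def by (drule (1) DERIV_mult) simp

lemma has_partial_inverse:
  "has_partial i h D u \<Longrightarrow> h u \<noteq> 0 \<Longrightarrow>
   has_partial i (\<lambda>u. inverse (h u)) (- (D * (inverse (h u) * inverse (h u)))) u"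
  unfolding has_partial_def
  by (drule DERIV_inverse_fun) (auto simp: algebra_simps)

lemma has_partial_sum:
  "(\<And>k. k \<in> A \<Longrightarrow> has_partial i (h k) (D k) u) \<Longrightarrow>
   has_partial i (\<lambda>u. \<Sum>k\<in>A. h k u) (\<Sum>k\<in>A. D k) u"
  unfolding has_partial_def by (rule DERIV_sum)

lemma Ck_on_Suc:
  assumes "S \<subseteq> espace m"
  shows "Ck_on (Suc k) m S h \<longleftrightarrow> continuous_on S h \<and>
    (\<forall>i<m. (\<forall>u\<in>S. has_partial i h (partial i h u) u) \<and> Ck_on k m S (partial i h))"
  using assms by (simp add: Euclidean_space_continuous_iff has_partial_partial)

lemma Ck_on_continuous: "S \<subseteq> espace m \<Longrightarrow> Ck_on k m S h \<Longrightarrow> continuous_on S h"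
  by (cases k) (simp_all add: Euclidean_space_continuous_iff)

lemma Ck_on_mono: "Ck_on (Suc k) m S h \<Longrightarrow> Ck_on k m S h"
  by (induction k arbitrary: h) auto

lemma Ck_on_cong:
  assumes "eopen m S" "\<And>w. w \<in> S \<Longrightarrow> h w = h' w" "Ck_on k m S h"
  shows "Ck_on k m S h'"
  using assms(2,3)
proof (induction k arbitrary: h h')
  case 0
  have "continuous_on S h \<longleftrightarrow> continuous_on S h'" using 0 by (intro continuous_on_cong) auto
  then show ?case using 0 eopen_subset[OF assms(1)] by (simp add: Euclidean_space_continuous_iff)
next
  case (Suc k)
  note h = Suc.prems(2)[unfolded Ck_on_Suc[OF eopen_subset[OF assms(1)]]]
  have eq: "partial i h u = partial i h' u" if "i < m" "u \<in> S" for i u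
    using partial_cong[OF assms(1)] that Suc by blast
  have "continuous_on S h'"
    using h Suc.prems(1) continuous_on_cong[of S S h h'] by blast
  moreover have "has_partial i h' (partial i h' u) u" if "i < m" "u \<in> S" for i u
    using has_partial_cong[OF assms(1) that(2,1), where h = h and h' = h' and D = "partial i h u"]
      eq that h Suc.prems(1) by auto
  moreover have "Ck_on k m S (partial i h')" if "i < m" for i
    by (rule Suc.IH[of "partial i h"]) (use h eq that in auto)
  ultimately show ?case
    by (simp only: Ck_on_Suc[OF eopen_subset[OF assms(1)]]) blast
qed

lemma Ck_on_subset:
  assumes "S \<subseteq> espace m" "T \<subseteq> S" "Ck_on k m S h"
  shows "Ck_on k m T h"
proof -
  have "T \<subseteq> espace m" using assms by auto
  then show ?thesis using assms(3)
  proof (induction k arbitrary: h)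
    case 0 then show ?case using assms
      by (auto simp: Euclidean_space_continuous_iff intro: continuous_on_subset)
  next
    case (Suc k)
    then show ?case
      using assms by (simp only: Ck_on_Suc) (blast intro: continuous_on_subset)
  qed
qed

lemma continuous_on_eopen_local:
  fixes h :: "(nat \<Rightarrow> real) \<Rightarrow> real"
  assumes "\<And>u. u \<in> S \<Longrightarrow> \<exists>T. eopen m T \<and> u \<in> T \<and> T \<subseteq> S \<and> continuous_on T h"
  shows "continuous_on S h"
  unfolding continuous_on_eq_continuous_within
proof
  fix u assume "u \<in> S"
  then obtain T where T: "eopen m T" "u \<in> T" "T \<subseteq> S" "continuous_on T h" using assms by blast
  obtain W where W: "open W" "T = espace m \<inter> W"
    using T(1) by (auto simp: Euclidean_space_top_of_set openin_open)
  have "S \<subseteq> espace m"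
    using assms by (meson eopen_subset subsetD subsetI)
  then have "S \<inter> W = T \<inter> W" using W T by auto
  have "continuous (at u within T) h"
    using T by (simp add: continuous_on_eq_continuous_within)
  then have "continuous (at u within S) h"
    unfolding continuous_within
    using Lim_transform_within_set[of h "h u" u T S] T W \<open>S \<inter> W = T \<inter> W\<close>
    by (metis IntE at_within_nhd)
  then show "continuous (at u within S) h" .
qed

text \<open>For gluing: on a union of disjoint chart pieces the maps are given by a different
  formula on each piece.\<close>

lemma Ck_on_local:
  assumes "\<And>u. u \<in> S \<Longrightarrow> \<exists>T. eopen m T \<and> u \<in> T \<and> T \<subseteq> S \<and> Ck_on k m T h"
  shows "Ck_on k m S h"
proof -
  have S: "S \<subseteq> espace m"
    using assms by (meson eopen_subset subsetD subsetI)
  have ccase: "continuous_on S h"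
    if "\<And>u. u \<in> S \<Longrightarrow> \<exists>T. eopen m T \<and> u \<in> T \<and> T \<subseteq> S \<and> Ck_on k m T h" for k h
    using that by (metis continuous_on_eopen_local eopen_subset Ck_on_continuous)
  show ?thesis using assms
  proof (induction k arbitrary: h)
    case 0
    then show ?case using ccase[of 0 h] S by (simp add: Euclidean_space_continuous_iff)
  next
    case (Suc k)
    show ?case
      unfolding Ck_on_Suc[OF S]
    proof (intro conjI allI impI ballI)
      show "continuous_on S h" using Suc.prems by (rule ccase)
      fix i assume i: "i < m"
      show "has_partial i h (partial i h u) u" if "u \<in> S" for u
        using Suc.prems[OF that] i Ck_on_Suc eopen_subset by metis
      show "Ck_on k m S (partial i h)"
        by (rule Suc.IH) (metis Suc.prems i Ck_on_Suc eopen_subset)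
    qed
  qed
qed

text \<open>Lets an induction on the order use any convenient formula \<open>D\<close> for the
  derivatives: it agrees with \<open>partial\<close> on the open set, and \<open>Ck_on\<close> does
  not see the difference.\<close>

lemma Ck_on_SucI:
  assumes S: "eopen m S" and "continuous_on S h"
    and D: "\<And>i u. i < m \<Longrightarrow> u \<in> S \<Longrightarrow> has_partial i h (D i u) u"
    and C: "\<And>i. i < m \<Longrightarrow> Ck_on k m S (D i)"
  shows "Ck_on (Suc k) m S h"
proof -
  have "Ck_on k m S (partial i h)" if "i < m" for i
    by (rule Ck_on_cong[OF S _ C[OF that]]) (use D partialI that in metis)
  then show ?thesis
    using assms eopen_subset[OF S] partialI by (auto simp only: Ck_on_Suc) (metis partialI)
qed

lemma Ck_on_const: "eopen m S \<Longrightarrow> Ck_on k m S (\<lambda>u. c)"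
proof (induction k arbitrary: c)
  case 0 then show ?case using eopen_subset[of m S] by (simp add: Euclidean_space_continuous_iff)
next
  case (Suc k) then show ?case
    by (intro Ck_on_SucI[where D = "\<lambda>i u. 0"]) (auto intro: has_partial_const)
qed

lemma Ck_on_coord: "eopen m S \<Longrightarrow> Ck_on k m S (\<lambda>u. u j)"
proof (induction k)
  case 0 then show ?case
    using eopen_subset[of m S] by (simp add: Euclidean_space_continuous_iff continuous_on_coord)
next
  case (Suc k) then show ?case
    by (intro Ck_on_SucI[where D = "\<lambda>i u. if j = i then 1 else 0"]
        has_partial_coord Ck_on_const continuous_on_coord)
qed

lemma Ck_on_add: "eopen m S \<Longrightarrow> Ck_on k m S h \<Longrightarrow> Ck_on k m S h' \<Longrightarrow> Ck_on k m S (\<lambda>u. h u + h' u)"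
proof (induction k arbitrary: h h')
  case 0 then show ?case
    using eopen_subset[of m S] by (auto simp: Euclidean_space_continuous_iff intro: continuous_intros)
next
  case (Suc k)
  note S = eopen_subset[OF Suc.prems(1)]
  note h = Suc.prems(2,3)[unfolded Ck_on_Suc[OF S]]
  show ?case
  proof (rule Ck_on_SucI[OF Suc.prems(1), where D = "\<lambda>i u. partial i h u + partial i h' u"])
    show "continuous_on S (\<lambda>u. h u + h' u)" using h by (intro continuous_on_add) auto
    show "has_partial i (\<lambda>u. h u + h' u) (partial i h u + partial i h' u) u" if "i < m" "u \<in> S" for i u
      using h that by (intro has_partial_add) auto
    show "Ck_on k m S (\<lambda>u. partial i h u + partial i h' u)" if "i < m" for i
      using h that by (intro Suc.IH Suc.prems(1)) auto
  qed
qed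

lemma Ck_on_mult: "eopen m S \<Longrightarrow> Ck_on k m S h \<Longrightarrow> Ck_on k m S h' \<Longrightarrow> Ck_on k m S (\<lambda>u. h u * h' u)"
proof (induction k arbitrary: h h')
  case 0 then show ?case
    using eopen_subset[of m S] by (auto simp: Euclidean_space_continuous_iff intro: continuous_intros)
next
  case (Suc k)
  note S = eopen_subset[OF Suc.prems(1)]
  note lower = Ck_on_mono[OF Suc.prems(2)] Ck_on_mono[OF Suc.prems(3)]
  note h = Suc.prems(2,3)[unfolded Ck_on_Suc[OF S]]
  show ?case
  proof (rule Ck_on_SucI[OF Suc.prems(1), where D = "\<lambda>i u. partial i h u * h' u + partial i h' u * h u"])
    show "continuous_on S (\<lambda>u. h u * h' u)" using h by (intro continuous_on_mult) auto
    show "has_partial i (\<lambda>u. h u * h' u) (partial i h u * h' u + partial i h' u * h u) u"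
      if "i < m" "u \<in> S" for i u
      using h that by (intro has_partial_mult) auto
    show "Ck_on k m S (\<lambda>u. partial i h u * h' u + partial i h' u * h u)" if "i < m" for i
      using h that by (intro Ck_on_add Suc.IH Suc.prems(1) lower) auto
  qed
qed

lemma Ck_on_inverse:
  "eopen m S \<Longrightarrow> Ck_on k m S h \<Longrightarrow> (\<And>u. u \<in> S \<Longrightarrow> h u \<noteq> 0) \<Longrightarrow> Ck_on k m S (\<lambda>u. inverse (h u))"
proof (induction k arbitrary: h)
  case 0 then show ?case
    using eopen_subset[of m S] by (auto simp: Euclidean_space_continuous_iff intro: continuous_intros)
next
  case (Suc k)
  note S = eopen_subset[OF Suc.prems(1)]
  have inv: "Ck_on k m S (\<lambda>u. inverse (h u))"
    using Suc Ck_on_mono by blast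
  have D: "Ck_on k m S (partial i h)" if "i < m" for i using Suc.prems that by simp
  show ?case
  \<comment> \<open>The sign is written as a factor so that \<open>Ck_on_const\<close> and
    \<open>Ck_on_mult\<close> cover it.\<close>
  proof (rule Ck_on_SucI[where D = "\<lambda>i u. - 1 * (partial i h u * (inverse (h u) * inverse (h u)))"])
    show "continuous_on S (\<lambda>u. inverse (h u))"
      by (rule Ck_on_continuous[OF S inv])
    show "has_partial i (\<lambda>u. inverse (h u)) (-1 * (partial i h u * (inverse (h u) * inverse (h u)))) u"
      if "i < m" "u \<in> S" for i u
      using has_partial_inverse[of i h "partial i h u" u] Suc.prems that S by (simp add: Ck_on_Suc del: Ck_on.simps)
    show "Ck_on k m S (\<lambda>u. - 1 * (partial i h u * (inverse (h u) * inverse (h u))))" if "i < m" for i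
      by (intro Ck_on_mult inv D that Ck_on_const Suc.prems)
  qed (use Suc in auto)
qed

section \<open>Smooth functions\<close>

lemma smooth_on_Ck: "smooth_on m S h \<Longrightarrow> Ck_on k m S h"
  by (simp add: smooth_on_def)

lemma smooth_on_continuous: "eopen m S \<Longrightarrow> smooth_on m S h \<Longrightarrow> continuous_on S h"
  by (rule Ck_on_continuous[OF eopen_subset smooth_on_Ck])

lemma smooth_on_partial: "smooth_on m S h \<Longrightarrow> i < m \<Longrightarrow> smooth_on m S (partial i h)"
  by (metis Ck_on.simps(2) smooth_on_def)

lemma smooth_on_has_partial:
  "eopen m S \<Longrightarrow> smooth_on m S h \<Longrightarrow> i < m \<Longrightarrow> u \<in> S \<Longrightarrow> has_partial i h (partial i h u) u"
  by (metis Ck_on_Suc eopen_subset smooth_on_def)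

lemma smooth_on_cong:
  "eopen m S \<Longrightarrow> smooth_on m S h \<Longrightarrow> (\<And>w. w \<in> S \<Longrightarrow> h w = h' w) \<Longrightarrow> smooth_on m S h'"
  unfolding smooth_on_def using Ck_on_cong by blast

lemma smooth_on_subset: "eopen m S \<Longrightarrow> smooth_on m S h \<Longrightarrow> T \<subseteq> S \<Longrightarrow> smooth_on m T h"
  unfolding smooth_on_def by (meson Ck_on_subset eopen_subset)

lemma smooth_on_local:
  "(\<And>u. u \<in> S \<Longrightarrow> \<exists>T. eopen m T \<and> u \<in> T \<and> T \<subseteq> S \<and> smooth_on m T h) \<Longrightarrow> smooth_on m S h"
  unfolding smooth_on_def by (intro allI Ck_on_local) blast

lemma smooth_on_const: "eopen m S \<Longrightarrow> smooth_on m S (\<lambda>u. c)"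
  unfolding smooth_on_def by (simp add: Ck_on_const)

lemma smooth_on_coord: "eopen m S \<Longrightarrow> smooth_on m S (\<lambda>u. u j)"
  unfolding smooth_on_def by (simp add: Ck_on_coord)

lemma smooth_on_add:
  "eopen m S \<Longrightarrow> smooth_on m S h \<Longrightarrow> smooth_on m S k \<Longrightarrow> smooth_on m S (\<lambda>u. h u + k u)"
  unfolding smooth_on_def by (simp add: Ck_on_add)

lemma smooth_on_mult:
  "eopen m S \<Longrightarrow> smooth_on m S h \<Longrightarrow> smooth_on m S k \<Longrightarrow> smooth_on m S (\<lambda>u. h u * k u)"
  unfolding smooth_on_def by (simp add: Ck_on_mult)

lemma smooth_on_uminus: "eopen m S \<Longrightarrow> smooth_on m S h \<Longrightarrow> smooth_on m S (\<lambda>u. - h u)"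
  using smooth_on_mult[OF _ smooth_on_const[of m S "-1"]] by fastforce

lemma smooth_on_diff:
  "eopen m S \<Longrightarrow> smooth_on m S h \<Longrightarrow> smooth_on m S k \<Longrightarrow> smooth_on m S (\<lambda>u. h u - k u)"
  using smooth_on_add[of m S h "\<lambda>u. - k u"] smooth_on_uminus by fastforce

lemma smooth_on_inverse:
  "eopen m S \<Longrightarrow> smooth_on m S h \<Longrightarrow> (\<And>u. u \<in> S \<Longrightarrow> h u \<noteq> 0) \<Longrightarrow> smooth_on m S (\<lambda>u. inverse (h u))"
  unfolding smooth_on_def by (simp add: Ck_on_inverse)

lemma smooth_on_sum:
  assumes "eopen m S" "\<And>k. k \<in> A \<Longrightarrow> smooth_on m S (h k)"
  shows "smooth_on m S (\<lambda>u. \<Sum>k\<in>A. h k u)"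
  using assms(2)
  by (induction A rule: infinite_finite_induct) (auto intro: smooth_on_const smooth_on_add assms(1))

lemmas smooth_intros = smooth_on_const smooth_on_coord smooth_on_add smooth_on_mult smooth_on_uminus
  smooth_on_diff smooth_on_sum smooth_on_partial

text \<open>Replacing the coordinates from \<open>n\<close> on by constants, and translating the others: this covers the
  shifts of charts, the projections \<open>\<real>\<^sup>m \<rightarrow> \<real>\<^sup>n\<close> and the inclusions of slices.\<close>

definition splice :: "nat \<Rightarrow> (nat \<Rightarrow> real) \<Rightarrow> (nat \<Rightarrow> real) \<Rightarrow> (nat \<Rightarrow> real) \<Rightarrow> nat \<Rightarrow> real" where
  "splice n c Y u = (\<lambda>i. if i < n then u i - c i else Y i)"

abbreviation shift_drop :: "nat \<Rightarrow> (nat \<Rightarrow> real) \<Rightarrow> (nat \<Rightarrow> real) \<Rightarrow> nat \<Rightarrow> real" where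
  "shift_drop n c \<equiv> splice n c (\<lambda>i. 0)"

lemma shift_drop_in_espace: "shift_drop n c u \<in> espace n"
  by (simp add: splice_def espace_def)

lemma splice_upd: "i < n \<Longrightarrow> splice n c Y (u(i := t)) = (splice n c Y u)(i := t - c i)"
  by (auto simp: splice_def)

lemma splice_upd_ge: "i \<ge> n \<Longrightarrow> splice n c Y (u(i := t)) = splice n c Y u"
  by (auto simp: splice_def)

lemma continuous_on_splice: "continuous_on S (splice n c Y)"
  unfolding splice_def
proof (rule continuous_on_coordinatewise_then_product)
  fix i show "continuous_on S (\<lambda>u. if i < n then u i - c i else Y i)"
    by (cases "i < n") (auto intro!: continuous_intros continuous_on_coord)
qed

lemma eopen_splice:
  assumes "eopen m' S" "\<And>u. splice n c Y u \<in> espace m'"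
  shows "eopen m {u\<in>espace m. splice n c Y u \<in> S}"
proof -
  obtain T where T: "open T" "S = espace m' \<inter> T"
    using assms by (auto simp: Euclidean_space_top_of_set openin_open)
  have "openin (top_of_set (espace m)) (espace m \<inter> splice n c Y -` T)"
    by (rule continuous_openin_preimage_gen[OF continuous_on_splice T(1)])
  moreover have "espace m \<inter> splice n c Y -` T = {u\<in>espace m. splice n c Y u \<in> S}"
    using T assms(2) by auto
  ultimately show ?thesis by (simp add: Euclidean_space_top_of_set)
qed

lemma has_partial_splice:
  assumes "has_partial i h D (splice n c Y u)" "i < n"
  shows "has_partial i (\<lambda>u. h (splice n c Y u)) D u"
proof -
  have "((\<lambda>t. h ((splice n c Y u)(i := t))) has_real_derivative D) (at (u i - c i))"
    using assms by (simp add: has_partial_def splice_def)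
  then have "((\<lambda>t. h ((splice n c Y u)(i := t - c i))) has_real_derivative D) (at (u i))"
    using DERIV_shift[of "\<lambda>t. h ((splice n c Y u)(i := t))" D "u i" "- c i"] by simp
  then show ?thesis using assms by (simp add: has_partial_def splice_upd)
qed

lemma has_partial_splice_ge:
  "i \<ge> n \<Longrightarrow> has_partial i (\<lambda>u. h (splice n c Y u)) 0 u"
  by (simp add: has_partial_def splice_upd_ge)

text \<open>The substitution is a translation in the coordinates below \<open>n\<close> and constant
  in the others, so a partial derivative either commutes with it or is 0; no chain rule is
  involved.\<close>

lemma Ck_on_splice:
  assumes S: "eopen m' S" and "n \<le> m'" and E: "\<And>u. splice n c Y u \<in> espace m'"
  shows "Ck_on k m' S h \<Longrightarrow> Ck_on k m {u\<in>espace m. splice n c Y u \<in> S} (\<lambda>u. h (splice n c Y u))"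
proof (induction k arbitrary: h)
  case 0
  have "continuous_on S h" using 0 S eopen_subset by (metis Ck_on_continuous)
  then have "continuous_on {u\<in>espace m. splice n c Y u \<in> S} (\<lambda>u. h (splice n c Y u))"
    by (rule continuous_on_compose2[OF _ continuous_on_splice]) auto
  then show ?case by (simp add: Euclidean_space_continuous_iff)
next
  case (Suc k)
  have "continuous_on S h" using Suc S eopen_subset by (metis Ck_on_continuous)
  then have c: "continuous_on {u\<in>espace m. splice n c Y u \<in> S} (\<lambda>u. h (splice n c Y u))"
    by (rule continuous_on_compose2[OF _ continuous_on_splice]) auto
  show ?case
  proof (rule Ck_on_SucI[OF eopen_splice[OF S E] c,
        where D = "\<lambda>i u. if i < n then partial i h (splice n c Y u) else 0"])
    show "has_partial i (\<lambda>u. h (splice n c Y u)) (if i < n then partial i h (splice n c Y u) else 0) u"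
      if "u \<in> {u\<in>espace m. splice n c Y u \<in> S}" for i u
      using Suc.prems that has_partial_splice has_partial_splice_ge eopen_subset[OF S] \<open>n \<le> m'\<close>
      by (auto simp: Ck_on_Suc simp del: Ck_on.simps)
    show "Ck_on k m {u\<in>espace m. splice n c Y u \<in> S}
            (\<lambda>u. if i < n then partial i h (splice n c Y u) else 0)" for i
      using Suc \<open>n \<le> m'\<close> by (cases "i < n") (auto intro: Ck_on_const eopen_splice[OF S E])
  qed
qed

lemma smooth_on_splice:
  assumes "eopen m' S" "n \<le> m'" "\<And>u. splice n c Y u \<in> espace m'" "smooth_on m' S h"
  shows "smooth_on m {u\<in>espace m. splice n c Y u \<in> S} (\<lambda>u. h (splice n c Y u))"
  using assms(4) Ck_on_splice[OF assms(1-3)] unfolding smooth_on_def by blast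

lemmas smooth_on_shift_drop = smooth_on_splice[OF _ order_refl shift_drop_in_espace]
lemmas eopen_shift_drop = eopen_splice[OF _ shift_drop_in_espace]

section \<open>The chain rule along curves\<close>

lemma MVT_between:
  fixes f :: "real \<Rightarrow> real"
  assumes "\<And>s. min a b \<le> s \<Longrightarrow> s \<le> max a b \<Longrightarrow> (f has_real_derivative f' s) (at s)"
  shows "\<exists>s. min a b \<le> s \<and> s \<le> max a b \<and> f b - f a = (b - a) * f' s"
proof -
  consider "a < b" | "a = b" | "b < a" by linarith
  then show ?thesis
  proof cases
    case 1
    then obtain s where "a < s" "s < b" "f b - f a = (b - a) * f' s"
      using MVT2[of a b f f'] assms by force
    then show ?thesis using 1 by (intro exI[of _ s]) auto
  next
    case 2 then show ?thesis by auto
  next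
    case 3
    then obtain s where "b < s" "s < a" "f a - f b = (a - b) * f' s"
      using MVT2[of b a f f'] assms by force
    then show ?thesis using 3 by (intro exI[of _ s]) (auto simp: algebra_simps)
  qed
qed

lemma tendsto_coordinatewise:
  fixes w :: "'b \<Rightarrow> nat \<Rightarrow> real"
  assumes "\<And>i. ((\<lambda>t. w t i) \<longlongrightarrow> u i) F"
  shows "(w \<longlongrightarrow> u) F"
proof -
  have "limitin (product_topology (\<lambda>i. euclidean) UNIV) w u F"
    using assms by (simp add: limitin_componentwise)
  then show ?thesis by (simp add: euclidean_product_topology)
qed

lemma DERIV_upd:
  assumes "eopen m S" "smooth_on m S h" "i < m" "w(i := s) \<in> S"
  shows "((\<lambda>s. h (w(i := s))) has_real_derivative partial i h (w(i := s))) (at s)"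
  using smooth_on_has_partial[OF assms] by (simp add: has_partial_def)

text \<open>The increment along the curve is split into steps in one coordinate at a time through
  the hybrid points \<open>hyb k t\<close>. Each step is a mean value in one variable, and
  continuity of the partial derivatives gives the limit.\<close>

lemma chain_rule_curve:
  assumes S: "eopen m S" "smooth_on m S h" and \<gamma>: "\<gamma> t0 \<in> S" "\<And>t. \<gamma> t \<in> espace m"
    and d: "\<And>i. i < m \<Longrightarrow> ((\<lambda>t. \<gamma> t i) has_real_derivative \<gamma>' i) (at t0)"
  shows "((\<lambda>t. h (\<gamma> t)) has_real_derivative (\<Sum>i<m. partial i h (\<gamma> t0) * \<gamma>' i)) (at t0)"
proof -
  define u where "u = \<gamma> t0"
  define hyb where "hyb k t = (\<lambda>i. if i < k then \<gamma> t i else u i)" for k t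
  have u: "u \<in> S" "u \<in> espace m" using \<gamma> by (auto simp: u_def)
  obtain e where e: "e > 0" "\<And>w. w\<in>espace m \<Longrightarrow> (\<forall>i<m. \<bar>w i - u i\<bar> < e) \<Longrightarrow> w \<in> S"
    using S(1) u unfolding eopen_box by metis
  have lim: "((\<lambda>t. \<gamma> t i) \<longlongrightarrow> u i) (at t0)" if "i < m" for i
    using DERIV_isCont[OF d[OF that]] by (simp add: isCont_def u_def)
  have near: "\<forall>\<^sub>F t in at t0. \<forall>i<m. \<bar>\<gamma> t i - u i\<bar> < e"
  proof -
    have "\<forall>\<^sub>F t in at t0. \<forall>i\<in>{..<m}. \<bar>\<gamma> t i - u i\<bar> < e"
      using tendstoD[OF lim e(1)] by (intro eventually_ball_finite) (auto simp: dist_real_def)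
    then show ?thesis by (rule eventually_mono) auto
  qed
  have "((\<lambda>t. h (hyb k t)) has_real_derivative (\<Sum>i<k. partial i h u * \<gamma>' i)) (at t0)" if "k \<le> m" for k
    using that
  proof (induction k)
    case 0 show ?case by (simp add: hyb_def)
  next
    case (Suc k)
    then have k: "k < m" by simp
    define w where "w t s = (hyb k t)(k := s)" for t s
    have w1: "w t (\<gamma> t k) = hyb (Suc k) t" and w0: "w t (u k) = hyb k t" for t
      by (auto simp: w_def hyb_def fun_eq_iff less_Suc_eq)
    have hE: "w t s \<in> espace m" for t s
      using \<gamma>(2)[of t] u(2) k by (auto simp: w_def hyb_def espace_def)
    have bound: "\<bar>w t s i - u i\<bar> \<le> \<bar>\<gamma> t i - u i\<bar>"
      if "min (u k) (\<gamma> t k) \<le> s" "s \<le> max (u k) (\<gamma> t k)" for t s i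
      using that by (auto simp: w_def hyb_def min_def max_def split: if_splits)
    have wS: "w t s \<in> S"
      if "\<forall>i<m. \<bar>\<gamma> t i - u i\<bar> < e" "min (u k) (\<gamma> t k) \<le> s" "s \<le> max (u k) (\<gamma> t k)" for t s
      using e(2)[OF hE] bound that by (meson le_less_trans)
    \<comment> \<open>Keeping the neighbourhood condition as a premise inside the existential makes
      an intermediate point available for every \<open>t\<close>, so that \<open>s\<close> can be
      chosen as a function; away from the neighbourhood \<open>u k\<close> serves.\<close>
    have "\<exists>s. min (u k) (\<gamma> t k) \<le> s \<and> s \<le> max (u k) (\<gamma> t k) \<and>
        ((\<forall>i<m. \<bar>\<gamma> t i - u i\<bar> < e) \<longrightarrow>
          h (hyb (Suc k) t) - h (hyb k t) = (\<gamma> t k - u k) * partial k h (w t s))" for t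
    proof (cases "\<forall>i<m. \<bar>\<gamma> t i - u i\<bar> < e")
      case True
      have "\<exists>s. min (u k) (\<gamma> t k) \<le> s \<and> s \<le> max (u k) (\<gamma> t k) \<and>
          h (w t (\<gamma> t k)) - h (w t (u k)) = (\<gamma> t k - u k) * partial k h (w t s)"
      proof (rule MVT_between)
        fix s assume s: "min (u k) (\<gamma> t k) \<le> s" "s \<le> max (u k) (\<gamma> t k)"
        have "(hyb k t)(k := s) \<in> S" using wS[OF True s] by (simp add: w_def)
        from DERIV_upd[OF S k this]
        show "((\<lambda>s. h (w t s)) has_real_derivative partial k h (w t s)) (at s)"
          by (simp add: w_def)
      qed
      then show ?thesis unfolding w0 w1 by blast
    next
      case False
      then show ?thesis by (intro exI[of _ "u k"]) auto
    qed
    then obtain s where s: "\<And>t. min (u k) (\<gamma> t k) \<le> s t" "\<And>t. s t \<le> max (u k) (\<gamma> t k)"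
      "\<And>t. (\<forall>i<m. \<bar>\<gamma> t i - u i\<bar> < e) \<Longrightarrow>
          h (hyb (Suc k) t) - h (hyb k t) = (\<gamma> t k - u k) * partial k h (w t (s t))"
      by metis
    have "((\<lambda>t. w t (s t) i) \<longlongrightarrow> u i) (at t0)" for i
    proof (cases "i < m")
      case True
      have "((\<lambda>t. w t (s t) i - u i) \<longlongrightarrow> 0) (at t0)"
      proof (rule Lim_null_comparison)
        show "\<forall>\<^sub>F t in at t0. norm (w t (s t) i - u i) \<le> \<bar>\<gamma> t i - u i\<bar>"
          using bound s by auto
        show "((\<lambda>t. \<bar>\<gamma> t i - u i\<bar>) \<longlongrightarrow> 0) (at t0)"
          using lim[OF True] tendsto_rabs_zero LIM_zero by blast
      qed
      then show ?thesis by (rule LIM_zero_cancel)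
    next
      case False
      then have "w t (s t) i = u i" for t using hE[of t "s t"] u by (auto simp: espace_def)
      then show ?thesis by simp
    qed
    then have "((\<lambda>t. w t (s t)) \<longlongrightarrow> u) (at t0)"
      by (intro tendsto_coordinatewise) 
    moreover have "\<forall>\<^sub>F t in at t0. w t (s t) \<in> S"
      using near by (rule eventually_mono) (rule wS[OF _ s(1,2)])
    ultimately have "((\<lambda>t. partial k h (w t (s t))) \<longlongrightarrow> partial k h u) (at t0)"
      by (rule continuous_on_tendsto_compose[OF
            smooth_on_continuous[OF S(1) smooth_on_partial[OF S(2) k]] _ u(1)])
    moreover have "((\<lambda>t. (\<gamma> t k - u k) / (t - t0)) \<longlongrightarrow> \<gamma>' k) (at t0)"
      using d[OF k] by (simp add: has_field_derivative_iff u_def)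
    ultimately have L: "((\<lambda>t. partial k h (w t (s t)) * ((\<gamma> t k - u k) / (t - t0))) \<longlongrightarrow> partial k h u * \<gamma>' k) (at t0)"
      by (rule tendsto_mult)
    have t0: "hyb j t0 = u" for j by (auto simp: hyb_def u_def)
    have "((\<lambda>t. h (hyb (Suc k) t) - h (hyb k t)) has_real_derivative partial k h u * \<gamma>' k) (at t0)"
      unfolding has_field_derivative_iff
      by (rule Lim_transform_eventually[OF L]) (rule eventually_mono[OF near], simp add: t0 s(3))
    then show ?case using DERIV_add[OF Suc.IH] k by (fastforce simp: add.commute)
  qed
  from this[of m] have "((\<lambda>t. h (hyb m t)) has_real_derivative (\<Sum>i<m. partial i h u * \<gamma>' i)) (at t0)" by simp
  moreover have "hyb m t = \<gamma> t" for t
    using \<gamma>(2)[of t] u by (auto simp: hyb_def espace_def)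
  ultimately show ?thesis by (simp add: u_def)
qed

section \<open>Symmetry of mixed partial derivatives\<close>

lemma double_difference:
  assumes S: "eopen m S" "smooth_on m S h" and ij: "i < m" "j < m" "i \<noteq> j" and d: "d > 0"
    and box: "u \<in> espace m" "\<And>w. w\<in>espace m \<Longrightarrow> (\<forall>i<m. \<bar>w i - u i\<bar> \<le> d) \<Longrightarrow> w \<in> S"
  shows "\<exists>w\<in>espace m. (\<forall>i<m. \<bar>w i - u i\<bar> \<le> d) \<and>
    h (u(i := u i + d, j := u j + d)) - h (u(i := u i + d)) - (h (u(j := u j + d)) - h u)
      = d * d * partial j (partial i h) w"
proof -
  define P where "P s t = u(i := s, j := t)" for s t
  have PE: "P s t \<in> espace m" for s t using box ij by (simp add: P_def espace_upd)
  have PS: "P s t \<in> S" if "u i \<le> s" "s \<le> u i + d" "u j \<le> t" "t \<le> u j + d" for s t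
    by (rule box(2)[OF PE]) (use that d in \<open>auto simp: P_def\<close>)
  have P': "P s t = (u(j := t))(i := s)" for s t using ij by (auto simp: P_def)
  \<comment> \<open>Mean value theorem in coordinate \<open>i\<close> for the increment in
    coordinate \<open>j\<close>; a second application, in coordinate \<open>j\<close>, follows with
    \<open>D'\<close>.\<close>
  have D: "((\<lambda>s. h (P s (u j + d)) - h (P s (u j))) has_real_derivative
      (partial i h (P s (u j + d)) - partial i h (P s (u j)))) (at s)" if "u i \<le> s" "s \<le> u i + d" for s
    unfolding P' by (intro DERIV_diff DERIV_upd[OF S ij(1)]) (use PS[of s "u j"] PS[of s "u j + d"] that d in \<open>auto simp: P'\<close>)
  obtain s where s: "u i < s" "s < u i + d"
    "h (P (u i + d) (u j + d)) - h (P (u i + d) (u j)) - (h (P (u i) (u j + d)) - h (P (u i) (u j)))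
      = d * (partial i h (P s (u j + d)) - partial i h (P s (u j)))"
    using MVT2[OF _ D, of "u i" "u i + d"] d by auto
  have D': "((\<lambda>t. partial i h (P s t)) has_real_derivative partial j (partial i h) (P s t)) (at t)"
    if "u j \<le> t" "t \<le> u j + d" for t
    unfolding P_def by (intro DERIV_upd[OF S(1) smooth_on_partial[OF S(2) ij(1)] ij(2)])
      (use PS that d s in \<open>auto simp: P_def\<close>)
  obtain t where t: "u j < t" "t < u j + d"
    "partial i h (P s (u j + d)) - partial i h (P s (u j)) = d * partial j (partial i h) (P s t)"
    using MVT2[OF _ D', of "u j" "u j + d"] d by auto
  have P0: "P x (u j) = u(i := x)" for x using ij by (auto simp: P_def)
  have "h (P (u i + d) (u j + d)) - h (u(i := u i + d)) - (h (P (u i) (u j + d)) - h u)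
      = d * d * partial j (partial i h) (P s t)"
    using s(3) unfolding t(3) by (simp add: P0)
  moreover have "P (u i) (u j + d) = u(j := u j + d)" by (simp add: P_def)
  ultimately show ?thesis
    by (intro bexI[of _ "P s t"]) (use s t PE ij in \<open>auto simp: P_def\<close>)
qed

text \<open>The double difference over a small square is symmetric in \<open>i\<close> and
  \<open>j\<close>, so the two mixed derivatives take a common value at points near
  \<open>u\<close>. With \<epsilon> half of the supposed gap at \<open>u\<close>, continuity
  excludes this.\<close>

lemma partial_commute:
  assumes S: "eopen m S" "smooth_on m S h" and ij: "i < m" "j < m" and u: "u \<in> S"
  shows "partial i (partial j h) u = partial j (partial i h) u"
proof (rule ccontr)
  assume ne: "partial i (partial j h) u \<noteq> partial j (partial i h) u"
  define \<epsilon> where "\<epsilon> = \<bar>partial i (partial j h) u - partial j (partial i h) u\<bar> / 2"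
  have eps: "\<epsilon> > 0" using ne by (simp add: \<epsilon>_def)
  have "i \<noteq> j" using ne by auto
  have uE: "u \<in> espace m" using S u eopen_subset by blast
  have *: "\<exists>e>0. \<forall>w\<in>espace m. (\<forall>i<m. \<bar>w i - u i\<bar> < e) \<longrightarrow> w \<in> S \<and> \<bar>k w - k u\<bar> < \<epsilon>"
    if "smooth_on m S k" for k
  proof -
    have "openin (top_of_set S) (S \<inter> k -` (ball (k u) \<epsilon>))"
      by (rule continuous_openin_preimage_gen[OF smooth_on_continuous[OF S(1) that]]) auto
    then have "eopen m (S \<inter> k -` (ball (k u) \<epsilon>))"
      using S(1) by (metis Euclidean_space_top_of_set openin_trans)
    moreover have "u \<in> S \<inter> k -` (ball (k u) \<epsilon>)" using u eps by auto
    ultimately obtain e where "e > 0"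
      "\<And>w. w\<in>espace m \<Longrightarrow> \<forall>i<m. \<bar>w i - u i\<bar> < e \<Longrightarrow> w \<in> S \<inter> k -` (ball (k u) \<epsilon>)"
      unfolding eopen_box by metis
    then show ?thesis by (intro exI[of _ e]) (auto simp: dist_real_def abs_minus_commute)
  qed
  obtain e1 where e1: "e1 > 0" "\<And>w. w\<in>espace m \<Longrightarrow> (\<forall>i<m. \<bar>w i - u i\<bar> < e1) \<Longrightarrow> 
      w \<in> S \<and> \<bar>partial i (partial j h) w - partial i (partial j h) u\<bar> < \<epsilon>"
    using *[of "partial i (partial j h)"] S ij smooth_on_partial by blast
  obtain e2 where e2: "e2 > 0" "\<And>w. w\<in>espace m \<Longrightarrow> (\<forall>i<m. \<bar>w i - u i\<bar> < e2) \<Longrightarrow> 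
      w \<in> S \<and> \<bar>partial j (partial i h) w - partial j (partial i h) u\<bar> < \<epsilon>"
    using *[of "partial j (partial i h)"] S ij smooth_on_partial by blast
  define d where "d = min e1 e2 / 2"
  have d: "d > 0" "d < e1" "d < e2" using e1(1) e2(1) by (auto simp: d_def)
  have box: "w \<in> S" if "w\<in>espace m" "\<forall>i<m. \<bar>w i - u i\<bar> \<le> d" for w
    using that e1(2)[of w] d by force
  obtain w1 where w1: "w1\<in>espace m" "\<forall>i<m. \<bar>w1 i - u i\<bar> \<le> d"
    "h (u(i := u i + d, j := u j + d)) - h (u(i := u i + d)) - (h (u(j := u j + d)) - h u)
      = d * d * partial j (partial i h) w1"
    using double_difference[OF S ij \<open>i \<noteq> j\<close> d(1) uE box] by blast
  obtain w2 where w2: "w2\<in>espace m" "\<forall>i<m. \<bar>w2 i - u i\<bar> \<le> d"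
    "h (u(j := u j + d, i := u i + d)) - h (u(j := u j + d)) - (h (u(i := u i + d)) - h u)
      = d * d * partial i (partial j h) w2"
    using double_difference[OF S ij(2,1) \<open>i \<noteq> j\<close>[symmetric] d(1) uE box] by blast
  have "u(j := u j + d, i := u i + d) = u(i := u i + d, j := u j + d)"
    using \<open>i \<noteq> j\<close> by (simp add: fun_upd_twist)
  then have "d * d * partial i (partial j h) w2 = d * d * partial j (partial i h) w1"
    using w1(3) w2(3) by (smt (verit))
  then have "partial i (partial j h) w2 = partial j (partial i h) w1" using d by simp
  moreover have "\<forall>i<m. \<bar>w2 i - u i\<bar> < e1" using w2(2) d(2) by (meson le_less_trans)
  then have "\<bar>partial i (partial j h) w2 - partial i (partial j h) u\<bar> < \<epsilon>"
    using e1(2) w2(1) by blast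
  moreover have "\<forall>i<m. \<bar>w1 i - u i\<bar> < e2" using w1(2) d(3) by (meson le_less_trans)
  then have "\<bar>partial j (partial i h) w1 - partial j (partial i h) u\<bar> < \<epsilon>"
    using e2(2) w1(1) by blast
  ultimately show False by (simp add: \<epsilon>_def abs_if split: if_splits)
qed

section \<open>Hadamard's lemma with smooth coefficients\<close>

definition segment_point :: "(nat \<Rightarrow> real) \<Rightarrow> (nat \<Rightarrow> real) \<Rightarrow> real \<Rightarrow> nat \<Rightarrow> real" where
  "segment_point y u t = (\<lambda>i. y i + t * (u i - y i))"

definition ebox :: "nat \<Rightarrow> (nat \<Rightarrow> real) \<Rightarrow> real \<Rightarrow> (nat \<Rightarrow> real) set" where
  "ebox m y e = {w\<in>espace m. \<forall>i<m. \<bar>w i - y i\<bar> < e}"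

lemma eopen_ebox: "eopen m (ebox m y e)"
  unfolding ebox_def Euclidean_space_top_of_set openin_open
  using open_box[of m y e] by (intro exI[of _ "{w. \<forall>i<m. \<bar>w i - y i\<bar> < e}"]) auto

lemma segment_point_in_ebox:
  assumes "y \<in> espace m" "u \<in> ebox m y e" "0 \<le> t" "t \<le> 1"
  shows "segment_point y u t \<in> ebox m y e"
proof -
  have "\<bar>t * (u i - y i)\<bar> < e" if "i < m" for i
  proof -
    have "\<bar>t * (u i - y i)\<bar> \<le> 1 * \<bar>u i - y i\<bar>"
      unfolding abs_mult by (rule mult_right_mono) (use assms in auto)
    then show ?thesis using assms that by (auto simp: ebox_def)
  qed
  then show ?thesis using assms by (auto simp: ebox_def segment_point_def espace_def)
qed

text \<open>For \<open>k = 0\<close> and \<open>h\<close> a partial derivative this is the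
  coefficient function in Hadamard's lemma. Differentiating under the integral sign produces a
  further factor \<open>t\<close>, hence the weights \<open>t ^ k\<close>: the family is closed
  under differentiation.\<close>

definition moment :: "(nat \<Rightarrow> real) \<Rightarrow> nat \<Rightarrow> ((nat \<Rightarrow> real) \<Rightarrow> real) \<Rightarrow> (nat \<Rightarrow> real) \<Rightarrow> real" where
  "moment y k h u = integral (cbox 0 1) (\<lambda>t. t ^ k * h (segment_point y u t))"

lemma continuous_on_segment_point:
  assumes "\<And>i. continuous_on A (\<lambda>a. u a i)" "continuous_on A t"
  shows "continuous_on A (\<lambda>a. segment_point y (u a) (t a))"
  unfolding segment_point_def
  by (rule continuous_on_coordinatewise_then_product) (intro continuous_intros assms)

lemma Ck_on_moment:
  assumes y: "y \<in> espace m"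
  shows "Ck_on j m (ebox m y e) h \<Longrightarrow> Ck_on j m (ebox m y e) (moment y k h)"
proof (induction j arbitrary: k h)
  let ?B = "ebox m y e"
  have B: "?B \<subseteq> espace m" by (auto simp: ebox_def)
  have cont: "continuous_on ?B (moment y k h)" if "continuous_on ?B h" for k h
    unfolding moment_def
  proof (rule integral_continuous_on_param)
    have "continuous_on (?B \<times> cbox 0 1) (\<lambda>p. h (segment_point y (fst p) (snd p)))"
    proof (rule continuous_on_compose2[OF that])
      show "continuous_on (?B \<times> cbox 0 1) (\<lambda>p. segment_point y (fst p) (snd p))"
        by (intro continuous_on_segment_point continuous_intros
            continuous_on_product_then_coordinatewise[OF continuous_on_fst])
      show "(\<lambda>p. segment_point y (fst p) (snd p)) ` (?B \<times> cbox 0 1) \<subseteq> ?B"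
        using segment_point_in_ebox[OF y] by auto
    qed
    then show "continuous_on (?B \<times> cbox 0 1) (\<lambda>(u, t). t ^ k * h (segment_point y u t))"
      unfolding case_prod_beta by (intro continuous_intros)
  qed
  case 0
  then show ?case using B cont[of h k] by (simp add: Euclidean_space_continuous_iff)
next
  let ?B = "ebox m y e"
  case (Suc j)
  have B: "?B \<subseteq> espace m" by (auto simp: ebox_def)
  have ch: "continuous_on ?B h" using Ck_on_continuous B Suc.prems by blast
  have cont: "continuous_on ?B (moment y k h)"
  proof -
    have "continuous_on (?B \<times> cbox 0 1) (\<lambda>p. h (segment_point y (fst p) (snd p)))"
    proof (rule continuous_on_compose2[OF ch])
      show "continuous_on (?B \<times> cbox 0 1) (\<lambda>p. segment_point y (fst p) (snd p))"
        by (intro continuous_on_segment_point continuous_intros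
            continuous_on_product_then_coordinatewise[OF continuous_on_fst])
      show "(\<lambda>p. segment_point y (fst p) (snd p)) ` (?B \<times> cbox 0 1) \<subseteq> ?B"
        using segment_point_in_ebox[OF y] by auto
    qed
    then show ?thesis
      unfolding moment_def
      by (intro integral_continuous_on_param) (simp add: case_prod_beta, intro continuous_intros)
  qed
  show ?case
  proof (rule Ck_on_SucI[where D = "\<lambda>i. moment y (Suc k) (partial i h)", OF eopen_ebox cont])
    show "Ck_on j m ?B (moment y (Suc k) (partial i h))" if "i < m" for i
      using Suc that by simp
    fix i u assume i: "i < m" and u: "u \<in> ?B"
    \<comment> \<open>The interval of values of coordinate \<open>i\<close> that keep the point in
      the box; it is the convex parameter set for differentiating under the integral.\<close>
    define W where "W = {s. \<bar>s - y i\<bar> < e}"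
    have W': "W = ball (y i) e" by (auto simp: W_def dist_real_def)
    have uB: "u(i := s) \<in> ?B" if "s \<in> W" for s
      using u i that by (auto simp: W_def ebox_def espace_def)
    have hp: "has_partial i h (partial i h w) w" if "w \<in> ?B" for w
      using Suc.prems Ck_on_Suc[OF B] i that by blast
    have cp: "continuous_on ?B (partial i h)"
      using Suc.prems i Ck_on_continuous[OF B] by (metis Ck_on.simps(2))
    have cs: "continuous_on (W \<times> cbox 0 1) (\<lambda>p. g (segment_point y (u(i := fst p)) (snd p)))"
      if "continuous_on ?B g" for g :: "(nat \<Rightarrow> real) \<Rightarrow> real"
    proof (rule continuous_on_compose2[OF that])
      show "continuous_on (W \<times> cbox 0 1) (\<lambda>p. segment_point y (u(i := fst p)) (snd p))"
      proof (rule continuous_on_segment_point)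
        fix j show "continuous_on (W \<times> cbox 0 1) (\<lambda>p. (u(i := fst p)) j)"
          by (cases "j = i") (auto intro!: continuous_intros)
      qed (intro continuous_intros)
      show "(\<lambda>p. segment_point y (u(i := fst p)) (snd p)) ` (W \<times> cbox 0 1) \<subseteq> ?B"
        using segment_point_in_ebox[OF y] uB by auto
    qed
    have "((\<lambda>s. integral (cbox 0 1) (\<lambda>t. t ^ k * h (segment_point y (u(i := s)) t)))
        has_real_derivative
        integral (cbox 0 1) (\<lambda>t. t ^ Suc k * partial i h (segment_point y (u(i := u i)) t))) (at (u i) within W)"
    proof (rule leibniz_rule_field_derivative)
      fix s t :: real assume s: "s \<in> W" and t: "t \<in> cbox 0 1"
      have L: "segment_point y (u(i := s)) t \<in> ?B"
        using segment_point_in_ebox[OF y uB[OF s]] t by auto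
      define a where "a = y i + t * (s - y i)"
      have "((\<lambda>r. h ((segment_point y (u(i := s)) t)(i := r))) has_real_derivative
          partial i h (segment_point y (u(i := s)) t)) (at a)"
        using hp[OF L] by (simp add: has_partial_def segment_point_def a_def)
      moreover have "((\<lambda>s. y i + t * (s - y i)) has_real_derivative t) (at s)"
        by (auto intro!: derivative_eq_intros)
      ultimately have "((\<lambda>s'. h ((segment_point y (u(i := s)) t)(i := y i + t * (s' - y i))))
          has_real_derivative partial i h (segment_point y (u(i := s)) t) * t) (at s)"
        unfolding a_def by (rule DERIV_chain2)
      moreover have "(segment_point y (u(i := s)) t)(i := y i + t * (s' - y i)) = segment_point y (u(i := s')) t" for s'
        by (auto simp: segment_point_def)
      ultimately have "((\<lambda>s. h (segment_point y (u(i := s)) t)) has_real_derivative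
          partial i h (segment_point y (u(i := s)) t) * t) (at s)" by simp
      then have "((\<lambda>s. t ^ k * h (segment_point y (u(i := s)) t)) has_real_derivative
          t ^ k * (partial i h (segment_point y (u(i := s)) t) * t)) (at s)"
        by (rule DERIV_cmult)
      then show "((\<lambda>s. t ^ k * h (segment_point y (u(i := s)) t)) has_real_derivative
          t ^ Suc k * partial i h (segment_point y (u(i := s)) t)) (at s within W)"
        by (auto intro: has_field_derivative_at_within simp: mult_ac)
    next
      fix s assume s: "s \<in> W"
      have "continuous_on (cbox 0 1) (\<lambda>t. h (segment_point y (u(i := s)) t))"
      proof (rule continuous_on_compose2[OF ch])
        show "continuous_on (cbox 0 1) (\<lambda>t. segment_point y (u(i := s)) t)"
          by (rule continuous_on_segment_point) (rule continuous_intros)+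
        show "segment_point y (u(i := s)) ` cbox 0 1 \<subseteq> ?B"
          using segment_point_in_ebox[OF y uB[OF s]] by auto
      qed
      then show "(\<lambda>t. t ^ k * h (segment_point y (u(i := s)) t)) integrable_on cbox 0 1"
        by (intro integrable_continuous continuous_intros)
    next
      show "continuous_on (W \<times> cbox 0 1) (\<lambda>(s, t). t ^ Suc k * partial i h (segment_point y (u(i := s)) t))"
        unfolding case_prod_beta by (intro continuous_intros cs cp)
      show "u i \<in> W" using u i by (auto simp: ebox_def W_def)
      show "convex W" by (simp add: W')
    qed
    moreover have "open W" by (simp add: W')
    then have "at (u i) within W = at (u i)"
      using u i by (intro at_within_open) (auto simp: W_def ebox_def)
    ultimately show "has_partial i (moment y k h) (moment y (Suc k) (partial i h) u) u"
      unfolding has_partial_def moment_def by (simp only: fun_upd_triv)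
  qed
qed

lemma smooth_on_moment:
  "y \<in> espace m \<Longrightarrow> smooth_on m (ebox m y e) h \<Longrightarrow> smooth_on m (ebox m y e) (moment y k h)"
  unfolding smooth_on_def using Ck_on_moment by blast

lemma moment_center: "moment y 0 h y = h y"
  by (simp add: moment_def segment_point_def)

text \<open>Fundamental theorem of calculus along the segment from \<open>y\<close> to
  \<open>u\<close>, with the chain rule for the integrand.\<close>

lemma hadamard:
  assumes y: "y \<in> espace m" and h: "smooth_on m (ebox m y e) h" and u: "u \<in> ebox m y e"
  shows "h u = h y + (\<Sum>i<m. (u i - y i) * moment y 0 (partial i h) u)"
proof -
  let ?B = "ebox m y e"
  have uE: "u \<in> espace m" using u by (simp add: ebox_def)
  have B: "eopen m ?B" by (rule eopen_ebox)
  have E: "segment_point y u t \<in> espace m" for t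
    using y uE by (auto simp: segment_point_def espace_def)
  have D: "((\<lambda>t. h (segment_point y u t)) has_vector_derivative
      (\<Sum>i<m. partial i h (segment_point y u t) * (u i - y i))) (at t within {0..1})" if "t \<in> {0..1}" for t
  proof -
    have "((\<lambda>t. h (segment_point y u t)) has_real_derivative
      (\<Sum>i<m. partial i h (segment_point y u t) * (u i - y i))) (at t)"
    proof (rule chain_rule_curve[OF B h _ E])
      show "segment_point y u t \<in> ?B" using segment_point_in_ebox[OF y u] that by auto
      show "((\<lambda>t. segment_point y u t i) has_real_derivative u i - y i) (at t)" for i
        unfolding segment_point_def by (auto intro!: derivative_eq_intros)
    qed
    then show ?thesis
      by (meson has_real_derivative_iff_has_vector_derivative has_vector_derivative_at_within)
  qed
  have "((\<lambda>t. \<Sum>i<m. partial i h (segment_point y u t) * (u i - y i)) has_integral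
      h (segment_point y u 1) - h (segment_point y u 0)) {0..1}"
    by (rule fundamental_theorem_of_calculus) (use D in auto)
  moreover have "segment_point y u 1 = u" "segment_point y u 0 = y"
    by (auto simp: segment_point_def)
  ultimately have 1: "integral {0..1} (\<lambda>t. \<Sum>i<m. partial i h (segment_point y u t) * (u i - y i)) = h u - h y"
    by (simp add: integral_unique)
  have c: "continuous_on {0..1} (\<lambda>t. partial i h (segment_point y u t))" if "i < m" for i
  proof (rule continuous_on_compose2[OF smooth_on_continuous[OF B smooth_on_partial[OF h that]]])
    show "continuous_on {0..1} (segment_point y u)"
      by (rule continuous_on_segment_point) (auto intro: continuous_intros)
    show "segment_point y u ` {0..1} \<subseteq> ?B" using segment_point_in_ebox[OF y u] by auto
  qed
  have "integral {0..1} (\<lambda>t. \<Sum>i<m. partial i h (segment_point y u t) * (u i - y i))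
      = (\<Sum>i<m. integral {0..1} (\<lambda>t. partial i h (segment_point y u t) * (u i - y i)))"
    by (rule integral_sum) (auto intro!: integrable_continuous_real continuous_intros c)
  also have "\<dots> = (\<Sum>i<m. (u i - y i) * moment y 0 (partial i h) u)"
    by (simp add: moment_def mult.commute cbox_interval)
  finally show ?thesis using 1 by simp
qed

section \<open>Tangent vectors\<close>

lemma smooth_manifold_chartD:
  assumes "smooth_manifold M" "(U, \<phi>) \<in> charts M"
  shows "openin (mtop M) U" "eopen (mdim M) (\<phi> ` U)" "inj_on \<phi> U"
    "homeomorphic_map (subtopology (mtop M) U) (subtopology (Euclidean_space (mdim M)) (\<phi> ` U)) \<phi>"
proof -
  show 1: "openin (mtop M) U" "eopen (mdim M) (\<phi> ` U)"
    "homeomorphic_map (subtopology (mtop M) U) (subtopology (Euclidean_space (mdim M)) (\<phi> ` U)) \<phi>"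
    using assms unfolding smooth_manifold_def by auto
  have "topspace (subtopology (mtop M) U) = U"
    using openin_subset[OF 1(1)] by auto
  then show "inj_on \<phi> U" using homeomorphic_imp_injective_map[OF 1(3)] by simp
qed

lemma smooth_manifold_transition:
  assumes "smooth_manifold M" "(U, \<phi>) \<in> charts M" "(V, \<psi>) \<in> charts M" "k < mdim M"
  shows "smooth_on (mdim M) (\<phi> ` (U \<inter> V)) (\<lambda>u. \<psi> (inv_into U \<phi> u) k)"
  using assms unfolding smooth_manifold_def by fast

lemma smooth_manifold_chart_exists:
  assumes "smooth_manifold M" "x \<in> topspace (mtop M)"
  shows "\<exists>U \<phi>. (U, \<phi>) \<in> charts M \<and> x \<in> U"
proof -
  have "(\<Union>(U, \<phi>)\<in>charts M. U) = topspace (mtop M)"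
    using assms(1) unfolding smooth_manifold_def by blast
  then have "x \<in> (\<Union>(U, \<phi>)\<in>charts M. U)" using assms(2) by simp
  then obtain c where "c \<in> charts M" "x \<in> (case c of (U, \<phi>) \<Rightarrow> U)" by (rule UN_E)
  then show ?thesis by (cases c) auto
qed

lemma chart_image_eopen:
  assumes "smooth_manifold M" "(U, \<phi>) \<in> charts M" "openin (mtop M) W"
  shows "eopen (mdim M) (\<phi> ` (U \<inter> W))"
proof -
  note c = smooth_manifold_chartD[OF assms(1,2)]
  have "openin (subtopology (mtop M) U) (U \<inter> W)"
    using assms(3) by (auto simp: openin_subtopology)
  then have "openin (subtopology (Euclidean_space (mdim M)) (\<phi> ` U)) (\<phi> ` (U \<inter> W))"
    using homeomorphic_imp_open_map[OF c(4)] unfolding open_map_def by blast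
  then show ?thesis using c(2) by (meson openin_trans_full)
qed

text \<open>\<open>open_submanifold\<close> shrinks chart domains and thereby changes the term
  \<open>inv_into\<close>, though not its values on the smaller image.\<close>

lemma inv_into_subset_eq:
  assumes "inj_on \<phi> U" "V \<subseteq> U" "u \<in> \<phi> ` V"
  shows "inv_into V \<phi> u = inv_into U \<phi> u"
proof -
  obtain x where "x \<in> V" "u = \<phi> x" using assms by auto
  then show ?thesis using assms by (metis inj_on_subset inv_into_f_f subsetD)
qed

lemma smooth_at_const:
  assumes "smooth_manifold M" "x \<in> topspace (mtop M)"
  shows "smooth_at M x (\<lambda>y. c)"
  unfolding smooth_at_def
  using assms chart_image_eopen[OF assms(1)]
  by (intro exI[of _ "topspace (mtop M)"]) (auto intro!: smooth_on_const)

lemma smooth_at_lift2: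
  assumes M: "smooth_manifold M" and "smooth_at M x h" "smooth_at M x k"
    and op: "\<And>S h k. eopen (mdim M) S \<Longrightarrow> smooth_on (mdim M) S h \<Longrightarrow> smooth_on (mdim M) S k \<Longrightarrow>
      smooth_on (mdim M) S (\<lambda>u. b (h u) (k u))"
  shows "smooth_at M x (\<lambda>y. b (h y) (k y))"
proof -
  obtain W W' where W: "openin (mtop M) W" "x \<in> W"
     "\<forall>(U, \<phi>)\<in>charts M. smooth_on (mdim M) (\<phi> ` (U \<inter> W)) (\<lambda>u. h (inv_into U \<phi> u))"
    and W': "openin (mtop M) W'" "x \<in> W'"
     "\<forall>(U, \<phi>)\<in>charts M. smooth_on (mdim M) (\<phi> ` (U \<inter> W')) (\<lambda>u. k (inv_into U \<phi> u))"
    using assms(2,3) unfolding smooth_at_def by blast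
  show ?thesis
    unfolding smooth_at_def
  proof (intro exI conjI)
    show "openin (mtop M) (W \<inter> W')" "x \<in> W \<inter> W'" using W W' by auto
    have "smooth_on (mdim M) (\<phi> ` (U \<inter> (W \<inter> W'))) (\<lambda>u. b (h (inv_into U \<phi> u)) (k (inv_into U \<phi> u)))"
      if c: "(U, \<phi>) \<in> charts M" for U \<phi>
    proof (rule op)
      show "eopen (mdim M) (\<phi> ` (U \<inter> (W \<inter> W')))"
        using chart_image_eopen[OF M c] W W' by blast
      show "smooth_on (mdim M) (\<phi> ` (U \<inter> (W \<inter> W'))) (\<lambda>u. h (inv_into U \<phi> u))"
        by (rule smooth_on_subset[OF chart_image_eopen[OF M c W(1)]]) (use W c in auto)
      show "smooth_on (mdim M) (\<phi> ` (U \<inter> (W \<inter> W'))) (\<lambda>u. k (inv_into U \<phi> u))"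
        by (rule smooth_on_subset[OF chart_image_eopen[OF M c W'(1)]]) (use W' c in auto)
    qed
    then show "\<forall>(U, \<phi>)\<in>charts M. smooth_on (mdim M) (\<phi> ` (U \<inter> (W \<inter> W')))
       (\<lambda>u. b (h (inv_into U \<phi> u)) (k (inv_into U \<phi> u)))" by auto
  qed
qed

lemma smooth_at_mult:
  "smooth_manifold M \<Longrightarrow> smooth_at M x h \<Longrightarrow> smooth_at M x k \<Longrightarrow> smooth_at M x (\<lambda>y. h y * k y)"
  by (rule smooth_at_lift2) (auto intro: smooth_on_mult)

lemma smooth_at_lincomb:
  "smooth_manifold M \<Longrightarrow> smooth_at M x h \<Longrightarrow> smooth_at M x k \<Longrightarrow>
   smooth_at M x (\<lambda>y. a * h y + b * k y)"
  by (rule smooth_at_lift2) (auto intro!: smooth_intros)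

lemma smooth_at_add:
  "smooth_manifold M \<Longrightarrow> smooth_at M x h \<Longrightarrow> smooth_at M x k \<Longrightarrow> smooth_at M x (\<lambda>y. h y + k y)"
  using smooth_at_lincomb[of M x h k 1 1] by simp

lemma smooth_at_sum:
  assumes "smooth_manifold M" "x \<in> topspace (mtop M)" "\<And>i. i \<in> A \<Longrightarrow> smooth_at M x (h i)"
  shows "smooth_at M x (\<lambda>y. \<Sum>i\<in>A. h i y)"
  using assms(3)
  by (induction A rule: infinite_finite_induct) (auto intro: smooth_at_const assms smooth_at_add)

lemma smooth_at_topspace: "smooth_at M x h \<Longrightarrow> x \<in> topspace (mtop M)"
  unfolding smooth_at_def using openin_subset by blast

lemma smooth_at_cong:
  assumes M: "smooth_manifold M" and h: "smooth_at M x h"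
    and W: "openin (mtop M) W" "x \<in> W" "\<And>y. y \<in> W \<Longrightarrow> h y = k y"
  shows "smooth_at M x k"
proof -
  obtain W' where W': "openin (mtop M) W'" "x \<in> W'"
     "\<forall>(U, \<phi>)\<in>charts M. smooth_on (mdim M) (\<phi> ` (U \<inter> W')) (\<lambda>u. h (inv_into U \<phi> u))"
    using h unfolding smooth_at_def by blast
  show ?thesis
    unfolding smooth_at_def
  proof (intro exI conjI)
    show "openin (mtop M) (W \<inter> W')" "x \<in> W \<inter> W'" using W W' by auto
    have "smooth_on (mdim M) (\<phi> ` (U \<inter> (W \<inter> W'))) (\<lambda>u. k (inv_into U \<phi> u))"
      if c: "(U, \<phi>) \<in> charts M" for U \<phi>
    proof (rule smooth_on_cong)
      show "eopen (mdim M) (\<phi> ` (U \<inter> (W \<inter> W')))"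
        using chart_image_eopen[OF M c] W W' by blast
      show "smooth_on (mdim M) (\<phi> ` (U \<inter> (W \<inter> W'))) (\<lambda>u. h (inv_into U \<phi> u))"
        by (rule smooth_on_subset[OF chart_image_eopen[OF M c W'(1)]]) (use W' c in auto)
      show "h (inv_into U \<phi> w) = k (inv_into U \<phi> w)" if "w \<in> \<phi> ` (U \<inter> (W \<inter> W'))" for w
        using that smooth_manifold_chartD(3)[OF M c] W(3) by auto
    qed
    then show "\<forall>(U, \<phi>)\<in>charts M. smooth_on (mdim M) (\<phi> ` (U \<inter> (W \<inter> W'))) (\<lambda>u. k (inv_into U \<phi> u))"
      by auto
  qed
qed

section \<open>Derivations at a point\<close>

lemma tangent_lincomb:
  "v \<in> tangent_space M x \<Longrightarrow> smooth_at M x h \<Longrightarrow> smooth_at M x k \<Longrightarrow>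
   v (\<lambda>y. a * h y + b * k y) = a * v h + b * v k"
  unfolding tangent_space_def by simp

lemma tangent_leibniz:
  "v \<in> tangent_space M x \<Longrightarrow> smooth_at M x h \<Longrightarrow> smooth_at M x k \<Longrightarrow>
   v (\<lambda>y. h y * k y) = h x * v k + k x * v h"
  unfolding tangent_space_def by simp

lemma tangent_not_smooth: "v \<in> tangent_space M x \<Longrightarrow> \<not> smooth_at M x h \<Longrightarrow> v h = 0"
  unfolding tangent_space_def by simp

lemma tangent_const:
  assumes "smooth_manifold M" "x \<in> topspace (mtop M)" "v \<in> tangent_space M x"
  shows "v (\<lambda>y. c) = 0"
proof -
  note s = smooth_at_const[OF assms(1,2)]
  \<comment> \<open>The Leibniz rule for 1 = 1 * 1 doubles the value.\<close>
  have "v (\<lambda>y. 1) = 0" using tangent_leibniz[OF assms(3) s[of 1] s[of 1]] by simp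
  then show ?thesis using tangent_lincomb[OF assms(3) s[of 1] s[of 1], of c 0] by simp
qed

lemma tangent_add:
  "v \<in> tangent_space M x \<Longrightarrow> smooth_at M x h \<Longrightarrow> smooth_at M x k \<Longrightarrow> v (\<lambda>y. h y + k y) = v h + v k"
  using tangent_lincomb[of v M x h k 1 1] by simp

lemma tangent_sum:
  assumes "smooth_manifold M" "x \<in> topspace (mtop M)" "v \<in> tangent_space M x"
    "\<And>i. i \<in> A \<Longrightarrow> smooth_at M x (h i)"
  shows "v (\<lambda>y. \<Sum>i\<in>A. h i y) = (\<Sum>i\<in>A. v (h i))"
  using assms(4)
proof (induction A rule: infinite_finite_induct)
  case (insert a A)
  then have "v (\<lambda>y. h a y + (\<Sum>i\<in>A. h i y)) = v (h a) + v (\<lambda>y. \<Sum>i\<in>A. h i y)"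
    by (intro tangent_add[OF assms(3)] smooth_at_sum[OF assms(1,2)]) auto
  then show ?case using insert by simp
qed (simp_all add: tangent_const[OF assms(1-3)])

text \<open>The difference \<open>h - k\<close> equals its product with the indicator function of the complement of \<open>W\<close>,
  and both factors vanish at \<open>x\<close>.\<close>

lemma tangent_germ:
  assumes M: "smooth_manifold M" and v: "v \<in> tangent_space M x" and h: "smooth_at M x h"
    and W: "openin (mtop M) W" "x \<in> W" "\<And>y. y \<in> W \<Longrightarrow> h y = k y"
  shows "v h = v k"
proof -
  have k: "smooth_at M x k" by (rule smooth_at_cong[OF M h W])
  define z where "z y = (if y \<in> W then 0 else 1 :: real)" for y
  have x: "x \<in> topspace (mtop M)" using h by (rule smooth_at_topspace)
  have chi: "smooth_at M x z"
    by (rule smooth_at_cong[OF M smooth_at_const[OF M x, of 0] W(1,2)]) (simp add: z_def)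
  define d where "d y = 1 * h y + (-1) * k y" for y
  have d: "smooth_at M x d" unfolding d_def by (rule smooth_at_lincomb[OF M h k])
  have "v (\<lambda>y. z y * d y) = 0"
    using tangent_leibniz[OF v chi d] W by (simp add: z_def d_def)
  moreover have "(\<lambda>y. z y * d y) = d" using W by (auto simp: z_def d_def)
  ultimately have "v d = 0" by simp
  moreover have "d = (\<lambda>y. 1 * h y + (-1) * k y)" by (simp add: d_def fun_eq_iff)
  ultimately show ?thesis using tangent_lincomb[OF v h k, of 1 "-1"] by simp
qed

lemma tangent_zero: "(\<lambda>h. 0) \<in> tangent_space M x"
  by (simp add: tangent_space_def)

lemma tangent_space_sum:
  assumes "\<And>i. i \<in> A \<Longrightarrow> v i \<in> tangent_space M x"
  shows "(\<lambda>h. \<Sum>i\<in>A. a i * v i h) \<in> tangent_space M x"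
  unfolding tangent_space_def mem_Collect_eq
proof (intro conjI allI impI; (elim conjE)?)
  fix h assume "\<not> smooth_at M x h"
  then show "(\<Sum>i\<in>A. a i * v i h) = 0"
    using assms tangent_not_smooth by (intro sum.neutral) fastforce
next
  fix h k c d assume hk: "smooth_at M x h" "smooth_at M x k"
  have "(\<Sum>i\<in>A. a i * v i (\<lambda>y. c * h y + d * k y)) = (\<Sum>i\<in>A. a i * (c * v i h + d * v i k))"
    by (intro sum.cong refl arg_cong2[where f = "(*)"] tangent_lincomb[OF assms hk])
  also have "\<dots> = c * (\<Sum>i\<in>A. a i * v i h) + d * (\<Sum>i\<in>A. a i * v i k)"
    by (simp add: algebra_simps sum.distrib sum_distrib_left)
  finally show "(\<Sum>i\<in>A. a i * v i (\<lambda>y. c * h y + d * k y)) = \<dots>" .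
next
  fix h k assume hk: "smooth_at M x h" "smooth_at M x k"
  have "(\<Sum>i\<in>A. a i * v i (\<lambda>y. h y * k y)) = (\<Sum>i\<in>A. a i * (h x * v i k + k x * v i h))"
    by (intro sum.cong refl arg_cong2[where f = "(*)"] tangent_leibniz[OF assms hk])
  also have "\<dots> = h x * (\<Sum>i\<in>A. a i * v i k) + k x * (\<Sum>i\<in>A. a i * v i h)"
    by (simp add: algebra_simps sum.distrib sum_distrib_left)
  finally show "(\<Sum>i\<in>A. a i * v i (\<lambda>y. h y * k y)) = \<dots>" .
qed

section \<open>Coordinate vectors\<close>

lemma smooth_at_chart_coord:
  assumes "smooth_manifold M" "(U, \<phi>) \<in> charts M" "x \<in> U" "j < mdim M"
  shows "smooth_at M x (\<lambda>y. \<phi> y j)"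
  unfolding smooth_at_def
  using smooth_manifold_chartD(1)[OF assms(1,2)] smooth_manifold_transition[OF assms(1) _ assms(2,4)] assms(3)
  by (intro exI[of _ U]) auto

lemma smooth_at_chart:
  assumes M: "smooth_manifold M" and c: "(U, \<phi>) \<in> charts M" and x: "x \<in> U" and h: "smooth_at M x h"
  obtains S where "eopen (mdim M) S" "\<phi> x \<in> S" "S \<subseteq> \<phi> ` U" "smooth_on (mdim M) S (\<lambda>u. h (inv_into U \<phi> u))"
proof -
  obtain W where W: "openin (mtop M) W" "x \<in> W"
     "\<forall>(U, \<phi>)\<in>charts M. smooth_on (mdim M) (\<phi> ` (U \<inter> W)) (\<lambda>u. h (inv_into U \<phi> u))"
    using h unfolding smooth_at_def by blast
  show thesis
    by (rule that[OF chart_image_eopen[OF M c W(1)]]) (use W c x in auto)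
qed

lemma coord_vector_tangent:
  assumes M: "smooth_manifold M" and c: "(U, \<phi>) \<in> charts M" and x: "x \<in> U" and i: "i < mdim M"
  shows "coord_vector M (U, \<phi>) x i \<in> tangent_space M x"
proof -
  let ?r = "\<lambda>h u. h (inv_into U \<phi> u)"
  have cv: "coord_vector M (U, \<phi>) x i h = partial i (?r h) (\<phi> x)" if "smooth_at M x h" for h
    using that by (simp add: coord_vector_def)
  have hp: "has_partial i (?r h) (partial i (?r h) (\<phi> x)) (\<phi> x)" if "smooth_at M x h" for h
    using smooth_at_chart[OF M c x that] smooth_on_has_partial i by metis
  have inv: "inv_into U \<phi> (\<phi> x) = x"
    using smooth_manifold_chartD(3)[OF M c] x by simp
  show ?thesis
    unfolding tangent_space_def mem_Collect_eq
  proof (intro conjI allI impI; (elim conjE)?)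
    fix h assume "\<not> smooth_at M x h"
    then show "coord_vector M (U, \<phi>) x i h = 0" by (simp add: coord_vector_def)
  next
    fix h k a b assume s: "smooth_at M x h" "smooth_at M x k"
    have "has_partial i (\<lambda>u. a * ?r h u + b * ?r k u)
      (0 * ?r h (\<phi> x) + partial i (?r h) (\<phi> x) * a + (0 * ?r k (\<phi> x) + partial i (?r k) (\<phi> x) * b)) (\<phi> x)"
      by (intro has_partial_add has_partial_mult has_partial_const hp s)
    from partialI[OF this] show "coord_vector M (U, \<phi>) x i (\<lambda>y. a * h y + b * k y) =
        a * coord_vector M (U, \<phi>) x i h + b * coord_vector M (U, \<phi>) x i k"
      by (simp add: cv s smooth_at_lincomb[OF M s])
  next
    fix h k assume s: "smooth_at M x h" "smooth_at M x k"
    have "has_partial i (\<lambda>u. ?r h u * ?r k u)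
      (partial i (?r h) (\<phi> x) * ?r k (\<phi> x) + partial i (?r k) (\<phi> x) * ?r h (\<phi> x)) (\<phi> x)"
      by (intro has_partial_mult hp s)
    from partialI[OF this] show "coord_vector M (U, \<phi>) x i (\<lambda>y. h y * k y) =
        h x * coord_vector M (U, \<phi>) x i k + k x * coord_vector M (U, \<phi>) x i h"
      by (simp add: cv s smooth_at_mult[OF M s] inv)
  qed
qed

lemma coord_vector_coord:
  assumes M: "smooth_manifold M" and c: "(U, \<phi>) \<in> charts M" and x: "x \<in> U" and j: "j < mdim M" and i: "i < mdim M"
  shows "coord_vector M (U, \<phi>) x i (\<lambda>y. \<phi> y j) = (if j = i then 1 else 0)"
proof -
  have "partial i (\<lambda>u. \<phi> (inv_into U \<phi> u) j) (\<phi> x) = partial i (\<lambda>u. u j) (\<phi> x)"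
    by (rule partial_cong[OF smooth_manifold_chartD(2)[OF M c]])
       (use x i in \<open>auto simp: f_inv_into_f\<close>)
  then show ?thesis
    using smooth_at_chart_coord[OF M c x j] partialI[OF has_partial_coord[of i j "\<phi> x"]]
    by (simp add: coord_vector_def)
qed

text \<open>The functions smooth near \<open>x\<close> are the same before and after restricting the
  charts to \<open>W\<close>, and the definition of tangent vectors mentions the manifold only
  through them.\<close>

lemma tangent_space_open_submanifold:
  assumes M: "smooth_manifold M" and W: "openin (mtop M) W" "x \<in> W"
  shows "tangent_space (open_submanifold M W) x = tangent_space M x"
proof -
  have "smooth_at (open_submanifold M W) x h \<longleftrightarrow> smooth_at M x h" for h
  proof -
    have cong: "smooth_on (mdim M) (\<phi> ` (U \<inter> V)) (\<lambda>u. h (inv_into (U \<inter> W) \<phi> u)) \<longleftrightarrow>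
        smooth_on (mdim M) (\<phi> ` (U \<inter> V)) (\<lambda>u. h (inv_into U \<phi> u))"
      if c: "(U, \<phi>) \<in> charts M" and V: "openin (mtop M) V" "V \<subseteq> W" for U \<phi> V
    proof -
      have eq: "inv_into (U \<inter> W) \<phi> w = inv_into U \<phi> w" if "w \<in> \<phi> ` (U \<inter> V)" for w
        by (rule inv_into_subset_eq[OF smooth_manifold_chartD(3)[OF M c]]) (use that V in auto)
      show ?thesis
        by (rule iffI; erule smooth_on_cong[OF chart_image_eopen[OF M c V(1)]]) (simp_all add: eq)
    qed
    show ?thesis
    proof
      assume "smooth_at (open_submanifold M W) x h"
      then obtain V where V: "openin (subtopology (mtop M) W) V" "x \<in> V"
        "\<forall>(U, \<phi>)\<in>charts M. smooth_on (mdim M) (\<phi> ` (U \<inter> W \<inter> V)) (\<lambda>u. h (inv_into (U \<inter> W) \<phi> u))"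
        unfolding smooth_at_def open_submanifold_def by (auto simp: case_prod_beta)
      have V': "openin (mtop M) V" "V \<subseteq> W"
        using V(1) W(1) by (auto simp: openin_open_subtopology)
      then have "U \<inter> W \<inter> V = U \<inter> V" for U by auto
      then show "smooth_at M x h"
        unfolding smooth_at_def using V(2,3) V' cong[OF _ V'] by (intro exI[of _ V]) fastforce
    next
      assume "smooth_at M x h"
      then obtain V where V: "openin (mtop M) V" "x \<in> V"
        "\<forall>(U, \<phi>)\<in>charts M. smooth_on (mdim M) (\<phi> ` (U \<inter> V)) (\<lambda>u. h (inv_into U \<phi> u))"
        unfolding smooth_at_def by blast
      have VW: "openin (mtop M) (W \<inter> V)" "W \<inter> V \<subseteq> W" using V W by auto
      have "smooth_on (mdim M) (\<phi> ` (U \<inter> (W \<inter> V))) (\<lambda>u. h (inv_into (U \<inter> W) \<phi> u))"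
        if c: "(U, \<phi>) \<in> charts M" for U \<phi>
        unfolding cong[OF c VW]
        by (rule smooth_on_subset[OF chart_image_eopen[OF M c V(1)]]) (use V c in auto)
      then show "smooth_at (open_submanifold M W) x h"
        unfolding smooth_at_def open_submanifold_def using V W VW
        by (intro exI[of _ "W \<inter> V"]) (auto simp: openin_open_subtopology Int_assoc)
    qed
  qed
  then show ?thesis by (simp add: tangent_space_def)
qed

section \<open>Open subsets of Euclidean space as manifolds\<close>

text \<open>One chart, the identity. The Euclidean targets and the extension are both of this form.
  The name is unrelated to flatness of bilinear forms.\<close>

definition flat :: "nat \<Rightarrow> (nat \<Rightarrow> real) set \<Rightarrow> (nat \<Rightarrow> real) manifold" where
  "flat m S = \<lparr>mtop = subtopology (Euclidean_space m) S, mdim = m, charts = {(S, \<lambda>x. x)}\<rparr>"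

lemma euclidean_manifold_flat: "euclidean_manifold m = flat m (espace m)"
  unfolding euclidean_manifold_def flat_def
  by (metis subtopology_topspace topspace_espace)

lemma inv_into_ident: "u \<in> S \<Longrightarrow> inv_into S (\<lambda>x. x) u = u"
  using f_inv_into_f[of u "\<lambda>x. x" S] by simp

lemma topspace_flat: "eopen m S \<Longrightarrow> topspace (mtop (flat m S)) = S"
  using eopen_subset by (auto simp: flat_def topspace_espace)

lemma openin_flat: "eopen m S \<Longrightarrow> openin (mtop (flat m S)) W \<longleftrightarrow> eopen m W \<and> W \<subseteq> S"
  by (simp add: flat_def openin_open_subtopology)

lemma smooth_manifold_flat:
  assumes S: "eopen m S"
  shows "smooth_manifold (flat m S)"
  unfolding smooth_manifold_def
proof (intro conjI ballI)
  show "Hausdorff_space (mtop (flat m S))"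
    by (simp add: flat_def Euclidean_space_top_of_set Hausdorff_space_subtopology)
  obtain B :: "(nat \<Rightarrow> real) set set" where B: "countable B" "topological_basis B"
    using ex_countable_basis by blast
  show "second_countable (mtop (flat m S))"
    unfolding second_countable_def
  proof (intro exI conjI allI impI ballI)
    let ?A = "espace m \<inter> S"
    have eq: "mtop (flat m S) = top_of_set ?A"
      by (simp add: flat_def Euclidean_space_top_of_set subtopology_subtopology)
    show "countable ((\<lambda>b. ?A \<inter> b) ` B)" using B by auto
    show "openin (mtop (flat m S)) b" if "b \<in> (\<lambda>b. ?A \<inter> b) ` B" for b
      using that topological_basis_open[OF B(2)] by (auto simp: eq)
    fix W x assume W: "openin (mtop (flat m S)) W \<and> x \<in> W"
    then obtain T where T: "open T" "W = ?A \<inter> T" unfolding eq openin_open by blast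
    then obtain b where "b \<in> B" "x \<in> b" "b \<subseteq> T"
      using W topological_basisE[OF B(2), of T x] by blast
    then show "\<exists>b\<in>(\<lambda>b. ?A \<inter> b) ` B. x \<in> b \<and> b \<subseteq> W" using T W by auto
  qed
  show "(\<Union>(U, \<phi>)\<in>charts (flat m S). U) = topspace (mtop (flat m S))"
    unfolding topspace_flat[OF S] by (simp add: flat_def)
next
  fix c assume "c \<in> charts (flat m S)"
  then have c: "c = (S, \<lambda>x. x)" by (simp add: flat_def)
  have "subtopology (mtop (flat m S)) S = subtopology (Euclidean_space m) S"
    by (simp add: flat_def subtopology_subtopology)
  moreover have "homeomorphic_map X X (\<lambda>x. x)" for X :: "(nat \<Rightarrow> real) topology"
    using homeomorphic_map_id[of X] by (simp add: id_def)
  ultimately show "case c of (U, \<phi>) \<Rightarrow> openin (mtop (flat m S)) U \<and>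
      openin (Euclidean_space (mdim (flat m S))) (\<phi> ` U) \<and>
      homeomorphic_map (subtopology (mtop (flat m S)) U)
          (subtopology (Euclidean_space (mdim (flat m S))) (\<phi> ` U)) \<phi>"
    using S by (simp add: c openin_flat) (simp add: flat_def)
next
  fix c assume "c \<in> charts (flat m S)"
  then have c: "c = (S, \<lambda>x. x)" by (simp add: flat_def)
  have "smooth_on m S (\<lambda>u. inv_into S (\<lambda>x. x) u k)" for k
    by (rule smooth_on_cong[OF S smooth_on_coord[OF S]]) (simp add: inv_into_ident)
  then show "case c of (U, \<phi>) \<Rightarrow> \<forall>(V, \<psi>)\<in>charts (flat m S). \<forall>k<mdim (flat m S).
        smooth_on (mdim (flat m S)) (\<phi> ` (U \<inter> V)) (\<lambda>u. \<psi> (inv_into U \<phi> u) k)"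
    by (simp add: c flat_def)
qed

lemma smooth_at_flat:
  assumes S: "eopen m S"
  shows "smooth_at (flat m S) y h \<longleftrightarrow> (\<exists>W. eopen m W \<and> W \<subseteq> S \<and> y \<in> W \<and> smooth_on m W h)"
proof -
  have "smooth_on m (S \<inter> W) (\<lambda>u. h (inv_into S (\<lambda>x. x) u)) \<longleftrightarrow> smooth_on m W h"
    if W: "eopen m W" "W \<subseteq> S" for W
  proof -
    have "S \<inter> W = W" using W by auto
    moreover have "inv_into S (\<lambda>x. x) u = u" if "u \<in> W" for u using W that by (auto simp: inv_into_ident)
    ultimately show ?thesis
      by (simp only:) (rule iffI; erule smooth_on_cong[OF W(1)]; simp)
  qed
  then show ?thesis
    unfolding smooth_at_def openin_flat[OF S] by (auto simp: flat_def)
qed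

lemma smooth_at_euclidean_coord:
  assumes "y \<in> espace m"
  shows "smooth_at (euclidean_manifold m) y (\<lambda>z. z k)"
  unfolding euclidean_manifold_flat smooth_at_flat[OF eopen_espace]
  using assms by (intro exI[of _ "espace m"]) (auto intro: smooth_on_coord eopen_espace)

text \<open>By \<open>tangent_germ\<close> the function may be replaced by its Hadamard expansion.
  In each product the factor \<open>u i - y i\<close> vanishes at \<open>y\<close>, so the Leibniz
  rule leaves the coefficient at \<open>y\<close>, which is the partial derivative.\<close>

lemma tangent_flat_coordinates:
  assumes S: "eopen m S" and y: "y \<in> S" and v: "v \<in> tangent_space (flat m S) y"
    and h: "smooth_at (flat m S) y h"
  shows "v h = (\<Sum>i<m. v (\<lambda>u. u i) * partial i h y)"
proof -
  let ?M = "flat m S"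
  have M: "smooth_manifold ?M" by (rule smooth_manifold_flat[OF S])
  have yt: "y \<in> topspace (mtop ?M)" using y topspace_flat[OF S] by simp
  obtain W where W: "eopen m W" "W \<subseteq> S" "y \<in> W" "smooth_on m W h"
    using h unfolding smooth_at_flat[OF S] by blast
  obtain e where e: "e > 0" "\<And>w. w\<in>espace m \<Longrightarrow> (\<forall>i<m. \<bar>w i - y i\<bar> < e) \<Longrightarrow> w \<in> W"
    using W(1,3) unfolding eopen_box by metis
  have yE: "y \<in> espace m" using S y eopen_subset by blast
  let ?B = "ebox m y e"
  have B: "eopen m ?B" "?B \<subseteq> W" "y \<in> ?B" using eopen_ebox e yE by (auto simp: ebox_def)
  have hB: "smooth_on m ?B h" using smooth_on_subset[OF W(1,4) B(2)] .
  let ?q = "\<lambda>i. moment y 0 (partial i h)"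
  have atB: "smooth_at ?M y k" if "smooth_on m ?B k" for k
    unfolding smooth_at_flat[OF S] using B W that by blast
  have q: "smooth_at ?M y (?q i)" if "i < m" for i
    by (intro atB smooth_on_moment yE smooth_on_partial hB that)
  have coord: "smooth_at ?M y (\<lambda>u. u i - y i)" for i
    by (intro atB smooth_intros B)
  have coord': "smooth_at ?M y (\<lambda>u. u i)" for i
    by (intro atB smooth_intros B)
  have "v h = v (\<lambda>u. h y + (\<Sum>i<m. (u i - y i) * ?q i u))"
  proof (rule tangent_germ[OF M v h])
    show "openin (mtop ?M) ?B" using B W by (simp add: openin_flat[OF S])
    show "y \<in> ?B" by fact
    show "h u = h y + (\<Sum>i<m. (u i - y i) * ?q i u)" if "u \<in> ?B" for u
      by (rule hadamard[OF yE hB that])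
  qed
  also have "\<dots> = v (\<lambda>u. h y) + v (\<lambda>u. \<Sum>i<m. (u i - y i) * ?q i u)"
    by (intro tangent_add[OF v] smooth_at_const M yt smooth_at_sum smooth_at_mult coord q) auto
  also have "\<dots> = (\<Sum>i<m. v (\<lambda>u. (u i - y i) * ?q i u))"
    unfolding tangent_const[OF M yt v]
    by (subst tangent_sum[OF M yt v]) (auto intro: smooth_at_mult M coord q)
  also have "\<dots> = (\<Sum>i<m. v (\<lambda>u. u i) * partial i h y)"
  proof (rule sum.cong[OF refl])
    fix i assume "i \<in> {..<m}"
    then have i: "i < m" by simp
    have "v (\<lambda>u. (u i - y i) * ?q i u) = (y i - y i) * v (?q i) + ?q i y * v (\<lambda>u. u i - y i)"
      by (rule tangent_leibniz[OF v coord q[OF i]])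
    moreover have "v (\<lambda>u. 1 * u i + (- y i) * 1) = 1 * v (\<lambda>u. u i) + (- y i) * v (\<lambda>u. 1)"
      by (rule tangent_lincomb[OF v coord' smooth_at_const[OF M yt]])
    ultimately show "v (\<lambda>u. (u i - y i) * ?q i u) = v (\<lambda>u. u i) * partial i h y"
      by (simp add: moment_center tangent_const[OF M yt v])
  qed
  finally show ?thesis .
qed

section \<open>Linear systems with smooth coefficients\<close>

text \<open>Gaussian elimination: whenever a pivot is not identically zero, pass to the open set where it
  does not vanish.\<close>

lemma generic_kernel:
  fixes a :: "'i \<Rightarrow> 'j \<Rightarrow> (nat \<Rightarrow> real) \<Rightarrow> real"
  assumes "finite I" "finite J" "card I < card J" "eopen m S" "S \<noteq> {}"
    and "\<And>i j. i \<in> I \<Longrightarrow> j \<in> J \<Longrightarrow> smooth_on m S (a i j)"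
  shows "\<exists>S' z. eopen m S' \<and> S' \<noteq> {} \<and> S' \<subseteq> S \<and> (\<forall>j\<in>J. smooth_on m S' (z j)) \<and>
    (\<forall>u\<in>S'. (\<forall>i\<in>I. (\<Sum>j\<in>J. a i j u * z j u) = 0) \<and> (\<exists>j\<in>J. z j u \<noteq> 0))"
  using assms
proof (induction I arbitrary: J S a rule: finite_induct)
  case empty
  then have "J \<noteq> {}" by auto
  then show ?case using empty
    by (intro exI[of _ S] exI[of _ "\<lambda>j u. 1"]) (auto intro: smooth_on_const)
next
  case (insert i I)
  show ?case
  proof (cases "\<exists>j\<in>J. \<exists>u\<in>S. a i j u \<noteq> 0")
    \<comment> \<open>The row \<open>i\<close> vanishes identically on \<open>S\<close> and imposes
      nothing.\<close>
    case False
    have "card I < card J" using insert by simp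
    then obtain S' z where "eopen m S'" "S' \<noteq> {}" "S' \<subseteq> S" "\<forall>j\<in>J. smooth_on m S' (z j)"
      "\<forall>u\<in>S'. (\<forall>i\<in>I. (\<Sum>j\<in>J. a i j u * z j u) = 0) \<and> (\<exists>j\<in>J. z j u \<noteq> 0)"
      using insert.IH[of J S a] insert.prems by blast
    then show ?thesis using False
      by (intro exI[of _ S'] exI[of _ z]) (auto intro!: sum.neutral simp: subset_iff)
  next
    case True
    then obtain j0 u0 where j0: "j0 \<in> J" "u0 \<in> S" "a i j0 u0 \<noteq> 0" by blast
    define S1 where "S1 = {u\<in>S. a i j0 u \<noteq> 0}"
    define J1 where "J1 = J - {j0}"
    \<comment> \<open>The pivot row divided by its pivot; \<open>b\<close> consists of the other
      rows with column \<open>j0\<close> cleared. One equation and one unknown disappear, so the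
      inequality of cardinalities persists.\<close>
    define r where "r j u = inverse (a i j0 u) * a i j u" for j u
    define b where "b k j u = a k j u - a k j0 u * r j u" for k j u
    have S1: "eopen m S1" "S1 \<noteq> {}" "S1 \<subseteq> S"
      using eopen_Collect_neq[OF insert.prems(3) smooth_on_continuous[OF insert.prems(3)]] insert.prems j0
      by (auto simp: S1_def)
    have sm: "smooth_on m S1 (a k j)" if "k \<in> insert i I" "j \<in> J" for k j
      by (rule smooth_on_subset[OF insert.prems(3) insert.prems(5)[OF that] S1(3)])
    have sr: "smooth_on m S1 (r j)" if "j \<in> J" for j
      unfolding r_def by (intro smooth_on_mult smooth_on_inverse S1 sm that j0) (auto simp: S1_def)
    have J: "J = insert j0 J1" "j0 \<notin> J1" "finite J1" "card I < card J1"
      using j0 insert.prems insert.hyps by (auto simp: J1_def)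
    have sb: "smooth_on m S1 (b k j)" if "k \<in> I" "j \<in> J1" for k j
      unfolding b_def by (intro smooth_intros S1 sm sr) (use that J in auto)
    have "\<exists>S' z. eopen m S' \<and> S' \<noteq> {} \<and> S' \<subseteq> S1 \<and> (\<forall>j\<in>J1. smooth_on m S' (z j)) \<and>
      (\<forall>u\<in>S'. (\<forall>k\<in>I. (\<Sum>j\<in>J1. b k j u * z j u) = 0) \<and> (\<exists>j\<in>J1. z j u \<noteq> 0))"
      by (rule insert.IH[OF J(3,4) S1(1,2)]) (rule sb)
    then obtain S' z where z: "eopen m S'" "S' \<noteq> {}" "S' \<subseteq> S1" "\<forall>j\<in>J1. smooth_on m S' (z j)"
      "\<forall>u\<in>S'. (\<forall>k\<in>I. (\<Sum>j\<in>J1. b k j u * z j u) = 0) \<and> (\<exists>j\<in>J1. z j u \<noteq> 0)"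
      by (elim exE conjE) (rule that)
    \<comment> \<open>Back substitution: the pivot row is solved for the unknown
      \<open>j0\<close>.\<close>
    define z' where "z' j = (if j = j0 then (\<lambda>u. - (\<Sum>j\<in>J1. r j u * z j u)) else z j)" for j
    have z': "z' j = z j" if "j \<in> J1" for j using that J by (auto simp: z'_def)
    show ?thesis
    proof (intro exI conjI ballI)
      show "eopen m S'" "S' \<noteq> {}" "S' \<subseteq> S" using z S1 by auto
      show "smooth_on m S' (z' j)" if "j \<in> J" for j
      proof (cases "j = j0")
        case True
        have "smooth_on m S' (\<lambda>u. - (\<Sum>j\<in>J1. r j u * z j u))"
          by (intro smooth_intros z(1) smooth_on_subset[OF S1(1) sr z(3)]) (use z J in auto)
        then show ?thesis by (simp add: z'_def True)
      qed (use that z J z' in auto)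
      fix u assume u: "u \<in> S'"
      have sum: "(\<Sum>j\<in>J. a k j u * z' j u) = (\<Sum>j\<in>J1. (a k j u - a k j0 u * r j u) * z j u)" for k
      proof -
        have "(\<Sum>j\<in>J. a k j u * z' j u) = a k j0 u * z' j0 u + (\<Sum>j\<in>J1. a k j u * z j u)"
          using J z' by simp
        then show ?thesis
          by (simp add: z'_def left_diff_distrib sum_subtractf sum_distrib_left mult.assoc)
      qed
      show "(\<Sum>j\<in>J. a k j u * z' j u) = 0" if "k \<in> insert i I" for k
      proof (cases "k = i")
        case True
        have "a i j0 u \<noteq> 0" using u z S1_def by auto
        then have e: "a i j u - a i j0 u * r j u = 0" for j by (simp add: r_def)
        show ?thesis unfolding sum True e by simp
      next
        case False
        then have "k \<in> I" using that by simp
        then have "(\<Sum>j\<in>J1. b k j u * z j u) = 0" using z(5) u by blast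
        then show ?thesis unfolding sum b_def .
      qed
      obtain j where j: "j \<in> J1" "z j u \<noteq> 0" using z(5) u by blast
      then have "j \<in> J" "z' j u \<noteq> 0" using J(1) z'[OF j(1)] by auto
      then show "\<exists>j\<in>J. z' j u \<noteq> 0" by blast
    qed
  qed
qed

section \<open>Pairs of isometric immersions of a coordinate domain\<close>

definition independent_family :: "nat \<Rightarrow> 'k set \<Rightarrow> (nat \<Rightarrow> 'k \<Rightarrow> real) \<Rightarrow> bool" where
  "independent_family n K v \<longleftrightarrow>
     (\<forall>a. (\<forall>\<kappa>\<in>K. (\<Sum>i<n. a i * v i \<kappa>) = 0) \<longrightarrow> (\<forall>i<n. a i = 0))"

text \<open>A single family of component functions will carry both immersions; the index set
  \<open>K\<close> selects the one whose inner product is meant.\<close>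

definition dot :: "'k set \<Rightarrow> ('k \<Rightarrow> real) \<Rightarrow> ('k \<Rightarrow> real) \<Rightarrow> real" where
  "dot K v w = (\<Sum>\<kappa>\<in>K. v \<kappa> * w \<kappa>)"

lemma dot_commute: "dot K v w = dot K w v"
  by (simp add: dot_def mult.commute)

lemma dot_cong: "(\<And>\<kappa>. \<kappa> \<in> K \<Longrightarrow> v \<kappa> = v' \<kappa>) \<Longrightarrow> (\<And>\<kappa>. \<kappa> \<in> K \<Longrightarrow> w \<kappa> = w' \<kappa>) \<Longrightarrow> dot K v w = dot K v' w'"
  by (simp add: dot_def)

lemma dot_sum_left: "dot K (\<lambda>\<kappa>. \<Sum>i\<in>A. a i * v i \<kappa>) w = (\<Sum>i\<in>A. a i * dot K (v i) w)"
  by (simp add: dot_def sum_distrib_left sum_distrib_right mult.assoc sum.swap[of _ A])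

lemma dot_sum_right: "dot K w (\<lambda>\<kappa>. \<Sum>i\<in>A. a i * v i \<kappa>) = (\<Sum>i\<in>A. a i * dot K w (v i))"
  by (simp only: dot_commute[of K w] dot_sum_left)

lemma dot_add_left: "dot K (\<lambda>\<kappa>. v \<kappa> + v' \<kappa>) w = dot K v w + dot K v' w"
  by (simp add: dot_def distrib_right sum.distrib)

lemma dot_diff_left: "dot K (\<lambda>\<kappa>. v \<kappa> - v' \<kappa>) w = dot K v w - dot K v' w"
  by (simp add: dot_def left_diff_distrib sum_subtractf)

lemma dot_self_eq_0: "finite K \<Longrightarrow> dot K v v = 0 \<Longrightarrow> \<kappa> \<in> K \<Longrightarrow> v \<kappa> = 0"
  using sum_nonneg_eq_0_iff[of K "\<lambda>\<kappa>. v \<kappa> * v \<kappa>"] by (simp add: dot_def)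

text \<open>Nondegeneracy of the Gram matrix: the combination with coefficients \<open>a\<close> is
  orthogonal to every \<open>v j\<close>, hence to itself.\<close>

lemma independent_family_dot:
  assumes "independent_family n K v" "finite K"
    and "\<And>j. j < n \<Longrightarrow> (\<Sum>i<n. a i * dot K (v i) (v j)) = 0" and "i < n"
  shows "a i = 0"
proof -
  let ?w = "\<lambda>\<kappa>. \<Sum>i<n. a i * v i \<kappa>"
  have "dot K ?w ?w = (\<Sum>j<n. a j * dot K ?w (v j))" by (rule dot_sum_right)
  also have "\<dots> = 0" by (rule sum.neutral) (simp add: dot_sum_left assms(3))
  finally have "\<forall>\<kappa>\<in>K. ?w \<kappa> = 0" using dot_self_eq_0[OF assms(2)] by blast
  then show ?thesis using assms(1,4) unfolding independent_family_def by blast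
qed

definition D1 :: "('k \<Rightarrow> (nat \<Rightarrow> real) \<Rightarrow> real) \<Rightarrow> nat \<Rightarrow> (nat \<Rightarrow> real) \<Rightarrow> 'k \<Rightarrow> real" where
  "D1 f i u = (\<lambda>\<kappa>. partial i (f \<kappa>) u)"

text \<open>The full second derivative in ambient components. It stands in for the second
  fundamental form, from which it differs by a tangent vector.\<close>

definition D2 :: "('k \<Rightarrow> (nat \<Rightarrow> real) \<Rightarrow> real) \<Rightarrow> nat \<Rightarrow> nat \<Rightarrow> (nat \<Rightarrow> real) \<Rightarrow> 'k \<Rightarrow> real" where
  "D2 f i j u = (\<lambda>\<kappa>. partial i (partial j (f \<kappa>)) u)"

definition D3 :: "('k \<Rightarrow> (nat \<Rightarrow> real) \<Rightarrow> real) \<Rightarrow> nat \<Rightarrow> nat \<Rightarrow> nat \<Rightarrow> (nat \<Rightarrow> real) \<Rightarrow> 'k \<Rightarrow> real" where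
  "D3 f i j k u = (\<lambda>\<kappa>. partial i (partial j (partial k (f \<kappa>))) u)"

lemma has_partial_dot:
  assumes "\<And>\<kappa>. \<kappa> \<in> K \<Longrightarrow> has_partial i (\<lambda>u. v u \<kappa>) (v' \<kappa>) u" "\<And>\<kappa>. \<kappa> \<in> K \<Longrightarrow> has_partial i (\<lambda>u. w u \<kappa>) (w' \<kappa>) u"
  shows "has_partial i (\<lambda>u. dot K (v u) (w u)) (dot K v' (w u) + dot K (v u) w') u"
proof -
  have "has_partial i (\<lambda>u. \<Sum>\<kappa>\<in>K. v u \<kappa> * w u \<kappa>) (\<Sum>\<kappa>\<in>K. v' \<kappa> * w u \<kappa> + w' \<kappa> * v u \<kappa>) u"
    by (intro has_partial_sum has_partial_mult assms)
  then show ?thesis by (simp add: dot_def sum.distrib mult.commute)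
qed

locale smooth_family =
  fixes n :: nat and S :: "(nat \<Rightarrow> real) set" and K :: "'k set" and f :: "'k \<Rightarrow> (nat \<Rightarrow> real) \<Rightarrow> real"
  assumes fin: "finite K" and S: "eopen n S" and smooth: "\<And>\<kappa>. \<kappa> \<in> K \<Longrightarrow> smooth_on n S (f \<kappa>)"
begin

lemma D2_commute: "u \<in> S \<Longrightarrow> i < n \<Longrightarrow> j < n \<Longrightarrow> \<kappa> \<in> K \<Longrightarrow> D2 f i j u \<kappa> = D2 f j i u \<kappa>"
  unfolding D2_def by (rule partial_commute[OF S smooth])

lemma has_partial_D1: "u \<in> S \<Longrightarrow> i < n \<Longrightarrow> j < n \<Longrightarrow> \<kappa> \<in> K \<Longrightarrow> has_partial i (\<lambda>u. D1 f j u \<kappa>) (D2 f i j u \<kappa>) u"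
  unfolding D1_def D2_def by (intro smooth_on_has_partial[OF S] smooth_on_partial smooth)

lemma has_partial_D2: "u \<in> S \<Longrightarrow> i < n \<Longrightarrow> j < n \<Longrightarrow> k < n \<Longrightarrow> \<kappa> \<in> K \<Longrightarrow>
  has_partial i (\<lambda>u. D2 f j k u \<kappa>) (D3 f i j k u \<kappa>) u"
  unfolding D2_def D3_def by (intro smooth_on_has_partial[OF S] smooth_on_partial smooth)

lemma D3_commute: "u \<in> S \<Longrightarrow> i < n \<Longrightarrow> j < n \<Longrightarrow> k < n \<Longrightarrow> \<kappa> \<in> K \<Longrightarrow> D3 f i j k u \<kappa> = D3 f j i k u \<kappa>"
  unfolding D3_def by (intro partial_commute[OF S] smooth_on_partial smooth)

lemma smooth_on_dot:
  assumes "\<And>\<kappa>. \<kappa> \<in> K \<Longrightarrow> smooth_on n S (\<lambda>u. v u \<kappa>)" "\<And>\<kappa>. \<kappa> \<in> K \<Longrightarrow> smooth_on n S (\<lambda>u. w u \<kappa>)"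
  shows "smooth_on n S (\<lambda>u. dot K (v u) (w u))"
  unfolding dot_def by (intro smooth_intros S assms)

lemma smooth_on_D1: "i < n \<Longrightarrow> \<kappa> \<in> K \<Longrightarrow> smooth_on n S (\<lambda>u. D1 f i u \<kappa>)"
  unfolding D1_def by (intro smooth_on_partial smooth)

lemma smooth_on_D2: "i < n \<Longrightarrow> j < n \<Longrightarrow> \<kappa> \<in> K \<Longrightarrow> smooth_on n S (\<lambda>u. D2 f i j u \<kappa>)"
  unfolding D2_def by (intro smooth_on_partial smooth)

lemma partial_metric:
  assumes "u \<in> S" "i < n" "j < n" "l < n"
  shows "partial i (\<lambda>u. dot K (D1 f j u) (D1 f l u)) u =
    dot K (D2 f i j u) (D1 f l u) + dot K (D1 f j u) (D2 f i l u)"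
  by (rule partialI, rule has_partial_dot) (intro has_partial_D1 assms; assumption)+

text \<open>Product rule for the three derivatives of the metric, combined as in the Christoffel
  symbols of the first kind. The tangential part of \<open>D2\<close> is thus determined by the
  metric.\<close>

lemma koszul:
  assumes "u \<in> S" "i < n" "j < n" "l < n"
  shows "2 * dot K (D2 f i j u) (D1 f l u) =
    partial i (\<lambda>u. dot K (D1 f j u) (D1 f l u)) u + partial j (\<lambda>u. dot K (D1 f i u) (D1 f l u)) u
    - partial l (\<lambda>u. dot K (D1 f i u) (D1 f j u)) u"
proof -
  have c: "dot K (D2 f a b u) w = dot K (D2 f b a u) w" if "a < n" "b < n" for a b w
    by (rule dot_cong) (auto intro: D2_commute assms that)
  show ?thesis
    unfolding partial_metric[OF assms(1,2,3,4)] partial_metric[OF assms(1,3,2,4)] partial_metric[OF assms(1,4,2,3)]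
      dot_commute[of K "D1 f _ u" "D2 f _ _ u"] 
    using c[of i j] c[of i l] c[of j l] assms by simp
qed

text \<open>The third derivatives cancel by symmetry. By \<open>koszul\<close> the left-hand side
  depends only on the metric.\<close>

lemma gauss_ambient:
  assumes "u \<in> S" "i < n" "j < n" "k < n" "l < n"
  shows "partial k (\<lambda>u. dot K (D2 f i j u) (D1 f l u)) u - partial i (\<lambda>u. dot K (D2 f k j u) (D1 f l u)) u
    = dot K (D2 f i j u) (D2 f k l u) - dot K (D2 f k j u) (D2 f i l u)"
proof -
  have 1: "partial k (\<lambda>u. dot K (D2 f i j u) (D1 f l u)) u
      = dot K (D3 f k i j u) (D1 f l u) + dot K (D2 f i j u) (D2 f k l u)" if "i < n" "k < n" for i k
    by (rule partialI, rule has_partial_dot) (intro has_partial_D1 has_partial_D2 assms that; assumption)+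
  have "dot K (D3 f k i j u) (D1 f l u) = dot K (D3 f i k j u) (D1 f l u)"
    by (rule dot_cong) (auto intro: D3_commute assms)
  then show ?thesis using 1[of i k] 1[of k i] assms by simp
qed

end

section \<open>Two immersions inducing the same metric\<close>

locale isometric_pair = f0: smooth_family n S K0 f + f1: smooth_family n S K1 f
  for n S and K0 K1 :: "'k set" and f +
  assumes disj: "K0 \<inter> K1 = {}"
    and metric: "\<And>u i j. u \<in> S \<Longrightarrow> i < n \<Longrightarrow> j < n \<Longrightarrow>
      dot K0 (D1 f i u) (D1 f j u) = dot K1 (D1 f i u) (D1 f j u)"
    and indep0: "\<And>u. u \<in> S \<Longrightarrow> independent_family n K0 (\<lambda>i. D1 f i u)"
    and indep1: "\<And>u. u \<in> S \<Longrightarrow> independent_family n K1 (\<lambda>i. D1 f i u)"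
begin

lemma metric2:
  assumes "u \<in> S" "i < n" "j < n" "l < n"
  shows "dot K0 (D2 f i j u) (D1 f l u) = dot K1 (D2 f i j u) (D1 f l u)"
proof -
  have "partial i (\<lambda>u. dot K0 (D1 f j u) (D1 f l u)) u = partial i (\<lambda>u. dot K1 (D1 f j u) (D1 f l u)) u"
    if "i < n" "j < n" "l < n" for i j l
    by (rule partial_cong[OF f0.S assms(1)]) (auto intro: metric that)
  then show ?thesis
    using f0.koszul[OF assms] f1.koszul[OF assms] assms by simp
qed

text \<open>The left-hand side of \<open>gauss_ambient\<close> is the same for both immersions by
  \<open>metric2\<close>. Equating the right-hand sides gives flatness of the pair of second
  derivatives, tangential parts included.\<close>

lemma gauss:
  assumes "u \<in> S" "i < n" "j < n" "k < n" "l < n"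
  shows "dot K0 (D2 f i j u) (D2 f k l u) - dot K0 (D2 f k j u) (D2 f i l u)
    = dot K1 (D2 f i j u) (D2 f k l u) - dot K1 (D2 f k j u) (D2 f i l u)"
proof -
  have "partial k (\<lambda>u. dot K0 (D2 f i j u) (D1 f l u)) u = partial k (\<lambda>u. dot K1 (D2 f i j u) (D1 f l u)) u"
    if "i < n" "k < n" for i k
    by (rule partial_cong[OF f0.S assms(1)]) (auto intro: metric2 that assms)
  then show ?thesis
    using f0.gauss_ambient[OF assms] f1.gauss_ambient[OF assms] assms by simp
qed

text \<open>The indefinite inner product on the sum of the two ambient spaces. Pairs of tangent
  vectors are null by \<open>metric\<close> and orthogonal to all second derivatives by
  \<open>metric2\<close>, so tangential parts never contribute and need not be projected
  away.\<close>

definition sform :: "('k \<Rightarrow> real) \<Rightarrow> ('k \<Rightarrow> real) \<Rightarrow> real" where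
  "sform v w = dot K0 v w - dot K1 v w"

lemma sform_cong: "(\<And>\<kappa>. \<kappa> \<in> K0 \<union> K1 \<Longrightarrow> v \<kappa> = v' \<kappa>) \<Longrightarrow> (\<And>\<kappa>. \<kappa> \<in> K0 \<union> K1 \<Longrightarrow> w \<kappa> = w' \<kappa>) \<Longrightarrow> sform v w = sform v' w'"
  unfolding sform_def using dot_cong[of K0 v v' w w'] dot_cong[of K1 v v' w w'] by auto

lemma sform_commute: "sform v w = sform w v"
  by (simp add: sform_def dot_commute)

lemma sform_sum_left: "sform (\<lambda>\<kappa>. \<Sum>i\<in>A. a i * v i \<kappa>) w = (\<Sum>i\<in>A. a i * sform (v i) w)"
  by (simp add: sform_def dot_sum_left right_diff_distrib sum_subtractf)

lemma sform_sum_right: "sform w (\<lambda>\<kappa>. \<Sum>i\<in>A. a i * v i \<kappa>) = (\<Sum>i\<in>A. a i * sform w (v i))"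
  by (simp only: sform_commute[of w] sform_sum_left)

lemma sform_add_left: "sform (\<lambda>\<kappa>. v \<kappa> + v' \<kappa>) w = sform v w + sform v' w"
  by (simp add: sform_def dot_add_left)

text \<open>The hypotheses say that \<open>Z\<close> lies in the kernel of \<open>\<beta>(Y, \<cdot>)\<close>, where \<open>\<beta>\<close> is the pair of second
  fundamental forms, and that the equation may be differentiated in the direction of the vectors \<open>e\<^sub>i\<close> of
  the \<open>Y\<close>-variables. As \<open>\<beta>\<close> is flat, \<open>\<beta>(Z, \<cdot>)\<close> takes values in a null space.\<close>

lemma null_of_kernel:
  fixes Y Z c :: "nat \<Rightarrow> real" and V E :: "nat \<Rightarrow> nat \<Rightarrow> real"
  assumes u: "u \<in> S"
    and AY: "\<And>j. AY j = (\<lambda>\<kappa>. \<Sum>a<n. Y a * D2 f a j u \<kappa>)"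
    and ker: "\<And>\<kappa>. \<kappa> \<in> K0 \<union> K1 \<Longrightarrow> (\<Sum>j<n. Z j * AY j \<kappa>) + (\<Sum>l<n. c l * D1 f l u \<kappa>) = 0"
    and dker: "\<And>i \<kappa>. i < n \<Longrightarrow> \<kappa> \<in> K0 \<union> K1 \<Longrightarrow>
      (\<Sum>j<n. Z j * D2 f i j u \<kappa>) + (\<Sum>j<n. V i j * AY j \<kappa>) + (\<Sum>l<n. E i l * D1 f l u \<kappa>) = 0"
    and il: "i < n" "l < n"
  shows "dot K0 (\<lambda>\<kappa>. \<Sum>j<n. Z j * D2 f i j u \<kappa>) (\<lambda>\<kappa>. \<Sum>j<n. Z j * D2 f l j u \<kappa>)
    = dot K1 (\<lambda>\<kappa>. \<Sum>j<n. Z j * D2 f i j u \<kappa>) (\<lambda>\<kappa>. \<Sum>j<n. Z j * D2 f l j u \<kappa>)"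
proof -
  let ?A = "\<lambda>i j. D2 f i j u" and ?T = "\<lambda>l. D1 f l u"
  define B where "B i = (\<lambda>\<kappa>. \<Sum>j<n. Z j * D2 f i j u \<kappa>)" for i
  have AT: "sform (?A i j) (?T l) = 0" if "i < n" "j < n" "l < n" for i j l
    using metric2[OF u that] by (simp add: sform_def)
  have AA: "sform (?A i j) (?A k l) = sform (?A k j) (?A i l)" if "i < n" "j < n" "k < n" "l < n" for i j k l
    using gauss[OF u that] by (simp add: sform_def)
  have BT: "sform (?T h) (B l) = 0" if "h < n" "l < n" for h l
    unfolding B_def sform_sum_right sform_commute[of "?T h"]
    by (rule sum.neutral) (simp add: AT that)
  \<comment> \<open>Flatness exchanges \<open>Y\<close> with the direction \<open>l\<close>; the
    second factor then becomes the second derivative along \<open>Y\<close> and \<open>Z\<close>,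
    which is tangent by \<open>ker\<close>.\<close>
  have AYB: "sform (AY j) (B l) = 0" if j: "j < n" and l: "l < n" for j l
  proof -
    have "sform (AY j) (B l) = (\<Sum>a<n. Y a * (\<Sum>b<n. Z b * sform (?A a j) (?A l b)))"
      unfolding AY B_def sform_sum_left sform_sum_right ..
    also have "\<dots> = (\<Sum>a<n. Y a * (\<Sum>b<n. Z b * sform (?A l j) (?A a b)))"
      by (intro sum.cong refl arg_cong2[where f = "(*)"] AA) (use j l in auto)
    also have "\<dots> = (\<Sum>b<n. Z b * (\<Sum>a<n. Y a * sform (?A l j) (?A a b)))"
      unfolding sum_distrib_left by (subst sum.swap) (simp add: mult_ac)
    also have "\<dots> = sform (?A l j) (\<lambda>\<kappa>. \<Sum>b<n. Z b * AY b \<kappa>)"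
      by (simp only: AY sform_sum_right)
    also have "\<dots> = sform (?A l j) (\<lambda>\<kappa>. \<Sum>h<n. (- c h) * ?T h \<kappa>)"
    proof (rule sform_cong[OF refl])
      fix \<kappa> assume "\<kappa> \<in> K0 \<union> K1"
      from ker[OF this] show "(\<Sum>b<n. Z b * AY b \<kappa>) = (\<Sum>h<n. (- c h) * ?T h \<kappa>)"
        by (simp add: sum_negf)
    qed
    also have "\<dots> = 0"
      unfolding sform_sum_right by (rule sum.neutral) (simp add: AT j l)
    finally show ?thesis .
  qed
  \<comment> \<open>The differentiated equation writes \<open>B i\<close> through the vectors
    \<open>AY j\<close> and tangent vectors, all orthogonal to \<open>B l\<close>.\<close>
  have "sform (B i) (B l) = sform (\<lambda>\<kappa>. (\<Sum>j<n. (- V i j) * AY j \<kappa>) + (\<Sum>h<n. (- E i h) * ?T h \<kappa>)) (B l)"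
  proof (rule sform_cong[OF _ refl])
    fix \<kappa> assume "\<kappa> \<in> K0 \<union> K1"
    from dker[OF il(1) this] show "B i \<kappa> = (\<Sum>j<n. (- V i j) * AY j \<kappa>) + (\<Sum>h<n. (- E i h) * ?T h \<kappa>)"
      by (simp add: B_def sum_negf)
  qed
  also have "\<dots> = (\<Sum>j<n. (- V i j) * sform (AY j) (B l)) + (\<Sum>h<n. (- E i h) * sform (?T h) (B l))"
    by (simp only: sform_add_left sform_sum_left)
  also have "\<dots> = 0" using AYB BT il(2) by simp
  finally show ?thesis by (simp add: sform_def B_def)
qed

text \<open>The linear system lives on an open subset of \<open>\<real>\<^sup>2\<^sup>n\<close>:
  coordinates below \<open>n\<close> are the point, those from \<open>n\<close> on are
  \<open>Y\<close>. There are \<open>n\<close> unknowns for \<open>Z\<close> and \<open>n\<close>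
  tangential coefficients for each immersion, against one equation per component.\<close>

lemma local_null_field:
  assumes dims: "card K0 + card K1 < 3 * n" and ne: "S \<noteq> {}"
  shows "\<exists>S' Z. eopen n S' \<and> S' \<noteq> {} \<and> S' \<subseteq> S \<and> (\<forall>j<n. smooth_on n S' (Z j)) \<and>
    (\<forall>u\<in>S'. (\<exists>j<n. Z j u \<noteq> 0) \<and> (\<forall>i<n. \<forall>l<n.
      dot K0 (\<lambda>\<kappa>. \<Sum>j<n. Z j u * D2 f i j u \<kappa>) (\<lambda>\<kappa>. \<Sum>j<n. Z j u * D2 f l j u \<kappa>)
    = dot K1 (\<lambda>\<kappa>. \<Sum>j<n. Z j u * D2 f i j u \<kappa>) (\<lambda>\<kappa>. \<Sum>j<n. Z j u * D2 f l j u \<kappa>)))"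
proof -
  define \<pi> where "\<pi> = shift_drop n (\<lambda>i. 0)"
  define \<Omega>0 where "\<Omega>0 = {w\<in>espace (2 * n). \<pi> w \<in> S}"
  have O0: "eopen (2 * n) \<Omega>0" unfolding \<Omega>0_def \<pi>_def by (rule eopen_shift_drop[OF f0.S])
  have "\<Omega>0 \<noteq> {}"
  proof -
    obtain u where u: "u \<in> S" using ne by blast
    then have "u \<in> espace n" using eopen_subset[OF f0.S] by blast
    then have "u \<in> espace (2 * n)" "\<pi> u = u" by (auto simp: espace_def \<pi>_def splice_def)
    then show ?thesis using u by (auto simp: \<Omega>0_def)
  qed
  \<comment> \<open>The block of tangential unknowns that enters the equation of component \<kappa>:
    block 1 for \<open>K0\<close>, block 2 for \<open>K1\<close>. Block 0 is
    \<open>Z\<close>.\<close>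
  define b where "b \<kappa> = (if \<kappa> \<in> K0 then 1 else 2 :: nat)" for \<kappa>
  define AY where "AY j w \<kappa> = (\<Sum>a<n. w (n + a) * D2 f a j (\<pi> w) \<kappa>)" for j w \<kappa>
  define coeff where "coeff \<kappa> p w = (case p of (k, j) \<Rightarrow>
    if k = 0 then AY j w \<kappa> else if k = b \<kappa> then D1 f j (\<pi> w) \<kappa> else 0)" for \<kappa> w and p :: "nat \<times> nat"
  have sm: "smooth_on n S (f \<kappa>)" if "\<kappa> \<in> K0 \<union> K1" for \<kappa>
    using that f0.smooth f1.smooth by auto
  have sAY: "smooth_on (2 * n) \<Omega>0 (\<lambda>w. AY j w \<kappa>)" if "j < n" "\<kappa> \<in> K0 \<union> K1" for j \<kappa>
    unfolding AY_def \<Omega>0_def \<pi>_def D2_def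
    by (intro smooth_intros smooth_on_shift_drop[OF f0.S] eopen_shift_drop[OF f0.S] sm that) (use that in auto)
  have sT: "smooth_on (2 * n) \<Omega>0 (\<lambda>w. D1 f j (\<pi> w) \<kappa>)" if "j < n" "\<kappa> \<in> K0 \<union> K1" for j \<kappa>
    unfolding \<Omega>0_def \<pi>_def D1_def
    by (intro smooth_intros smooth_on_shift_drop[OF f0.S] sm that)
  have sc: "smooth_on (2 * n) \<Omega>0 (coeff \<kappa> p)" if \<kappa>: "\<kappa> \<in> K0 \<union> K1" and p: "p \<in> {0,1,2} \<times> {..<n}" for \<kappa> p
  proof (cases p)
    case (Pair k j)
    then have "j < n" using p by auto
    then show ?thesis
      unfolding coeff_def Pair prod.case
      using sAY[OF _ \<kappa>] sT[OF _ \<kappa>] smooth_on_const[OF O0]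
      by (cases "k = 0"; cases "k = b \<kappa>") simp_all
  qed
  have card: "card (K0 \<union> K1) < card ({0,1,2::nat} \<times> {..<n})"
    using dims disj f0.fin f1.fin by (simp add: card_Un_disjoint)
  have "\<exists>\<Omega> z. eopen (2 * n) \<Omega> \<and> \<Omega> \<noteq> {} \<and> \<Omega> \<subseteq> \<Omega>0 \<and>
    (\<forall>p\<in>{0,1,2} \<times> {..<n}. smooth_on (2 * n) \<Omega> (z p)) \<and>
    (\<forall>w\<in>\<Omega>. (\<forall>\<kappa>\<in>K0 \<union> K1. (\<Sum>p\<in>{0,1,2} \<times> {..<n}. coeff \<kappa> p w * z p w) = 0) \<and>
      (\<exists>p\<in>{0,1,2} \<times> {..<n}. z p w \<noteq> 0))"
    by (rule generic_kernel[OF _ _ card O0 \<open>\<Omega>0 \<noteq> {}\<close>])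
       (use f0.fin f1.fin in simp, simp, rule sc)
  then obtain \<Omega> z where \<Omega>: "eopen (2 * n) \<Omega>" "\<Omega> \<noteq> {}" "\<Omega> \<subseteq> \<Omega>0"
    and sz: "\<forall>p\<in>{0,1,2} \<times> {..<n}. smooth_on (2 * n) \<Omega> (z p)"
    and z: "\<forall>w\<in>\<Omega>. (\<forall>\<kappa>\<in>K0 \<union> K1. (\<Sum>p\<in>{0,1,2} \<times> {..<n}. coeff \<kappa> p w * z p w) = 0) \<and>
      (\<exists>p\<in>{0,1,2} \<times> {..<n}. z p w \<noteq> 0)"
    by (elim exE conjE) (rule that)
  have \<pi>S: "\<pi> w \<in> S" if "w \<in> \<Omega>" for w using that \<Omega>(3) by (auto simp: \<Omega>0_def)
  have eq: "(\<Sum>j<n. z (0, j) w * AY j w \<kappa>) + (\<Sum>l<n. z (b \<kappa>, l) w * D1 f l (\<pi> w) \<kappa>) = 0"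
    if "w \<in> \<Omega>" "\<kappa> \<in> K0 \<union> K1" for w \<kappa>
  proof -
    have "(\<Sum>p\<in>{0,1,2} \<times> {..<n}. coeff \<kappa> p w * z p w) = 0" using z that by blast
    moreover have "(\<Sum>p\<in>{0,1,2} \<times> {..<n}. coeff \<kappa> p w * z p w)
        = (\<Sum>k\<in>{0,1,2}. \<Sum>j<n. coeff \<kappa> (k, j) w * z (k, j) w)"
      by (simp only: sum.cartesian_product) (simp add: case_prod_beta)
    ultimately show ?thesis
      by (cases "\<kappa> \<in> K0") (simp_all add: coeff_def b_def mult.commute)
  qed
  \<comment> \<open>By \<open>metric2\<close> the tangential part of the second derivative along
    \<open>Y\<close> and \<open>Z\<close> is the same for both immersions. Pairing with tangent
    vectors therefore gives both coefficient vectors the same image under the Gram matrix.\<close>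
  have cc: "z (1, l) w = z (2, l) w" if w: "w \<in> \<Omega>" and l: "l < n" for w l
  proof -
    note u = \<pi>S[OF w]
    let ?T = "\<lambda>l. D1 f l (\<pi> w)"
    let ?\<Xi> = "\<lambda>\<kappa>. \<Sum>j<n. z (0, j) w * AY j w \<kappa>"
    have "z (1, l) w - z (2, l) w = 0"
    proof (rule independent_family_dot[OF indep0[OF u] f0.fin _ l])
      fix h assume h: "h < n"
      have 0: "dot K0 ?\<Xi> (?T h) = (\<Sum>l<n. - z (1, l) w * dot K0 (?T l) (?T h))"
        unfolding dot_sum_left[symmetric]
        by (rule dot_cong) (use eq[OF w] in \<open>auto simp: b_def sum_negf add_eq_0_iff2\<close>)
      have "dot K1 ?\<Xi> (?T h) = (\<Sum>l<n. - z (2, l) w * dot K1 (?T l) (?T h))"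
        unfolding dot_sum_left[symmetric]
        by (rule dot_cong) (use eq[OF w] disj in \<open>auto simp: b_def sum_negf add_eq_0_iff2\<close>)
      also have "\<dots> = (\<Sum>l<n. - z (2, l) w * dot K0 (?T l) (?T h))"
        using metric[OF u _ h] by (intro sum.cong) auto
      finally have 1: "dot K1 ?\<Xi> (?T h) = (\<Sum>l<n. - z (2, l) w * dot K0 (?T l) (?T h))" .
      have "dot K0 ?\<Xi> (?T h) = dot K1 ?\<Xi> (?T h)"
        unfolding AY_def dot_sum_left
        by (intro sum.cong refl arg_cong2[where f = "(*)"] metric2[OF u]) (use h in auto)
      then show "(\<Sum>l<n. (z (1, l) w - z (2, l) w) * dot K0 (?T l) (?T h)) = 0"
        using 0 1 by (simp add: left_diff_distrib sum_subtractf sum_negf)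
    qed
    then show ?thesis by simp
  qed
  \<comment> \<open>If block 0 vanished, independence of the tangent vectors would kill block 1,
    \<open>cc\<close> would kill block 2, and the whole solution would be zero.\<close>
  have nz: "\<exists>j<n. z (0, j) w \<noteq> 0" if w: "w \<in> \<Omega>" for w
  proof (rule ccontr)
    assume "\<not> (\<exists>j<n. z (0, j) w \<noteq> 0)"
    then have z0: "z (0, j) w = 0" if "j < n" for j using that by blast
    have "(\<Sum>l<n. z (1, l) w * D1 f l (\<pi> w) \<kappa>) = 0" if "\<kappa> \<in> K0" for \<kappa>
      using eq[OF w, of \<kappa>] z0 that by (simp add: b_def)
    then have "\<forall>l<n. z (1, l) w = 0"
      using indep0[OF \<pi>S[OF w], unfolded independent_family_def, rule_format, of "\<lambda>l. z (1, l) w"] by blast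
    then have "z p w = 0" if "p \<in> {0,1,2} \<times> {..<n}" for p
      using that z0 cc[OF w] by auto
    then show False using z w by blast
  qed
  obtain w0 where w0: "w0 \<in> \<Omega>" using \<Omega>(2) by blast
  have w0E: "w0 \<in> espace (2 * n)" using w0 eopen_subset[OF \<Omega>(1)] by blast
  \<comment> \<open>Freezes \<open>Y\<close> at its value at \<open>w0\<close>; \<open>S'\<close> is
    the corresponding slice of \<Omega>.\<close>
  define P where "P = splice n (\<lambda>i. 0) w0"
  have PE: "splice n (\<lambda>i. 0) w0 u \<in> espace (2 * n)" for u
    using w0E by (auto simp: splice_def espace_def)
  have \<pi>P: "\<pi> (P u) = u" if "u \<in> espace n" for u
    using that by (auto simp: \<pi>_def P_def splice_def espace_def)
  have Pw0: "P (\<pi> w0) = w0" by (auto simp: \<pi>_def P_def splice_def)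
  define S' where "S' = {u\<in>espace n. P u \<in> \<Omega>}"
  have S': "eopen n S'" unfolding S'_def P_def by (rule eopen_splice[OF \<Omega>(1) PE])
  have ne': "\<pi> w0 \<in> S'"
    using Pw0 w0 by (simp add: S'_def) (simp add: \<pi>_def shift_drop_in_espace)
  have sub: "S' \<subseteq> S" using \<pi>P \<pi>S by (fastforce simp: S'_def)
  have sZ: "smooth_on n S' (\<lambda>u. z (0, j) (P u))" if "j < n" for j
    unfolding S'_def P_def by (rule smooth_on_splice[OF \<Omega>(1) _ PE]) (use sz that in auto)
  have null: "dot K0 (\<lambda>\<kappa>. \<Sum>j<n. z (0, j) (P u) * D2 f i j u \<kappa>) (\<lambda>\<kappa>. \<Sum>j<n. z (0, j) (P u) * D2 f l j u \<kappa>)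
    = dot K1 (\<lambda>\<kappa>. \<Sum>j<n. z (0, j) (P u) * D2 f i j u \<kappa>) (\<lambda>\<kappa>. \<Sum>j<n. z (0, j) (P u) * D2 f l j u \<kappa>)"
    if u: "u \<in> S'" and il: "i < n" "l < n" for u i l
  \<comment> \<open>\<open>V\<close> and \<open>E\<close> are the derivatives of the kernel field
    and of the tangential coefficients in the \<open>Y\<close>-coordinate
    \<open>n + i\<close>.\<close>
  proof (rule null_of_kernel[where Y = "\<lambda>a. P u (n + a)" and c = "\<lambda>l. z (1, l) (P u)" and AY = "\<lambda>j. AY j (P u)"
        and V = "\<lambda>i j. partial (n + i) (z (0, j)) (P u)" and E = "\<lambda>i l. partial (n + i) (z (1, l)) (P u)", OF _ _ _ _ il])
    have w: "P u \<in> \<Omega>" and uE: "u \<in> espace n" using u by (auto simp: S'_def)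
    show "u \<in> S" using u sub by blast
    show "AY j (P u) = (\<lambda>\<kappa>. \<Sum>a<n. P u (n + a) * D2 f a j u \<kappa>)" for j
      by (simp add: fun_eq_iff AY_def \<pi>P[OF uE])
    have eq1: "(\<Sum>j<n. z (0, j) w * AY j w \<kappa>) + (\<Sum>l<n. z (1, l) w * D1 f l (\<pi> w) \<kappa>) = 0"
      if "w \<in> \<Omega>" "\<kappa> \<in> K0 \<union> K1" for w \<kappa>
      using eq[OF that] cc[OF that(1)] by (cases "\<kappa> \<in> K0") (auto simp: b_def)
    show "(\<Sum>j<n. z (0, j) (P u) * AY j (P u) \<kappa>) + (\<Sum>l<n. z (1, l) (P u) * D1 f l u \<kappa>) = 0"
      if "\<kappa> \<in> K0 \<union> K1" for \<kappa> using eq1[OF w that] by (simp add: \<pi>P[OF uE])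
    fix i \<kappa> assume i: "i < n" and \<kappa>: "\<kappa> \<in> K0 \<union> K1"
    have i2: "n + i < 2 * n" using i by simp
    have hz: "has_partial (n + i) (z p) (partial (n + i) (z p) (P u)) (P u)" if "p \<in> {0,1,2} \<times> {..<n}" for p
      using smooth_on_has_partial[OF \<Omega>(1) _ i2 w] sz that by blast
    have const: "has_partial (n + i) (\<lambda>w. g (\<pi> w)) 0 (P u)" for g
      unfolding \<pi>_def by (rule has_partial_splice_ge) simp
    \<comment> \<open>\<open>AY j\<close> is linear in \<open>Y\<close>, so this derivative is the
      second derivative in direction \<open>i\<close>; whatever factors through \<pi> is constant
      here.\<close>
    have hAY: "has_partial (n + i) (\<lambda>w. AY j w \<kappa>) (D2 f i j u \<kappa>) (P u)" for j
    proof -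
      have "has_partial (n + i) (\<lambda>w. AY j w \<kappa>)
        (\<Sum>a<n. (if n + a = n + i then 1 else 0) * D2 f a j (\<pi> (P u)) \<kappa> + 0 * P u (n + a)) (P u)"
        unfolding AY_def by (intro has_partial_sum has_partial_mult has_partial_coord const)
      moreover have "(\<Sum>a<n. (if n + a = n + i then 1 else 0) * D2 f a j (\<pi> (P u)) \<kappa> + 0 * P u (n + a))
        = (\<Sum>a<n. if a = i then D2 f a j (\<pi> (P u)) \<kappa> else 0)"
        by (rule sum.cong) auto
      ultimately show ?thesis using i by (simp add: \<pi>P[OF uE])
    qed
    have d: "has_partial (n + i) (\<lambda>w. (\<Sum>j<n. z (0, j) w * AY j w \<kappa>) + (\<Sum>l<n. z (1, l) w * D1 f l (\<pi> w) \<kappa>))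
      ((\<Sum>j<n. partial (n + i) (z (0, j)) (P u) * AY j (P u) \<kappa> + D2 f i j u \<kappa> * z (0, j) (P u)) +
       (\<Sum>l<n. partial (n + i) (z (1, l)) (P u) * D1 f l (\<pi> (P u)) \<kappa> + 0 * z (1, l) (P u))) (P u)"
      by (intro has_partial_add has_partial_sum has_partial_mult const hAY hz) auto
    have "partial (n + i) (\<lambda>w. (\<Sum>j<n. z (0, j) w * AY j w \<kappa>) + (\<Sum>l<n. z (1, l) w * D1 f l (\<pi> w) \<kappa>)) (P u)
      = partial (n + i) (\<lambda>w. 0) (P u)"
      by (rule partial_cong[OF \<Omega>(1) w i2 eq1[OF _ \<kappa>]])
    from trans[OF sym[OF partialI[OF d]] this]
    show "(\<Sum>j<n. z (0, j) (P u) * D2 f i j u \<kappa>) + (\<Sum>j<n. partial (n + i) (z (0, j)) (P u) * AY j (P u) \<kappa>) +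
        (\<Sum>l<n. partial (n + i) (z (1, l)) (P u) * D1 f l u \<kappa>) = 0"
      by (simp add: partialI[OF has_partial_const] \<pi>P[OF uE] sum.distrib mult.commute)
  qed
  show ?thesis
  proof (rule exI[of _ S'], rule exI[of _ "\<lambda>j u. z (0, j) (P u)"], intro conjI ballI)
    show "eopen n S'" "S' \<noteq> {}" "S' \<subseteq> S" using S' ne' sub by auto
    show "\<forall>j<n. smooth_on n S' (\<lambda>u. z (0, j) (P u))" using sZ by blast
    fix u assume u: "u \<in> S'"
    then show "\<exists>j<n. z (0, j) (P u) \<noteq> 0" by (intro nz) (simp add: S'_def)
    show "\<forall>i<n. \<forall>l<n. dot K0 (\<lambda>\<kappa>. \<Sum>j<n. z (0, j) (P u) * D2 f i j u \<kappa>) (\<lambda>\<kappa>. \<Sum>j<n. z (0, j) (P u) * D2 f l j u \<kappa>)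
      = dot K1 (\<lambda>\<kappa>. \<Sum>j<n. z (0, j) (P u) * D2 f i j u \<kappa>) (\<lambda>\<kappa>. \<Sum>j<n. z (0, j) (P u) * D2 f l j u \<kappa>)"
      using null[OF u] by blast
  qed
qed

end

section \<open>The Gauss equation and Ricci curvature\<close>

locale immersed_family = smooth_family n S K f for n S and K :: "'k set" and f +
  assumes indep: "\<And>u. u \<in> S \<Longrightarrow> independent_family n K (\<lambda>i. D1 f i u)"
begin

definition gm :: "nat \<Rightarrow> nat \<Rightarrow> (nat \<Rightarrow> real) \<Rightarrow> real" where
  "gm i j u = dot K (D1 f i u) (D1 f j u)"

lemma gm_sym: "gm i j u = gm j i u"
  by (simp add: gm_def dot_commute)

lemma gm_row_zero:
  assumes "u \<in> S" "\<And>j. j < n \<Longrightarrow> (\<Sum>k<n. r k * gm k j u) = 0" "k < n"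
  shows "r k = 0"
  using independent_family_dot[OF indep[OF assms(1)] fin] assms(2,3) unfolding gm_def by blast

lemma smooth_on_gm: "i < n \<Longrightarrow> j < n \<Longrightarrow> smooth_on n S (gm i j)"
  unfolding gm_def by (rule smooth_on_dot) (auto intro: smooth_on_D1)

text \<open>The entries of the inverse together with a common denominator, indexed by
  \<open>None\<close>, form a homogeneous system with one more unknown than equations. Where the
  denominator vanished, nondegeneracy of the metric would make the entire solution zero.\<close>

lemma generic_inverse:
  assumes "S \<noteq> {}"
  shows "\<exists>S' G. eopen n S' \<and> S' \<noteq> {} \<and> S' \<subseteq> S \<and>
    (\<forall>i<n. \<forall>j<n. smooth_on n S' (G i j)) \<and>
    (\<forall>u\<in>S'. \<forall>i<n. \<forall>j<n. (\<Sum>k<n. G i k u * gm k j u) = (if i = j then 1 else 0))"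
proof -
  let ?N = "{..<n} \<times> {..<n}"
  define J where "J = insert None (Some ` ?N)"
  define a where "a q p u = (case q of (i, j) \<Rightarrow> (case p of None \<Rightarrow> (if i = j then - 1 else 0)
    | Some (i', k) \<Rightarrow> (if i' = i then gm k j u else 0)))" for q :: "nat \<times> nat" and p :: "(nat \<times> nat) option" and u
  have J: "finite J" "card ?N < card J"
    by (simp_all add: J_def card_image)
  have sa: "smooth_on n S (a q p)" if qN: "q \<in> ?N" and pJ: "p \<in> J" for q p
  proof -
    obtain i j where q: "q = (i, j)" "i < n" "j < n" using qN by auto
    consider "p = None" | i' k where "p = Some (i', k)" "i' < n" "k < n" using pJ by (auto simp: J_def)
    then show ?thesis
    proof cases
      case 1 then show ?thesis by (simp add: a_def[abs_def] q smooth_on_const[OF S])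
    next
      case 2 then show ?thesis
        using smooth_on_gm[OF 2(3) q(3)] smooth_on_const[OF S] by (cases "i' = i") (simp_all add: a_def[abs_def] q)
    qed
  qed
  have "\<exists>S' z. eopen n S' \<and> S' \<noteq> {} \<and> S' \<subseteq> S \<and> (\<forall>j\<in>J. smooth_on n S' (z j)) \<and>
    (\<forall>u\<in>S'. (\<forall>i\<in>?N. (\<Sum>j\<in>J. a i j u * z j u) = 0) \<and> (\<exists>j\<in>J. z j u \<noteq> 0))"
    by (rule generic_kernel[OF _ J S assms]) (simp, rule sa)
  then obtain S' z where S': "eopen n S'" "S' \<noteq> {}" "S' \<subseteq> S" and sz: "\<forall>j\<in>J. smooth_on n S' (z j)"
    and z: "\<forall>u\<in>S'. (\<forall>i\<in>?N. (\<Sum>j\<in>J. a i j u * z j u) = 0) \<and> (\<exists>j\<in>J. z j u \<noteq> 0)"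
    by (elim exE conjE) (rule that)
  have eq: "(\<Sum>k<n. z (Some (i, k)) u * gm k j u) = (if i = j then z None u else 0)"
    if "u \<in> S'" "i < n" "j < n" for u i j
  proof -
    have "(\<Sum>p\<in>J. a (i, j) p u * z p u) = 0" using z that by blast
    moreover have "(\<Sum>p\<in>J. a (i, j) p u * z p u)
      = a (i, j) None u * z None u + (\<Sum>p\<in>?N. a (i, j) (Some p) u * z (Some p) u)"
      by (simp add: J_def sum.reindex image_iff)
    moreover have "(\<Sum>p\<in>?N. a (i, j) (Some p) u * z (Some p) u)
      = (\<Sum>i'<n. \<Sum>k<n. (if i' = i then gm k j u else 0) * z (Some (i', k)) u)"
      by (simp only: sum.cartesian_product) (simp add: case_prod_beta a_def)
    moreover have "(\<Sum>i'<n. \<Sum>k<n. (if i' = i then gm k j u else 0) * z (Some (i', k)) u)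
      = (\<Sum>i'<n. if i' = i then (\<Sum>k<n. gm k j u * z (Some (i', k)) u) else 0)"
      by (rule sum.cong) auto
    ultimately show ?thesis using that by (simp add: a_def mult.commute split: if_splits)
  qed
  have nz: "z None u \<noteq> 0" if u: "u \<in> S'" for u
  proof
    assume 0: "z None u = 0"
    have "z (Some (i, k)) u = 0" if "i < n" "k < n" for i k
      by (rule gm_row_zero[of u "\<lambda>k. z (Some (i, k)) u"]) (use eq[OF u] 0 u S' that in auto)
    then have "z p u = 0" if "p \<in> J" for p using that 0 by (auto simp: J_def)
    then show False using z u by blast
  qed
  show ?thesis
  proof (rule exI[of _ S'], rule exI[of _ "\<lambda>i k u. inverse (z None u) * z (Some (i, k)) u"], intro conjI ballI allI impI)
    show "eopen n S'" "S' \<noteq> {}" "S' \<subseteq> S" by fact+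
    show "smooth_on n S' (\<lambda>u. inverse (z None u) * z (Some (i, j)) u)" if "i < n" "j < n" for i j
      by (intro smooth_on_mult smooth_on_inverse S' nz) (use sz that in \<open>auto simp: J_def\<close>)
    show "(\<Sum>k<n. inverse (z None u) * z (Some (i, k)) u * gm k j u) = (if i = j then 1 else 0)"
      if "u \<in> S'" "i < n" "j < n" for u i j
      using eq[OF that] nz[OF that(1)] by (simp add: mult.assoc sum_distrib_left[symmetric])
  qed
qed

end

locale immersed_inverse = immersed_family n S K f for n S and K :: "'k set" and f +
  fixes G :: "nat \<Rightarrow> nat \<Rightarrow> (nat \<Rightarrow> real) \<Rightarrow> real"
  assumes smooth_G: "\<And>i j. i < n \<Longrightarrow> j < n \<Longrightarrow> smooth_on n S (G i j)"
    and left_inverse: "\<And>u i j. u \<in> S \<Longrightarrow> i < n \<Longrightarrow> j < n \<Longrightarrow>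
      (\<Sum>k<n. G i k u * gm k j u) = (if i = j then 1 else 0)"
begin

text \<open>A row of \<open>gm G - 1\<close> is annihilated by multiplication with \<open>gm\<close>
  from the right, hence zero.\<close>

lemma right_inverse:
  assumes u: "u \<in> S" and ij: "i < n" "j < n"
  shows "(\<Sum>k<n. gm i k u * G k j u) = (if i = j then 1 else 0)"
proof -
  define r where "r k = (\<Sum>l<n. gm i l u * G l k u) - (if i = k then 1 else 0)" for k
  have "r j = 0"
  proof (rule gm_row_zero[OF u _ ij(2)])
    fix h assume h: "h < n"
    have "(\<Sum>k<n. r k * gm k h u) = (\<Sum>k<n. (\<Sum>l<n. gm i l u * G l k u) * gm k h u) - (\<Sum>k<n. (if i = k then 1 else 0) * gm k h u)"
      by (simp add: r_def left_diff_distrib sum_subtractf)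
    also have "(\<Sum>k<n. (\<Sum>l<n. gm i l u * G l k u) * gm k h u) = (\<Sum>l<n. gm i l u * (\<Sum>k<n. G l k u * gm k h u))"
      unfolding sum_distrib_left sum_distrib_right by (subst sum.swap) (simp add: mult.assoc)
    also have "\<dots> = (\<Sum>l<n. if l = h then gm i l u else 0)"
      by (rule sum.cong) (auto simp: left_inverse u h)
    also have "\<dots> = gm i h u" using h by simp
    also have "(\<Sum>k<n. (if i = k then 1 else 0) * gm k h u) = (\<Sum>k<n. if i = k then gm k h u else 0)"
      by (rule sum.cong) auto
    also have "\<dots> = gm i h u" using ij by simp
    finally show "(\<Sum>k<n. r k * gm k h u) = 0" by simp
  qed
  then show ?thesis by (simp add: r_def)
qed

text \<open>Serves to evaluate the definite description in \<open>inverse_metric\<close>.\<close>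

lemma left_inverse_unique:
  assumes u: "u \<in> S" and H: "\<And>i j. i < n \<Longrightarrow> j < n \<Longrightarrow> (\<Sum>k<n. H i k * gm k j u) = (if i = j then 1 else 0)"
    and ij: "i < n" "j < n"
  shows "H i j = G i j u"
proof -
  have "H i j - G i j u = 0"
    by (rule gm_row_zero[OF u _ ij(2), of "\<lambda>j. H i j - G i j u"])
       (simp add: left_diff_distrib sum_subtractf H left_inverse u ij)
  then show ?thesis by simp
qed

text \<open>With \<open>y = G a\<close> the form equals the squared length of the tangent vector
  with components \<open>y\<close>.\<close>

lemma G_nonneg:
  assumes u: "u \<in> S"
  shows "(\<Sum>i<n. \<Sum>h<n. G h i u * (a i * a h)) \<ge> 0"
proof -
  define y where "y k = (\<Sum>i<n. G k i u * a i)" for k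
  have a: "a h = (\<Sum>k<n. y k * gm k h u)" if h: "h < n" for h
  proof -
    have "(\<Sum>k<n. y k * gm k h u) = (\<Sum>i<n. (\<Sum>k<n. gm h k u * G k i u) * a i)"
      unfolding y_def sum_distrib_left sum_distrib_right
      by (subst sum.swap) (simp add: mult_ac gm_sym[of _ h])
    also have "\<dots> = (\<Sum>i<n. if h = i then a i else 0)"
      by (rule sum.cong) (auto simp: right_inverse u h)
    finally show ?thesis using h by simp
  qed
  have "(\<Sum>i<n. \<Sum>h<n. G h i u * (a i * a h)) = (\<Sum>h<n. a h * y h)"
    unfolding y_def sum_distrib_left by (subst sum.swap) (simp add: mult_ac)
  also have "\<dots> = (\<Sum>h<n. y h * (\<Sum>k<n. y k * gm k h u))"
    by (rule sum.cong) (auto simp: a)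
  also have "\<dots> = dot K (\<lambda>\<kappa>. \<Sum>k<n. y k * D1 f k u \<kappa>) (\<lambda>\<kappa>. \<Sum>h<n. y h * D1 f h u \<kappa>)"
    by (subst dot_sum_right) (simp only: dot_sum_left gm_def)
  also have "\<dots> \<ge> 0" by (simp add: dot_def sum_nonneg)
  finally show ?thesis .
qed

section \<open>Christoffel symbols, second fundamental form and the Gauss equation\<close>

definition \<Gamma> :: "nat \<Rightarrow> nat \<Rightarrow> nat \<Rightarrow> (nat \<Rightarrow> real) \<Rightarrow> real" where
  "\<Gamma> k i j u = (\<Sum>l<n. G k l u * dot K (D2 f i j u) (D1 f l u))"

text \<open>The second fundamental form on coordinate vectors, by the Gauss formula.\<close>

definition \<alpha> :: "nat \<Rightarrow> nat \<Rightarrow> (nat \<Rightarrow> real) \<Rightarrow> 'k \<Rightarrow> real" where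
  "\<alpha> i j u \<kappa> = D2 f i j u \<kappa> - (\<Sum>l<n. \<Gamma> l i j u * D1 f l u \<kappa>)"

lemma smooth_\<Gamma>: "k < n \<Longrightarrow> i < n \<Longrightarrow> j < n \<Longrightarrow> smooth_on n S (\<Gamma> k i j)"
  unfolding \<Gamma>_def by (intro smooth_on_sum smooth_on_mult S smooth_G smooth_on_dot smooth_on_D1 smooth_on_D2) auto

lemma \<Gamma>_gm:
  assumes u: "u \<in> S" and h: "h < n"
  shows "(\<Sum>l<n. \<Gamma> l i j u * gm l h u) = dot K (D2 f i j u) (D1 f h u)"
proof -
  have "(\<Sum>l<n. \<Gamma> l i j u * gm l h u) = (\<Sum>m<n. (\<Sum>l<n. gm h l u * G l m u) * dot K (D2 f i j u) (D1 f m u))"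
    unfolding \<Gamma>_def sum_distrib_left sum_distrib_right
    by (subst sum.swap) (simp add: mult_ac gm_sym[of _ h])
  also have "\<dots> = (\<Sum>m<n. if h = m then dot K (D2 f i j u) (D1 f m u) else 0)"
    by (rule sum.cong) (auto simp: right_inverse u h)
  finally show ?thesis using h by simp
qed

lemma \<alpha>_normal:
  assumes u: "u \<in> S" and h: "h < n"
  shows "dot K (\<alpha> i j u) (D1 f h u) = 0"
  using \<Gamma>_gm[OF assms] unfolding \<alpha>_def[abs_def] dot_diff_left dot_sum_left gm_def by simp

definition R :: "nat \<Rightarrow> nat \<Rightarrow> nat \<Rightarrow> nat \<Rightarrow> (nat \<Rightarrow> real) \<Rightarrow> real" where
  "R l i j k u = partial i (\<Gamma> l j k) u - partial j (\<Gamma> l i k) u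
     + (\<Sum>m<n. \<Gamma> l i m u * \<Gamma> m j k u - \<Gamma> l j m u * \<Gamma> m i k u)"

text \<open>The identity \<open>\<alpha>_normal\<close> for \<open>\<alpha> j k\<close> and tangent
  vector \<open>h\<close>, differentiated in direction \<open>i\<close>.\<close>

lemma \<alpha>_normal_derivative:
  assumes u: "u \<in> S" and i: "i < n" "j < n" "k < n" "h < n"
  shows "dot K (D3 f i j k u) (D1 f h u) - (\<Sum>l<n. partial i (\<Gamma> l j k) u * gm l h u)
    - (\<Sum>l<n. \<Gamma> l j k u * (\<Sum>m<n. \<Gamma> m i l u * gm m h u)) + dot K (\<alpha> j k u) (D2 f i h u) = 0"
proof -
  define E where "E = (\<lambda>\<kappa>. D3 f i j k u \<kappa> - ((\<Sum>l<n. partial i (\<Gamma> l j k) u * D1 f l u \<kappa>)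
    + (\<Sum>l<n. \<Gamma> l j k u * D2 f i l u \<kappa>)))"
  have "has_partial i (\<lambda>u. \<alpha> j k u \<kappa>) (D3 f i j k u \<kappa> - (\<Sum>l<n. partial i (\<Gamma> l j k) u * D1 f l u \<kappa> + D2 f i l u \<kappa> * \<Gamma> l j k u)) u"
    if "\<kappa> \<in> K" for \<kappa>
    unfolding \<alpha>_def
    by (intro has_partial_diff has_partial_sum has_partial_mult has_partial_D2 has_partial_D1
        smooth_on_has_partial[OF S] smooth_\<Gamma> u i that) auto
  then have "has_partial i (\<lambda>u. \<alpha> j k u \<kappa>) (E \<kappa>) u" if "\<kappa> \<in> K" for \<kappa>
    using that by (simp add: E_def sum.distrib mult.commute)
  then have "has_partial i (\<lambda>u. dot K (\<alpha> j k u) (D1 f h u)) (dot K E (D1 f h u) + dot K (\<alpha> j k u) (D2 f i h u)) u"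
    by (intro has_partial_dot has_partial_D1 u i)
  moreover have "partial i (\<lambda>u. dot K (\<alpha> j k u) (D1 f h u)) u = partial i (\<lambda>u. 0) u"
    by (rule partial_cong[OF S u i(1)]) (simp add: \<alpha>_normal i)
  ultimately have "dot K E (D1 f h u) + dot K (\<alpha> j k u) (D2 f i h u) = 0"
    using partialI[OF has_partial_const[of i 0 u]] partialI by metis
  moreover have "dot K E (D1 f h u) = dot K (D3 f i j k u) (D1 f h u)
     - ((\<Sum>l<n. partial i (\<Gamma> l j k) u * gm l h u) + (\<Sum>l<n. \<Gamma> l j k u * dot K (D2 f i l u) (D1 f h u)))"
    unfolding E_def dot_diff_left dot_add_left dot_sum_left gm_def ..
  ultimately show ?thesis by (simp add: \<Gamma>_gm[OF u i(4)])
qed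

text \<open>Antisymmetrizing \<open>\<alpha>_normal_derivative\<close> in \<open>i\<close> and
  \<open>j\<close> cancels the third derivatives and leaves the curvature. As \<alpha> is normal,
  \<open>D2\<close> on the right-hand side counts only through its normal part.\<close>

lemma gauss_equation:
  assumes u: "u \<in> S" and i: "i < n" "j < n" "k < n" "h < n"
  shows "(\<Sum>l<n. R l i j k u * gm l h u) = dot K (\<alpha> j k u) (D2 f i h u) - dot K (\<alpha> i k u) (D2 f j h u)"
proof -
  have D3: "dot K (D3 f i j k u) (D1 f h u) = dot K (D3 f j i k u) (D1 f h u)"
    by (rule dot_cong) (auto intro: D3_commute u i)
  have G: "(\<Sum>l<n. \<Gamma> l j k u * (\<Sum>m<n. \<Gamma> m i l u * gm m h u)) = (\<Sum>l<n. (\<Sum>m<n. \<Gamma> l i m u * \<Gamma> m j k u) * gm l h u)" for i j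
    unfolding sum_distrib_left sum_distrib_right by (subst sum.swap) (simp add: mult_ac)
  have "(\<Sum>l<n. R l i j k u * gm l h u) = (\<Sum>l<n. partial i (\<Gamma> l j k) u * gm l h u) - (\<Sum>l<n. partial j (\<Gamma> l i k) u * gm l h u)
    + ((\<Sum>l<n. (\<Sum>m<n. \<Gamma> l i m u * \<Gamma> m j k u) * gm l h u) - (\<Sum>l<n. (\<Sum>m<n. \<Gamma> l j m u * \<Gamma> m i k u) * gm l h u))"
    by (simp add: R_def distrib_right left_diff_distrib sum.distrib sum_subtractf)
  then show ?thesis
    using \<alpha>_normal_derivative[OF u i(1,2,3,4)] \<alpha>_normal_derivative[OF u i(2,1,3,4)] D3 G[of j i] G[of i j]
    by linarith
qed

lemma curvature_formula:
  assumes u: "u \<in> S" and i: "i < n" "j < n" "k < n" "m < n"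
  shows "R m i j k u = (\<Sum>h<n. (dot K (\<alpha> j k u) (D2 f i h u) - dot K (\<alpha> i k u) (D2 f j h u)) * G h m u)"
proof -
  have "(\<Sum>h<n. (dot K (\<alpha> j k u) (D2 f i h u) - dot K (\<alpha> i k u) (D2 f j h u)) * G h m u)
     = (\<Sum>h<n. (\<Sum>l<n. R l i j k u * gm l h u) * G h m u)"
    by (rule sum.cong) (auto simp: gauss_equation u i)
  also have "\<dots> = (\<Sum>l<n. R l i j k u * (\<Sum>h<n. gm l h u * G h m u))"
    unfolding sum_distrib_left sum_distrib_right by (subst sum.swap) (simp add: mult_ac)
  also have "\<dots> = (\<Sum>l<n. if l = m then R l i j k u else 0)"
    by (rule sum.cong) (auto simp: right_inverse u i)
  finally show ?thesis using i by simp
qed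

text \<open>Contracting the Gauss equation, Ric(Z, Z) is the trace of the product of \<alpha>(Z, Z)
  with \<alpha> minus the trace of the form (X, X') \<mapsto> <\<alpha>(X, Z), \<alpha>(X', Z)>. By
  \<open>span\<close> the first term vanishes; the second trace is nonnegative by
  \<open>G_nonneg\<close>.\<close>

lemma ricci_nonpos:
  assumes u: "u \<in> S"
    and span: "\<And>\<kappa>. \<kappa> \<in> K \<Longrightarrow> (\<Sum>i<n. \<Sum>j<n. Z i * Z j * D2 f i j u \<kappa>) = (\<Sum>l<n. d l * D1 f l u \<kappa>)"
  shows "(\<Sum>j<n. \<Sum>k<n. (\<Sum>i<n. R i i j k u) * Z j * Z k) \<le> 0"
proof -
  define \<alpha>Z where "\<alpha>Z = (\<lambda>\<kappa>. \<Sum>j<n. Z j * (\<Sum>k<n. Z k * \<alpha> j k u \<kappa>))"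
  define b where "b i = (\<lambda>\<kappa>. \<Sum>k<n. Z k * \<alpha> i k u \<kappa>)" for i
  define e where "e l = d l - (\<Sum>j<n. \<Sum>k<n. Z j * Z k * \<Gamma> l j k u)" for l
  \<comment> \<open>\<alpha>(Z, Z) is tangent by \<open>span\<close>; being also normal, it is
    orthogonal to itself.\<close>
  have "\<alpha>Z \<kappa> = (\<Sum>l<n. e l * D1 f l u \<kappa>)" if "\<kappa> \<in> K" for \<kappa>
  proof -
    have "\<alpha>Z \<kappa> = (\<Sum>i<n. \<Sum>j<n. Z i * Z j * D2 f i j u \<kappa>) - (\<Sum>i<n. \<Sum>j<n. \<Sum>l<n. Z i * Z j * \<Gamma> l i j u * D1 f l u \<kappa>)"
      by (simp add: \<alpha>Z_def \<alpha>_def right_diff_distrib sum_subtractf sum_distrib_left mult_ac)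
    also have "(\<Sum>i<n. \<Sum>j<n. \<Sum>l<n. Z i * Z j * \<Gamma> l i j u * D1 f l u \<kappa>)
      = (\<Sum>l<n. (\<Sum>i<n. \<Sum>j<n. Z i * Z j * \<Gamma> l i j u) * D1 f l u \<kappa>)"
    proof -
      have "(\<Sum>i<n. \<Sum>j<n. \<Sum>l<n. Z i * Z j * \<Gamma> l i j u * D1 f l u \<kappa>) = (\<Sum>i<n. \<Sum>l<n. \<Sum>j<n. Z i * Z j * \<Gamma> l i j u * D1 f l u \<kappa>)"
        by (rule sum.cong[OF refl], rule sum.swap)
      also have "\<dots> = (\<Sum>l<n. \<Sum>i<n. \<Sum>j<n. Z i * Z j * \<Gamma> l i j u * D1 f l u \<kappa>)"
        by (rule sum.swap)
      finally show ?thesis by (simp only: sum_distrib_right)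
    qed
    finally show ?thesis by (simp add: span[OF that] e_def left_diff_distrib sum_subtractf)
  qed
  then have "dot K \<alpha>Z \<alpha>Z = dot K \<alpha>Z (\<lambda>\<kappa>. \<Sum>l<n. e l * D1 f l u \<kappa>)" by (intro dot_cong) auto
  also have "\<dots> = (\<Sum>l<n. e l * dot K \<alpha>Z (D1 f l u))" by (rule dot_sum_right)
  also have "\<dots> = 0"
  proof (intro sum.neutral ballI)
    fix l assume "l \<in> {..<n}"
    have "dot K \<alpha>Z (D1 f l u) = (\<Sum>j<n. Z j * (\<Sum>k<n. Z k * dot K (\<alpha> j k u) (D1 f l u)))"
      unfolding \<alpha>Z_def by (simp only: dot_sum_left)
    then show "e l * dot K \<alpha>Z (D1 f l u) = 0" using \<open>l \<in> {..<n}\<close> by (simp add: \<alpha>_normal u)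
  qed
  finally have \<alpha>Z0: "\<alpha>Z \<kappa> = 0" if "\<kappa> \<in> K" for \<kappa> using dot_self_eq_0[OF fin] that by blast
  \<comment> \<open>By symmetry of \<open>D2\<close> the right factor is \<open>b h\<close> plus a
    tangent vector, and \<open>b i\<close> is normal.\<close>
  have bD: "dot K (b i) (\<lambda>\<kappa>. \<Sum>j<n. Z j * D2 f j h u \<kappa>) = dot K (b i) (b h)" if h: "h < n" for i h
  proof -
    have "dot K (b i) (\<lambda>\<kappa>. \<Sum>j<n. Z j * D2 f j h u \<kappa>)
      = dot K (b i) (\<lambda>\<kappa>. b h \<kappa> + (\<Sum>l<n. (\<Sum>j<n. Z j * \<Gamma> l h j u) * D1 f l u \<kappa>))"
    proof (rule dot_cong[OF refl])
      fix \<kappa> assume \<kappa>: "\<kappa> \<in> K"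
      have "(\<Sum>j<n. Z j * D2 f j h u \<kappa>) = (\<Sum>j<n. Z j * D2 f h j u \<kappa>)"
        by (rule sum.cong) (auto simp: D2_commute[OF u _ h \<kappa>])
      also have "\<dots> = b h \<kappa> + (\<Sum>j<n. Z j * (\<Sum>l<n. \<Gamma> l h j u * D1 f l u \<kappa>))"
        by (simp add: b_def \<alpha>_def right_diff_distrib sum_subtractf)
      also have "(\<Sum>j<n. Z j * (\<Sum>l<n. \<Gamma> l h j u * D1 f l u \<kappa>)) = (\<Sum>l<n. (\<Sum>j<n. Z j * \<Gamma> l h j u) * D1 f l u \<kappa>)"
        unfolding sum_distrib_left sum_distrib_right by (subst sum.swap) (simp add: mult_ac)
      finally show "(\<Sum>j<n. Z j * D2 f j h u \<kappa>) = b h \<kappa> + (\<Sum>l<n. (\<Sum>j<n. Z j * \<Gamma> l h j u) * D1 f l u \<kappa>)" .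
    qed
    also have "\<dots> = dot K (b i) (b h) + (\<Sum>l<n. (\<Sum>j<n. Z j * \<Gamma> l h j u) * dot K (b i) (D1 f l u))"
      unfolding dot_commute[of K "b i"] dot_add_left dot_sum_left ..
    also have "(\<Sum>l<n. (\<Sum>j<n. Z j * \<Gamma> l h j u) * dot K (b i) (D1 f l u)) = 0"
    proof (intro sum.neutral ballI)
      fix l assume "l \<in> {..<n}"
      then have "dot K (b i) (D1 f l u) = 0"
        unfolding b_def dot_sum_left by (simp add: \<alpha>_normal u)
      then show "(\<Sum>j<n. Z j * \<Gamma> l h j u) * dot K (b i) (D1 f l u) = 0" by simp
    qed
    finally show ?thesis by simp
  qed
  have "(\<Sum>j<n. \<Sum>k<n. (\<Sum>i<n. R i i j k u) * Z j * Z k)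
    = (\<Sum>j<n. \<Sum>k<n. \<Sum>i<n. \<Sum>h<n. (dot K (\<alpha> j k u) (D2 f i h u) * G h i u) * (Z j * Z k)
        - (dot K (\<alpha> i k u) (D2 f j h u) * G h i u) * (Z j * Z k))"
    by (intro sum.cong refl) (simp add: curvature_formula u sum_distrib_left sum_distrib_right algebra_simps)
  also have "\<dots> = (\<Sum>i<n. \<Sum>h<n. \<Sum>j<n. \<Sum>k<n. (dot K (\<alpha> j k u) (D2 f i h u) * G h i u) * (Z j * Z k)
        - (dot K (\<alpha> i k u) (D2 f j h u) * G h i u) * (Z j * Z k))"
  proof -
    have sw: "(\<Sum>j<n. \<Sum>k<n. \<Sum>i<n. \<Sum>h<n. F j k i h) = (\<Sum>i<n. \<Sum>h<n. \<Sum>j<n. \<Sum>k<n. F j k i h)" for F :: "nat \<Rightarrow> nat \<Rightarrow> nat \<Rightarrow> nat \<Rightarrow> real"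
    proof -
      have "(\<Sum>j<n. \<Sum>k<n. \<Sum>i<n. \<Sum>h<n. F j k i h) = (\<Sum>j<n. \<Sum>i<n. \<Sum>h<n. \<Sum>k<n. F j k i h)"
        by (rule sum.cong[OF refl], subst sum.swap, rule sum.cong[OF refl], subst sum.swap, rule refl)
      also have "\<dots> = (\<Sum>i<n. \<Sum>h<n. \<Sum>j<n. \<Sum>k<n. F j k i h)"
        by (subst sum.swap, rule sum.cong[OF refl], subst sum.swap, rule refl)
      finally show ?thesis .
    qed
    show ?thesis by (rule sw)
  qed
  also have "\<dots> = (\<Sum>i<n. \<Sum>h<n. G h i u * dot K \<alpha>Z (D2 f i h u) - G h i u * dot K (b i) (\<lambda>\<kappa>. \<Sum>j<n. Z j * D2 f j h u \<kappa>))"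
  proof (intro sum.cong refl)
    fix i h
    have 1: "dot K \<alpha>Z (D2 f i h u) = (\<Sum>j<n. Z j * (\<Sum>k<n. Z k * dot K (\<alpha> j k u) (D2 f i h u)))"
      unfolding \<alpha>Z_def by (simp only: dot_sum_left)
    have 2: "dot K (b i) (\<lambda>\<kappa>. \<Sum>j<n. Z j * D2 f j h u \<kappa>) = (\<Sum>j<n. Z j * (\<Sum>k<n. Z k * dot K (\<alpha> i k u) (D2 f j h u)))"
      unfolding b_def by (subst dot_sum_right) (simp only: dot_sum_left)
    show "(\<Sum>j<n. \<Sum>k<n. (dot K (\<alpha> j k u) (D2 f i h u) * G h i u) * (Z j * Z k)
        - (dot K (\<alpha> i k u) (D2 f j h u) * G h i u) * (Z j * Z k))
       = G h i u * dot K \<alpha>Z (D2 f i h u) - G h i u * dot K (b i) (\<lambda>\<kappa>. \<Sum>j<n. Z j * D2 f j h u \<kappa>)"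
      unfolding 1 2 by (simp add: sum_subtractf sum_distrib_left mult_ac)
  qed
  also have "\<dots> = - (\<Sum>i<n. \<Sum>h<n. G h i u * dot K (b i) (b h))"
  proof -
    have "dot K \<alpha>Z w = 0" for w using \<alpha>Z0 by (simp add: dot_def)
    then show ?thesis by (simp add: bD sum_negf)
  qed
  also have "(\<Sum>i<n. \<Sum>h<n. G h i u * dot K (b i) (b h)) = (\<Sum>\<kappa>\<in>K. \<Sum>i<n. \<Sum>h<n. G h i u * (b i \<kappa> * b h \<kappa>))"
    unfolding dot_def sum_distrib_left sum.swap[of _ K "{..<n}"] ..
  also have "- \<dots> \<le> 0" using G_nonneg[OF u] by (simp add: sum_nonneg)
  finally show ?thesis .
qed

text \<open>Links the chart formulas for the metric \<open>g\<close> with those of the immersion.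
  The Christoffel symbols have to agree on the whole open set, since the curvature differentiates
  them.\<close>

lemma ricci_coeff_eq:
  assumes M: "mdim M = n"
    and mc: "\<And>u i j. u \<in> S \<Longrightarrow> i < n \<Longrightarrow> j < n \<Longrightarrow> metric_coeff M g c i j u = gm i j u"
    and u: "u \<in> S" and jk: "j < n" "k < n"
  shows "ricci_coeff M g c j k u = (\<Sum>i<n. R i i j k u)"
proof -
  have inv: "inverse_metric M g c u i j = G i j u" if u: "u \<in> S" and ij: "i < n" "j < n" for u i j
  proof -
    define H where "H = (\<lambda>i j. if i < n \<and> j < n then G i j u else 0)"
    have "inverse_metric M g c u = H"
      unfolding inverse_metric_def M
    proof (rule the_equality)
      show "(\<forall>i j. n \<le> i \<or> n \<le> j \<longrightarrow> H i j = 0) \<and>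
        (\<forall>i<n. \<forall>j<n. (\<Sum>k<n. H i k * metric_coeff M g c k j u) = (if i = j then 1 else 0))"
        using left_inverse[OF u] by (auto simp: H_def mc u)
      fix H' assume H': "(\<forall>i j. n \<le> i \<or> n \<le> j \<longrightarrow> H' i j = 0) \<and>
        (\<forall>i<n. \<forall>j<n. (\<Sum>k<n. H' i k * metric_coeff M g c k j u) = (if i = j then 1 else 0))"
      have "H' i j = G i j u" if "i < n" "j < n" for i j
        by (rule left_inverse_unique[OF u _ that]) (use H' in \<open>auto simp: mc u\<close>)
      then show "H' = H" using H' by (auto simp: H_def fun_eq_iff not_less)
    qed
    then show ?thesis using ij by (simp add: H_def)
  qed
  have chr: "christoffel M g c k i j u = \<Gamma> k i j u" if u: "u \<in> S" and ij: "k < n" "i < n" "j < n" for u k i j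
  proof -
    have p: "partial a (metric_coeff M g c b d) u = partial a (\<lambda>u. dot K (D1 f b u) (D1 f d u)) u"
      if "a < n" "b < n" "d < n" for a b d
      by (rule partial_cong[OF S u that(1)]) (simp add: mc that gm_def)
    have "christoffel M g c k i j u = (\<Sum>l<n. G k l u * (2 * dot K (D2 f i j u) (D1 f l u))) / 2"
      unfolding christoffel_def M
      by (intro arg_cong2[where f = "(/)"] sum.cong refl) (simp add: inv u ij p koszul)
    then show ?thesis by (simp add: \<Gamma>_def sum_distrib_left[symmetric] mult.left_commute)
  qed
  have "curvature_coeff M g c l i j k u = R l i j k u" if "l < n" "i < n" for l i
  proof -
    have "partial i (christoffel M g c l j k) u = partial i (\<Gamma> l j k) u"
      by (rule partial_cong[OF S u]) (simp_all add: chr that jk)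
    moreover have "partial j (christoffel M g c l i k) u = partial j (\<Gamma> l i k) u"
      by (rule partial_cong[OF S u]) (simp_all add: chr that jk)
    ultimately show ?thesis
      unfolding curvature_coeff_def R_def M by (simp add: chr u that jk)
  qed
  then show ?thesis by (simp add: ricci_coeff_def M)
qed

end

text \<open>The curvature differentiates the Christoffel symbols, so a smooth inverse of the metric
  on an open set is required; \<open>generic_inverse\<close> supplies one after shrinking.\<close>

lemma (in immersed_family) generic_ricci_nonpos:
  assumes ne: "S \<noteq> {}" and M: "mdim M = n"
    and mc: "\<And>u i j. u \<in> S \<Longrightarrow> i < n \<Longrightarrow> j < n \<Longrightarrow> metric_coeff M g c i j u = gm i j u"
  obtains S' where "eopen n S'" "S' \<noteq> {}" "S' \<subseteq> S"
    "\<forall>u\<in>S'. \<forall>Z d. (\<forall>\<kappa>\<in>K.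
       (\<Sum>i<n. \<Sum>j<n. Z i * Z j * D2 f i j u \<kappa>) = (\<Sum>l<n. d l * D1 f l u \<kappa>)) \<longrightarrow>
      (\<Sum>j<n. \<Sum>k<n. ricci_coeff M g c j k u * Z j * Z k) \<le> 0"
proof -
  obtain S' G where S': "eopen n S'" "S' \<noteq> {}" "S' \<subseteq> S"
    and G: "\<forall>i<n. \<forall>j<n. smooth_on n S' (G i j)"
      "\<forall>u\<in>S'. \<forall>i<n. \<forall>j<n. (\<Sum>k<n. G i k u * gm k j u) = (if i = j then 1 else 0)"
    using generic_inverse[OF ne] by (elim exE conjE) (rule that)
  interpret sub: immersed_family n S' K f
  proof unfold_locales
    show "smooth_on n S' (f \<kappa>)" if "\<kappa> \<in> K" for \<kappa>
      by (rule smooth_on_subset[OF S smooth[OF that] S'(3)])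
    show "independent_family n K (\<lambda>i. D1 f i u)" if "u \<in> S'" for u
      using indep S'(3) that by blast
    show "finite K" by (rule fin)
    show "eopen n S'" by (rule S'(1))
  qed
  interpret inv: immersed_inverse n S' K f G
  proof unfold_locales
    show "smooth_on n S' (G i j)" if "i < n" "j < n" for i j using G(1) that by blast
    show "(\<Sum>k<n. G i k u * gm k j u) = (if i = j then 1 else 0)" if "u \<in> S'" "i < n" "j < n" for u i j
      using G(2) that by blast
  qed
  show thesis
  proof (rule that[OF S'], intro ballI allI impI)
    fix u Z d assume u: "u \<in> S'" and
      span: "\<forall>\<kappa>\<in>K. (\<Sum>i<n. \<Sum>j<n. Z i * Z j * D2 f i j u \<kappa>) = (\<Sum>l<n. d l * D1 f l u \<kappa>)"
    have "ricci_coeff M g c j k u = (\<Sum>i<n. inv.R i i j k u)" if "j < n" "k < n" for j k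
    proof (rule inv.ricci_coeff_eq[OF M _ u that])
      show "metric_coeff M g c i j u = gm i j u" if "u \<in> S'" "i < n" "j < n" for u i j
        using mc[of u i j] S'(3) that by blast
    qed
    then show "(\<Sum>j<n. \<Sum>k<n. ricci_coeff M g c j k u * Z j * Z k) \<le> 0"
      using inv.ricci_nonpos[OF u, of Z d] span by simp
  qed
qed

section \<open>The singular extension of a coordinate domain\<close>

text \<open>Elimination instead of minors: a component of the last vector that is nonzero at
  \<open>y0\<close> stays nonzero nearby, and subtracting multiples of that vector clears this
  component of the others, which reduces to \<open>k\<close> vectors.\<close>

lemma independent_family_nearby:
  assumes "finite K" "eopen m S" "y0 \<in> S"
    and "\<And>a \<kappa>. a < k \<Longrightarrow> \<kappa> \<in> K \<Longrightarrow> continuous_on S (\<lambda>y. w a y \<kappa>)"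
    and "independent_family k K (\<lambda>a. w a y0)"
  shows "\<exists>T. eopen m T \<and> y0 \<in> T \<and> T \<subseteq> S \<and> (\<forall>y\<in>T. independent_family k K (\<lambda>a. w a y))"
  using assms(2-)
proof (induction k arbitrary: S w)
  case 0
  then show ?case by (intro exI[of _ S]) (auto simp: independent_family_def)
next
  case (Suc k)
  have "\<exists>\<kappa>\<in>K. w k y0 \<kappa> \<noteq> 0"
  proof (rule ccontr)
    assume "\<not> ?thesis"
    then have "\<forall>\<kappa>\<in>K. (\<Sum>i<Suc k. (if i = k then 1 else 0) * w i y0 \<kappa>) = 0" by simp
    then show False
      using Suc.prems(4)[unfolded independent_family_def, rule_format, of "\<lambda>i. if i = k then 1 else 0" k] by simp
  qed
  then obtain \<kappa>0 where k0: "\<kappa>0 \<in> K" "w k y0 \<kappa>0 \<noteq> 0" by blast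
  define S1 where "S1 = {y\<in>S. w k y \<kappa>0 \<noteq> 0}"
  have S1: "eopen m S1" "y0 \<in> S1" "S1 \<subseteq> S"
    using eopen_Collect_neq[OF Suc.prems(1) Suc.prems(3)[OF lessI k0(1)]] Suc.prems(2) k0 by (auto simp: S1_def)
  define r where "r a y = w a y \<kappa>0 / w k y \<kappa>0" for a y
  define w' where "w' a y \<kappa> = w a y \<kappa> - r a y * w k y \<kappa>" for a y \<kappa>
  have c: "continuous_on S1 (\<lambda>y. w a y \<kappa>)" if "a < Suc k" "\<kappa> \<in> K" for a \<kappa>
    by (rule continuous_on_subset[OF Suc.prems(3)[OF that] S1(3)])
  have c': "continuous_on S1 (\<lambda>y. w' a y \<kappa>)" if "a < k" "\<kappa> \<in> K" for a \<kappa>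
    unfolding w'_def r_def
    by (intro continuous_on_diff continuous_on_mult continuous_on_divide c k0 that) (use that in \<open>auto simp: S1_def\<close>)
  have split: "(\<Sum>a<Suc k. x a * w a y \<kappa>) = (\<Sum>a<k. x a * w' a y \<kappa>) + (x k + (\<Sum>a<k. x a * r a y)) * w k y \<kappa>" for x y \<kappa>
    by (simp add: w'_def right_diff_distrib sum_subtractf distrib_right sum_distrib_right mult.assoc)
  have w'0: "w' a y \<kappa>0 = 0" if "y \<in> S1" for a y
    using that by (simp add: w'_def r_def S1_def)
  have "independent_family k K (\<lambda>a. w' a y0)"
    unfolding independent_family_def
  proof (intro allI impI)
    fix x i assume x: "\<forall>\<kappa>\<in>K. (\<Sum>a<k. x a * w' a y0 \<kappa>) = 0" and i: "i < k"
    \<comment> \<open>The last coefficient is chosen to cancel the multiples of \<open>w k\<close>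
      subtracted in \<open>w'\<close>.\<close>
    define x' where "x' a = (if a < k then x a else - (\<Sum>a<k. x a * r a y0))" for a
    have "(\<Sum>a<Suc k. x' a * w a y0 \<kappa>) = 0" if "\<kappa> \<in> K" for \<kappa>
      unfolding split using x that by (simp add: x'_def)
    then have "x' i = 0"
      using Suc.prems(4)[unfolded independent_family_def, rule_format, of x' i] i by simp
    then show "x i = 0" using i by (simp add: x'_def)
  qed
  then obtain T where T: "eopen m T" "y0 \<in> T" "T \<subseteq> S1" "\<forall>y\<in>T. independent_family k K (\<lambda>a. w' a y)"
    using Suc.IH[of S1 w', OF S1(1,2) c'] by blast
  have "independent_family (Suc k) K (\<lambda>a. w a y)" if y: "y \<in> T" for y
    unfolding independent_family_def
  proof (intro allI impI)
    fix x i assume x: "\<forall>\<kappa>\<in>K. (\<Sum>a<Suc k. x a * w a y \<kappa>) = 0" and i: "i < Suc k"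
    have yS: "y \<in> S1" using y T by blast
    have "x k + (\<Sum>a<k. x a * r a y) = 0"
      using x[rule_format, OF k0(1), unfolded split] yS by (simp add: w'0) (simp add: S1_def)
    then have "\<forall>\<kappa>\<in>K. (\<Sum>a<k. x a * w' a y \<kappa>) = 0"
      using x unfolding split by simp
    then have "x a = 0" if "a < k" for a
      using T(4)[rule_format, OF y, unfolded independent_family_def] that by blast
    then show "x i = 0" using i \<open>x k + (\<Sum>a<k. x a * r a y) = 0\<close> by (cases "i = k") auto
  qed
  then show ?case using T S1 by (intro exI[of _ T]) auto
qed

lemma eopen_independent_family:
  assumes "finite K" "eopen m S"
    and "\<And>a \<kappa>. a < k \<Longrightarrow> \<kappa> \<in> K \<Longrightarrow> continuous_on S (\<lambda>y. w a y \<kappa>)"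
  shows "eopen m {y\<in>S. independent_family k K (\<lambda>a. w a y)}"
proof (subst openin_subopen, intro ballI)
  fix y assume y: "y \<in> {y\<in>S. independent_family k K (\<lambda>a. w a y)}"
  obtain T where "eopen m T" "y \<in> T" "T \<subseteq> S" "\<forall>y\<in>T. independent_family k K (\<lambda>a. w a y)"
    using independent_family_nearby[of K m S y k w, OF assms(1,2) _ assms(3)] y by auto
  then show "\<exists>T. eopen m T \<and> y \<in> T \<and> T \<subseteq> {y\<in>S. independent_family k K (\<lambda>a. w a y)}" by blast
qed

text \<open>The second derivative of \<open>f\<close> in the direction \<open>Z\<close> is not tangent, i.e. \<open>\<alpha>(Z, Z) \<noteq> 0\<close>.\<close>

definition nontangent :: "nat \<Rightarrow> 'k set \<Rightarrow> ('k \<Rightarrow> (nat \<Rightarrow> real) \<Rightarrow> real) \<Rightarrow> (nat \<Rightarrow> (nat \<Rightarrow> real) \<Rightarrow> real) \<Rightarrow> (nat \<Rightarrow> real) \<Rightarrow> bool" where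
  "nontangent n K f Z u \<longleftrightarrow> \<not> (\<exists>d. \<forall>\<kappa>\<in>K.
     (\<Sum>i<n. \<Sum>j<n. Z i u * Z j u * D2 f i j u \<kappa>) = (\<Sum>l<n. d l * D1 f l u \<kappa>))"

text \<open>Up to a tangent vector this is \<alpha>(e, Z) for the \<open>i\<close>-th coordinate
  vector e.\<close>

definition shape_vector :: "nat \<Rightarrow> ('k \<Rightarrow> (nat \<Rightarrow> real) \<Rightarrow> real) \<Rightarrow> (nat \<Rightarrow> (nat \<Rightarrow> real) \<Rightarrow> real) \<Rightarrow> nat \<Rightarrow> (nat \<Rightarrow> real) \<Rightarrow> 'k \<Rightarrow> real" where
  "shape_vector n f Z i u = (\<lambda>\<kappa>. \<Sum>j<n. Z j u * D2 f i j u \<kappa>)"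

locale extension_data = isometric_pair +
  fixes Z :: "nat \<Rightarrow> (nat \<Rightarrow> real) \<Rightarrow> real"
  assumes smooth_Z: "\<And>j. j < n \<Longrightarrow> smooth_on n S (Z j)"
    and null: "\<And>u i l. u \<in> S \<Longrightarrow> i < n \<Longrightarrow> l < n \<Longrightarrow>
      dot K0 (shape_vector n f Z i u) (shape_vector n f Z l u) = dot K1 (shape_vector n f Z i u) (shape_vector n f Z l u)"
    and nontangent0: "\<And>u. u \<in> S \<Longrightarrow> nontangent n K0 f Z u"
    and nontangent1: "\<And>u. u \<in> S \<Longrightarrow> nontangent n K1 f Z u"
begin

section \<open>The extended map and its induced metric\<close>

definition \<pi> :: "(nat \<Rightarrow> real) \<Rightarrow> nat \<Rightarrow> real" where
  "\<pi> = shift_drop n (\<lambda>i. 0)"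

text \<open>The parameter t is the coordinate \<open>n\<close> of \<open>y\<close>.\<close>

definition F :: "'a \<Rightarrow> (nat \<Rightarrow> real) \<Rightarrow> real" where
  "F \<kappa> y = f \<kappa> (\<pi> y) + y n * (\<Sum>j<n. Z j (\<pi> y) * D1 f j (\<pi> y) \<kappa>)"

definition Dom :: "(nat \<Rightarrow> real) set" where
  "Dom = {y\<in>espace (Suc n). \<pi> y \<in> S}"

lemma eopen_Dom: "eopen (Suc n) Dom"
  unfolding Dom_def \<pi>_def by (rule eopen_shift_drop[OF f0.S])

lemma smooth_f: "\<kappa> \<in> K0 \<union> K1 \<Longrightarrow> smooth_on n S (f \<kappa>)"
  using f0.smooth f1.smooth by auto

lemma smooth_pullback: "smooth_on n S h \<Longrightarrow> smooth_on (Suc n) Dom (\<lambda>y. h (\<pi> y))"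
  unfolding Dom_def \<pi>_def by (rule smooth_on_shift_drop[OF f0.S])

lemma smooth_F: "\<kappa> \<in> K0 \<union> K1 \<Longrightarrow> smooth_on (Suc n) Dom (F \<kappa>)"
  unfolding F_def[abs_def] D1_def
  by (intro smooth_intros eopen_Dom smooth_pullback smooth_f smooth_Z) auto

text \<open>The part of the \<open>i\<close>-th derivative of \<open>f\<^sub>*Z\<close> in which
  \<open>Z\<close> is differentiated; \<open>shape_vector\<close> is the other part.\<close>

definition W :: "nat \<Rightarrow> (nat \<Rightarrow> real) \<Rightarrow> 'a \<Rightarrow> real" where
  "W i u = (\<lambda>\<kappa>. \<Sum>j<n. partial i (Z j) u * D1 f j u \<kappa>)"

lemma D1_F:
  assumes y: "y \<in> Dom" and \<kappa>: "\<kappa> \<in> K0 \<union> K1" and i: "i < n"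
  shows "D1 F i y \<kappa> = D1 f i (\<pi> y) \<kappa> + y n * (W i (\<pi> y) \<kappa> + shape_vector n f Z i (\<pi> y) \<kappa>)"
proof -
  have u: "\<pi> y \<in> S" using y by (simp add: Dom_def)
  have lift: "has_partial i (\<lambda>y. h (\<pi> y)) (partial i h (\<pi> y)) y" if "smooth_on n S h" for h
    unfolding \<pi>_def
    by (rule has_partial_splice[OF _ i]) (use smooth_on_has_partial[OF f0.S that i u] in \<open>simp add: \<pi>_def\<close>)
  have "has_partial i (F \<kappa>) (partial i (f \<kappa>) (\<pi> y) + ((if n = i then 1 else 0) * (\<Sum>j<n. Z j (\<pi> y) * partial j (f \<kappa>) (\<pi> y))
      + (\<Sum>j<n. partial i (Z j) (\<pi> y) * partial j (f \<kappa>) (\<pi> y) + partial i (partial j (f \<kappa>)) (\<pi> y) * Z j (\<pi> y)) * y n)) y"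
    unfolding F_def[abs_def] D1_def
    by (intro has_partial_add has_partial_mult has_partial_sum has_partial_coord lift smooth_f \<kappa> smooth_Z smooth_on_partial) auto
  from partialI[OF this] i show ?thesis
    by (simp add: D1_def D2_def W_def shape_vector_def sum.distrib mult.commute)
qed

lemma D1_F_last:
  assumes y: "y \<in> Dom" and \<kappa>: "\<kappa> \<in> K0 \<union> K1"
  shows "D1 F n y \<kappa> = (\<Sum>j<n. Z j (\<pi> y) * D1 f j (\<pi> y) \<kappa>)"
proof -
  have lift: "has_partial n (\<lambda>y. h (\<pi> y)) 0 y" for h
    unfolding \<pi>_def by (rule has_partial_splice_ge) simp
  have "has_partial n (F \<kappa>) (0 + ((if n = n then 1 else 0) * (\<Sum>j<n. Z j (\<pi> y) * D1 f j (\<pi> y) \<kappa>) + 0 * y n)) y"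
    unfolding F_def[abs_def]
    by (intro has_partial_add has_partial_mult has_partial_coord lift[where h = "f \<kappa>"] 
        lift[where h = "\<lambda>u. \<Sum>j<n. Z j u * D1 f j u \<kappa>"])
  from partialI[OF this] show ?thesis by (simp add: D1_def)
qed

text \<open>Coefficients of the derivatives of \<open>F\<close> with respect to tangent vectors;
  \<open>Bcoeff\<close> gives those with respect to shape vectors. They carry no index \<kappa>,
  hence are common to both immersions.\<close>

definition Tcoeff :: "nat \<Rightarrow> (nat \<Rightarrow> real) \<Rightarrow> nat \<Rightarrow> real" where
  "Tcoeff i y j = (if i < n then (if j = i then 1 else 0) + y n * partial i (Z j) (\<pi> y) else Z j (\<pi> y))"

definition Bcoeff :: "nat \<Rightarrow> (nat \<Rightarrow> real) \<Rightarrow> nat \<Rightarrow> real" where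
  "Bcoeff i y j = (if i < n \<and> j = i then y n else 0)"

lemma D1_F_coeff:
  assumes y: "y \<in> Dom" and \<kappa>: "\<kappa> \<in> K0 \<union> K1" and i: "i < Suc n"
  shows "D1 F i y \<kappa> = (\<Sum>j<n. Tcoeff i y j * D1 f j (\<pi> y) \<kappa>) + (\<Sum>j<n. Bcoeff i y j * shape_vector n f Z j (\<pi> y) \<kappa>)"
proof (cases "i < n")
  case True
  have "(\<Sum>j<n. Tcoeff i y j * D1 f j (\<pi> y) \<kappa>) = (\<Sum>j<n. if j = i then D1 f j (\<pi> y) \<kappa> else 0) + y n * W i (\<pi> y) \<kappa>"
    unfolding W_def sum_distrib_left sum.distrib[symmetric]
    by (rule sum.cong) (use True in \<open>auto simp: Tcoeff_def algebra_simps\<close>)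
  moreover have "(\<Sum>j<n. Bcoeff i y j * shape_vector n f Z j (\<pi> y) \<kappa>)
      = (\<Sum>j<n. if j = i then y n * shape_vector n f Z j (\<pi> y) \<kappa> else 0)"
    by (rule sum.cong) (use True in \<open>auto simp: Bcoeff_def\<close>)
  ultimately show ?thesis using True D1_F[OF y \<kappa> True] by (simp add: distrib_left)
next
  case False
  then have "i = n" using i by simp
  then show ?thesis using D1_F_last[OF y \<kappa>] by (simp add: Tcoeff_def Bcoeff_def)
qed

text \<open>By \<open>D1_F_coeff\<close> it suffices to compare products of tangent and shape
  vectors: two tangent vectors by \<open>metric\<close>, a mixed pair by \<open>metric2\<close>, two
  shape vectors by \<open>null\<close>.\<close>

lemma isometric_F:
  assumes y: "y \<in> Dom" and ab: "a < Suc n" "b < Suc n"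
  shows "dot K0 (D1 F a y) (D1 F b y) = dot K1 (D1 F a y) (D1 F b y)"
proof -
  let ?u = "\<pi> y"
  let ?T = "\<lambda>l. D1 f l ?u" and ?B = "\<lambda>i. shape_vector n f Z i ?u"
  have u: "?u \<in> S" using y by (simp add: Dom_def)
  have TT: "sform (?T i) (?T l) = 0" if "i < n" "l < n" for i l
    using metric[OF u that] by (simp add: sform_def)
  have BT: "sform (?B i) (?T l) = 0" if "i < n" "l < n" for i l
    unfolding shape_vector_def sform_sum_left
    by (intro sum.neutral) (use metric2[OF u that(1) _ that(2)] in \<open>auto simp: sform_def\<close>)
  have BB: "sform (?B i) (?B l) = 0" if "i < n" "l < n" for i l
    using null[OF u that] by (simp add: sform_def)
  have "sform (D1 F a y) (D1 F b y)
    = sform (\<lambda>\<kappa>. (\<Sum>j<n. Tcoeff a y j * ?T j \<kappa>) + (\<Sum>j<n. Bcoeff a y j * ?B j \<kappa>))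
            (\<lambda>\<kappa>. (\<Sum>j<n. Tcoeff b y j * ?T j \<kappa>) + (\<Sum>j<n. Bcoeff b y j * ?B j \<kappa>))"
    by (rule sform_cong) (auto simp: D1_F_coeff[OF y] ab)
  also have "\<dots> = 0"
    unfolding sform_add_left sform_sum_left
    unfolding sform_commute[of "?T _"] sform_commute[of "?B _"]
    unfolding sform_add_left sform_sum_left
    by (simp add: TT BT BB sform_commute[of "?T _" "?B _"])
  finally show ?thesis by (simp add: sform_def)
qed

section \<open>Where the extension is immersed\<close>

text \<open>The derivative of \<open>f\<^sub>*Z\<close> along \<open>Z\<close>; its normal part is
  \<alpha>(Z, Z).\<close>

definition Gv :: "(nat \<Rightarrow> real) \<Rightarrow> 'a \<Rightarrow> real" where
  "Gv u = (\<lambda>\<kappa>. \<Sum>i<n. Z i u * (W i u \<kappa> + shape_vector n f Z i u \<kappa>))"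

text \<open>The t-derivative of \<open>F\<close> depends on the others at t = 0. By
  \<open>D1_F_last_frame\<close> it differs from a combination of them by t times \<open>Gv\<close>,
  so \<open>Gv\<close> takes its place.\<close>

definition frame :: "nat \<Rightarrow> (nat \<Rightarrow> real) \<Rightarrow> 'a \<Rightarrow> real" where
  "frame a y = (if a < n then D1 F a y else Gv (\<pi> y))"

lemma D1_F_last_frame:
  assumes y: "y \<in> Dom" and \<kappa>: "\<kappa> \<in> K0 \<union> K1"
  shows "D1 F n y \<kappa> = (\<Sum>i<n. Z i (\<pi> y) * frame i y \<kappa>) - y n * frame n y \<kappa>"
proof -
  have "(\<Sum>i<n. Z i (\<pi> y) * frame i y \<kappa>) = (\<Sum>i<n. Z i (\<pi> y) * D1 f i (\<pi> y) \<kappa>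
      + y n * (Z i (\<pi> y) * (W i (\<pi> y) \<kappa> + shape_vector n f Z i (\<pi> y) \<kappa>)))"
    by (rule sum.cong) (simp_all add: frame_def D1_F[OF y \<kappa>] algebra_simps)
  also have "\<dots> = D1 F n y \<kappa> + y n * frame n y \<kappa>"
    by (simp add: sum.distrib D1_F_last[OF y \<kappa>] frame_def Gv_def sum_distrib_left)
  finally show ?thesis by simp
qed

text \<open>Plays the role of "small t": an open set defined by independence of both frames, with no
  uniform bound on t.\<close>

definition N :: "(nat \<Rightarrow> real) set" where
  "N = {y\<in>Dom. independent_family (Suc n) K0 (\<lambda>a. frame a y)} \<inter>
       {y\<in>Dom. independent_family (Suc n) K1 (\<lambda>a. frame a y)}"

lemma smooth_frame:
  assumes "a < Suc n" "\<kappa> \<in> K0 \<union> K1"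
  shows "smooth_on (Suc n) Dom (\<lambda>y. frame a y \<kappa>)"
proof (cases "a < n")
  case True
  then show ?thesis
    using smooth_on_partial[OF smooth_F[OF assms(2)] assms(1)] by (simp add: frame_def D1_def)
next
  case False
  have "smooth_on (Suc n) Dom (\<lambda>y. Gv (\<pi> y) \<kappa>)"
    unfolding Gv_def W_def shape_vector_def D1_def D2_def
    by (intro smooth_pullback smooth_intros f0.S smooth_f smooth_Z assms) auto
  then show ?thesis using False by (simp add: frame_def)
qed

lemma eopen_N: "eopen (Suc n) N"
  unfolding N_def
  by (intro openin_Int eopen_independent_family f0.fin f1.fin eopen_Dom
      smooth_on_continuous[OF eopen_Dom smooth_frame]) auto

lemma N_Dom: "N \<subseteq> Dom"
  by (auto simp: N_def)

lemma \<pi>_ident: "u \<in> espace n \<Longrightarrow> \<pi> u = u"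
  by (auto simp: \<pi>_def splice_def espace_def)

text \<open>At t = 0 the frame consists of the coordinate tangent vectors and \<open>Gv\<close>,
  which is not tangent because \<alpha>(Z, Z) is nonzero.\<close>

lemma S_N: "S \<subseteq> N"
proof
  fix u assume u: "u \<in> S"
  then have uE: "u \<in> espace n" using eopen_subset[OF f0.S] by blast
  then have un: "u n = 0" and pu: "\<pi> u = u" using \<pi>_ident by (auto simp: espace_def)
  have D: "u \<in> Dom" using u uE pu by (auto simp: Dom_def espace_def)
  have "independent_family (Suc n) K (\<lambda>a. frame a u)"
    if K: "K \<subseteq> K0 \<union> K1" and ind: "independent_family n K (\<lambda>i. D1 f i u)" and nt: "nontangent n K f Z u" for K
    unfolding independent_family_def
  proof (intro allI impI)
    fix x i assume x: "\<forall>\<kappa>\<in>K. (\<Sum>a<Suc n. x a * frame a u \<kappa>) = 0" and i: "i < Suc n"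
    have fr: "frame a u \<kappa> = D1 f a u \<kappa>" if "a < n" "\<kappa> \<in> K" for a \<kappa>
      using that K D1_F[OF D _ that(1), of \<kappa>] by (auto simp: frame_def pu un)
    have eq: "(\<Sum>a<n. x a * D1 f a u \<kappa>) + x n * Gv u \<kappa> = 0" if "\<kappa> \<in> K" for \<kappa>
    proof -
      have "(\<Sum>a<n. x a * frame a u \<kappa>) = (\<Sum>a<n. x a * D1 f a u \<kappa>)"
        by (rule sum.cong) (auto simp: fr that)
      then show ?thesis using x[rule_format, OF that] by (simp add: frame_def pu)
    qed
    have "x n = 0"
    proof (rule ccontr)
      assume xn: "x n \<noteq> 0"
      \<comment> \<open>Solving the relation for \<open>Gv\<close> and removing the term in which
        \<open>Z\<close> is differentiated would make the second derivative along \<open>Z\<close>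
        tangent, with these coefficients.\<close>
      define d where "d l = - x l / x n - (\<Sum>i<n. Z i u * partial i (Z l) u)" for l
      have "(\<Sum>i<n. \<Sum>j<n. Z i u * Z j u * D2 f i j u \<kappa>) = (\<Sum>l<n. d l * D1 f l u \<kappa>)" if "\<kappa> \<in> K" for \<kappa>
      proof -
        have "Gv u \<kappa> = (\<Sum>i<n. Z i u * (\<Sum>j<n. partial i (Z j) u * D1 f j u \<kappa>)) + (\<Sum>i<n. \<Sum>j<n. Z i u * Z j u * D2 f i j u \<kappa>)"
          by (simp add: Gv_def W_def shape_vector_def distrib_left sum.distrib sum_distrib_left mult.assoc)
        also have "(\<Sum>i<n. Z i u * (\<Sum>j<n. partial i (Z j) u * D1 f j u \<kappa>)) = (\<Sum>l<n. (\<Sum>i<n. Z i u * partial i (Z l) u) * D1 f l u \<kappa>)"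
          unfolding sum_distrib_left sum_distrib_right by (subst sum.swap) (simp add: mult.assoc)
        finally have "(\<Sum>i<n. \<Sum>j<n. Z i u * Z j u * D2 f i j u \<kappa>) = Gv u \<kappa> - (\<Sum>l<n. (\<Sum>i<n. Z i u * partial i (Z l) u) * D1 f l u \<kappa>)"
          by simp
        also have "Gv u \<kappa> = (\<Sum>l<n. (- x l / x n) * D1 f l u \<kappa>)"
        proof -
          have "x n * Gv u \<kappa> = x n * (\<Sum>l<n. (- x l / x n) * D1 f l u \<kappa>)"
            using eq[OF that] xn by (simp add: sum_distrib_left sum_negf)
          then show ?thesis using xn by simp
        qed
        finally show ?thesis by (simp add: d_def left_diff_distrib sum_subtractf)
      qed
      then show False using nt unfolding nontangent_def by blast
    qed
    moreover have "\<forall>a<n. x a = 0"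
      using ind[unfolded independent_family_def, rule_format, of x] eq \<open>x n = 0\<close> by simp
    ultimately show "x i = 0" using i by (cases "i = n") auto
  qed
  then show "u \<in> N"
    using D indep0[OF u] indep1[OF u] nontangent0[OF u] nontangent1[OF u] by (simp add: N_def)
qed

text \<open>For t different from 0 the relation \<open>D1_F_last_frame\<close> is an invertible
  change between the frame and the derivatives of \<open>F\<close>.\<close>

lemma immersed_F:
  assumes y: "y \<in> N" "y n \<noteq> 0" and K: "K = K0 \<or> K = K1"
  shows "independent_family (Suc n) K (\<lambda>a. D1 F a y)"
  unfolding independent_family_def
proof (intro allI impI)
  fix x i assume x: "\<forall>\<kappa>\<in>K. (\<Sum>a<Suc n. x a * D1 F a y \<kappa>) = 0" and i: "i < Suc n"
  have D: "y \<in> Dom" using y N_Dom by blast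
  have ind: "independent_family (Suc n) K (\<lambda>a. frame a y)" using y K by (auto simp: N_def)
  \<comment> \<open>The coefficients after \<open>D1_F_last_frame\<close> has been substituted for
    the last derivative.\<close>
  define x' where "x' a = (if a < n then x a + x n * Z a (\<pi> y) else - (x n * y n))" for a
  have "(\<Sum>a<Suc n. x' a * frame a y \<kappa>) = 0" if "\<kappa> \<in> K" for \<kappa>
  proof -
    have \<kappa>: "\<kappa> \<in> K0 \<union> K1" using that K by auto
    have "(\<Sum>a<Suc n. x' a * frame a y \<kappa>) = (\<Sum>a<n. x a * D1 F a y \<kappa> + x n * (Z a (\<pi> y) * frame a y \<kappa>)) - x n * y n * frame n y \<kappa>"
    proof -
      have "(\<Sum>a<n. x' a * frame a y \<kappa>) = (\<Sum>a<n. x a * D1 F a y \<kappa> + x n * (Z a (\<pi> y) * frame a y \<kappa>))"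
        by (rule sum.cong) (auto simp: x'_def frame_def algebra_simps)
      then show ?thesis by (simp add: x'_def)
    qed
    also have "\<dots> = (\<Sum>a<n. x a * D1 F a y \<kappa>) + x n * D1 F n y \<kappa>"
      unfolding D1_F_last_frame[OF D \<kappa>] by (simp add: sum.distrib sum_distrib_left right_diff_distrib mult.assoc)
    also have "\<dots> = 0" using x that by simp
    finally show ?thesis .
  qed
  then have x': "x' a = 0" if "a < Suc n" for a
    using ind[unfolded independent_family_def, rule_format, of x' a] that by blast
  have "x n = 0" using x'[of n] y(2) by (simp add: x'_def)
  then show "x i = 0" using x'[of i] i by (cases "i = n") (auto simp: x'_def)
qed

lemma F_on_S: "u \<in> S \<Longrightarrow> F \<kappa> u = f \<kappa> u"
  using eopen_subset[OF f0.S] \<pi>_ident[of u] by (auto simp: F_def espace_def)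

end

section \<open>Maps into Euclidean space\<close>

lemma smooth_map_flat:
  assumes O: "eopen p O'" and smooth: "\<And>k. k < m \<Longrightarrow> smooth_on p O' (\<lambda>u. F u k)"
    and E: "\<And>u. u \<in> O' \<Longrightarrow> F u \<in> espace m"
  shows "smooth_map (flat p O') (euclidean_manifold m) F"
  unfolding smooth_map_def
proof (intro conjI)
  have "continuous_on O' (\<lambda>u. F u k)" for k
  proof (cases "k < m")
    case True
    then show ?thesis using smooth_on_continuous[OF O smooth] by blast
  next
    case False
    then have "F u k = 0" if "u \<in> O'" for u using E[OF that] by (simp add: espace_def)
    then show ?thesis using continuous_on_cong[of O' O' "\<lambda>u. F u k" "\<lambda>u. 0"] by simp
  qed
  then have "continuous_on O' F" by (rule continuous_on_coordinatewise_then_product)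
  then show "continuous_map (mtop (flat p O')) (mtop (euclidean_manifold m)) F"
    using topspace_flat[OF O] E
    by (auto simp: flat_def euclidean_manifold_def cm_Euclidean_space_iff_continuous_on topspace_espace)
  have "smooth_on p (O' \<inter> F -` espace m) (\<lambda>u. F (inv_into O' (\<lambda>x. x) u) k)" if "k < m" for k
  proof -
    have "O' \<inter> F -` espace m = O'" using E by auto
    then show ?thesis
      using smooth_on_cong[OF O smooth[OF that], of "\<lambda>u. F (inv_into O' (\<lambda>x. x) u) k"]
      by (simp add: inv_into_ident)
  qed
  then show "\<forall>(U, \<phi>)\<in>charts (flat p O'). \<forall>(V, \<psi>)\<in>charts (euclidean_manifold m). \<forall>k<mdim (euclidean_manifold m).
      smooth_on (mdim (flat p O')) (\<phi> ` (U \<inter> F -` V)) (\<lambda>u. \<psi> (F (inv_into U \<phi> u)) k)"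
    by (simp add: flat_def euclidean_manifold_def topspace_espace)
qed

lemma differential_coord:
  assumes "F y \<in> espace m"
  shows "differential M (euclidean_manifold m) F y v (\<lambda>z. z k) = v (\<lambda>u. F u k)"
  by (simp add: differential_def smooth_at_euclidean_coord assms)

lemma induced_metric_coord:
  assumes "F y \<in> espace m"
  shows "induced_metric M m F y v w = (\<Sum>k<m. v (\<lambda>u. F u k) * w (\<lambda>u. F u k))"
  by (simp add: induced_metric_def euclidean_metric_def differential_coord assms)

lemma smooth_at_flat_open: "eopen p O' \<Longrightarrow> y \<in> O' \<Longrightarrow> smooth_on p O' h \<Longrightarrow> smooth_at (flat p O') y h"
  unfolding smooth_at_flat by blast

text \<open>A derivation on an open set of Euclidean space is determined by its values on the
  coordinates, and its image under the differential yields the Jacobian applied to these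
  values.\<close>

lemma immersion_at_flat:
  assumes O: "eopen p O'" and y: "y \<in> O'" and E: "F y \<in> espace m"
    and smooth: "\<And>k. k < m \<Longrightarrow> smooth_on p O' (\<lambda>u. F u k)"
    and indep: "\<And>a. (\<And>k. k < m \<Longrightarrow> (\<Sum>i<p. a i * partial i (\<lambda>u. F u k) y) = 0) \<Longrightarrow> \<forall>i<p. a i = 0"
  shows "immersion_at (flat p O') (euclidean_manifold m) F y"
  unfolding immersion_at_def
proof (rule inj_onI)
  let ?M = "flat p O'"
  fix v w assume v: "v \<in> tangent_space ?M y" and w: "w \<in> tangent_space ?M y"
    and eq: "differential ?M (euclidean_manifold m) F y v = differential ?M (euclidean_manifold m) F y w"
  have "(\<Sum>i<p. (v (\<lambda>u. u i) - w (\<lambda>u. u i)) * partial i (\<lambda>u. F u k) y) = 0" if k: "k < m" for k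
  proof -
    have "v (\<lambda>u. F u k) = w (\<lambda>u. F u k)"
      using fun_cong[OF eq, of "\<lambda>z. z k"] by (simp add: differential_coord[of F y m, OF E])
    then show ?thesis
      using tangent_flat_coordinates[OF O y v smooth_at_flat_open[OF O y smooth[OF k]]]
        tangent_flat_coordinates[OF O y w smooth_at_flat_open[OF O y smooth[OF k]]]
      by (simp add: left_diff_distrib sum_subtractf)
  qed
  then have "\<forall>i<p. v (\<lambda>u. u i) - w (\<lambda>u. u i) = 0" by (rule indep)
  then have c: "v (\<lambda>u. u i) = w (\<lambda>u. u i)" if "i < p" for i using that by simp
  show "v = w"
  proof
    fix h show "v h = w h"
    proof (cases "smooth_at ?M y h")
      case True
      show ?thesis
        unfolding tangent_flat_coordinates[OF O y v True] tangent_flat_coordinates[OF O y w True]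
        by (simp add: c)
    next
      case False
      then show ?thesis using tangent_not_smooth v w by metis
    qed
  qed
qed

lemma has_partial_compose:
  assumes S: "eopen n S" "u \<in> S" "i < n" and G: "\<And>w. w \<in> S \<Longrightarrow> G w \<in> espace m"
    and d: "\<And>k. k < m \<Longrightarrow> has_partial i (\<lambda>w. G w k) (D k) u"
    and W: "eopen m W" "smooth_on m W h" "G u \<in> W"
  shows "has_partial i (\<lambda>w. h (G w)) (\<Sum>k<m. partial k h (G u) * D k) u"
proof -
  \<comment> \<open>Outside \<open>S\<close> the curve is made constant, because
    \<open>chain_rule_curve\<close> wants it in \<open>espace m\<close> for every parameter; only
    its germ matters.\<close>
  define \<gamma> where "\<gamma> t = (if u(i := t) \<in> S then G (u(i := t)) else G u)" for t
  have ev: "\<forall>\<^sub>F t in nhds (u i). \<gamma> t = G (u(i := t))"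
    using eopen_upd_eventually[OF S] by (rule eventually_mono) (simp add: \<gamma>_def)
  have "((\<lambda>t. h (\<gamma> t)) has_real_derivative (\<Sum>k<m. partial k h (\<gamma> (u i)) * D k)) (at (u i))"
  proof (rule chain_rule_curve[OF W(1,2)])
    show "\<gamma> (u i) \<in> W" using W S by (simp add: \<gamma>_def)
    show "\<gamma> t \<in> espace m" for t using G S by (simp add: \<gamma>_def)
    fix k assume "k < m"
    have "((\<lambda>t. G (u(i := t)) k) has_real_derivative D k) (at (u i))"
      using d[OF \<open>k < m\<close>] by (simp add: has_partial_def)
    moreover have "\<forall>\<^sub>F t in nhds (u i). \<gamma> t k = G (u(i := t)) k"
      using ev by (rule eventually_mono) simp
    ultimately show "((\<lambda>t. \<gamma> t k) has_real_derivative D k) (at (u i))"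
      using DERIV_cong_ev[OF refl _ refl, of "\<lambda>t. \<gamma> t k" "\<lambda>t. G (u(i := t)) k" "u i" "D k"] by blast
  qed
  moreover have "\<forall>\<^sub>F t in nhds (u i). h (\<gamma> t) = h (G (u(i := t)))"
    using ev by (rule eventually_mono) simp
  moreover have "\<gamma> (u i) = G u" using S by (simp add: \<gamma>_def)
  ultimately show ?thesis
    unfolding has_partial_def
    using DERIV_cong_ev[OF refl _ refl, of "\<lambda>t. h (\<gamma> t)" "\<lambda>t. h (G (u(i := t)))" "u i"] by simp
qed

section \<open>Isometric immersions in charts\<close>

text \<open>Both immersions in one family: the first entry of the index is 0 for \<open>f\<close>
  and 1 for \<open>f'\<close>, the second is the component. Hence \<open>comps 0 m\<close> and
  \<open>comps 1 m'\<close> are disjoint.\<close>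

definition chart_rep :: "'a set \<Rightarrow> ('a \<Rightarrow> nat \<Rightarrow> real) \<Rightarrow> ('a \<Rightarrow> nat \<Rightarrow> real) \<Rightarrow> ('a \<Rightarrow> nat \<Rightarrow> real) \<Rightarrow> nat \<times> nat \<Rightarrow> (nat \<Rightarrow> real) \<Rightarrow> real" where
  "chart_rep U \<phi> f f' \<kappa> u = (if fst \<kappa> = 0 then f else f') (inv_into U \<phi> u) (snd \<kappa>)"

definition comps :: "nat \<Rightarrow> nat \<Rightarrow> (nat \<times> nat) set" where
  "comps b m = {b} \<times> {..<m}"

lemma finite_comps: "finite (comps b m)" and card_comps: "card (comps b m) = m"
  by (simp_all add: comps_def)

lemma dot_comps: "dot (comps b m) v w = (\<Sum>k<m. v (b, k) * w (b, k))"
proof -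
  have "comps b m = Pair b ` {..<m}" by (auto simp: comps_def)
  then show ?thesis by (simp add: dot_def sum.reindex inj_on_def)
qed

locale immersion_chart =
  fixes M :: "'a manifold" and g :: "'a metric" and m :: nat and f :: "'a \<Rightarrow> nat \<Rightarrow> real"
    and U :: "'a set" and \<phi> :: "'a \<Rightarrow> nat \<Rightarrow> real"
  assumes M: "smooth_manifold M" and f: "isometric_immersion M g m f" and c: "(U, \<phi>) \<in> charts M"
begin

abbreviation "rep k \<equiv> (\<lambda>u. f (inv_into U \<phi> u) k)"

lemma f_espace: "x \<in> topspace (mtop M) \<Longrightarrow> f x \<in> espace m"
proof -
  have "continuous_map (mtop M) (Euclidean_space m) f"
    using f by (simp add: isometric_immersion_def smooth_map_def euclidean_manifold_def)
  then show "x \<in> topspace (mtop M) \<Longrightarrow> f x \<in> espace m"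
    using continuous_map_image_subset_topspace topspace_espace by blast
qed

lemma chart_topspace: "(A, \<psi>) \<in> charts M \<Longrightarrow> A \<subseteq> topspace (mtop M)"
  using smooth_manifold_chartD(1)[OF M] openin_subset by blast

lemma smooth_on_rep': 
  assumes A: "(A, \<psi>) \<in> charts M" and k: "k < m"
  shows "smooth_on (mdim M) (\<psi> ` A) (\<lambda>u. f (inv_into A \<psi> u) k)"
proof -
  have "smooth_on (mdim M) (\<psi> ` (A \<inter> f -` espace m)) (\<lambda>u. f (inv_into A \<psi> u) k)"
    using f A k by (auto simp: isometric_immersion_def smooth_map_def euclidean_manifold_def topspace_espace)
  moreover have "A \<inter> f -` espace m = A" using f_espace chart_topspace[OF A] by auto
  ultimately show ?thesis by simp
qed

lemmas smooth_on_rep = smooth_on_rep'[OF c]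

lemma smooth_at_f: "x \<in> topspace (mtop M) \<Longrightarrow> k < m \<Longrightarrow> smooth_at M x (\<lambda>y. f y k)"
  unfolding smooth_at_def
proof (intro exI[of _ "topspace (mtop M)"] conjI)
  assume k: "k < m"
  have "smooth_on (mdim M) (\<psi> ` (A \<inter> topspace (mtop M))) (\<lambda>u. f (inv_into A \<psi> u) k)" if "(A, \<psi>) \<in> charts M" for A \<psi>
    using smooth_on_rep'[OF that k] chart_topspace[OF that] by (simp add: Int_absorb2)
  then show "\<forall>(A, \<psi>)\<in>charts M. smooth_on (mdim M) (\<psi> ` (A \<inter> topspace (mtop M))) (\<lambda>u. f (inv_into A \<psi> u) k)"
    by auto
qed auto

lemma metric_coeff_rep:
  assumes u: "u \<in> \<phi> ` U" and ij: "i < mdim M" "j < mdim M"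
  shows "metric_coeff M g (U, \<phi>) i j u = (\<Sum>k<m. partial i (rep k) u * partial j (rep k) u)"
proof -
  define x where "x = inv_into U \<phi> u"
  have x: "x \<in> U" "\<phi> x = u" using u by (auto simp: x_def inv_into_into f_inv_into_f)
  have xt: "x \<in> topspace (mtop M)" using x chart_topspace[OF c] by blast
  let ?v = "\<lambda>i. coord_vector M (U, \<phi>) x i"
  have v: "?v i (\<lambda>y. f y k) = partial i (rep k) u" if "k < m" for i k
    using smooth_at_f[OF xt that] by (simp add: coord_vector_def x)
  have "metric_coeff M g (U, \<phi>) i j u = g x (?v i) (?v j)"
    by (simp add: metric_coeff_def Let_def x_def)
  also have "\<dots> = induced_metric M m f x (?v i) (?v j)"
    using f xt coord_vector_tangent[OF M c x(1)] ij by (simp add: isometric_immersion_def)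
  also have "\<dots> = (\<Sum>k<m. partial i (rep k) u * partial j (rep k) u)"
    by (simp add: induced_metric_coord f_espace[OF xt] v)
  finally show ?thesis .
qed

text \<open>A relation between the columns of the Jacobian gives a tangent vector \<open>v\<close>
  with zero differential. Injectivity forces \<open>v = 0\<close>, and evaluating \<open>v\<close>
  at a coordinate function returns the coefficient.\<close>

lemma rep_independent:
  assumes u: "u \<in> \<phi> ` U" and a: "\<And>k. k < m \<Longrightarrow> (\<Sum>i<mdim M. a i * partial i (rep k) u) = 0" and j: "j < mdim M"
  shows "a j = 0"
proof -
  let ?n = "mdim M"
  define x where "x = inv_into U \<phi> u"
  have x: "x \<in> U" "\<phi> x = u" using u by (auto simp: x_def inv_into_into f_inv_into_f)
  have xt: "x \<in> topspace (mtop M)" using x chart_topspace[OF c] by blast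
  define v where "v = (\<lambda>h. \<Sum>i<?n. a i * coord_vector M (U, \<phi>) x i h)"
  have vT: "v \<in> tangent_space M x"
    unfolding v_def by (rule tangent_space_sum) (use coord_vector_tangent[OF M c x(1)] in auto)
  have S: "eopen ?n (\<phi> ` U)" using smooth_manifold_chartD[OF M c] by blast
  \<comment> \<open>If the composite is not smooth at \<open>x\<close>, the value is 0 by the
    convention for tangent vectors, so smoothness of composites need not be proved.\<close>
  have "v (\<lambda>y. h (f y)) = 0" if h: "smooth_at (euclidean_manifold m) (f x) h" for h
  proof (cases "smooth_at M x (\<lambda>y. h (f y))")
    case True
    obtain W where W: "eopen m W" "f x \<in> W" "smooth_on m W h"
      using h unfolding euclidean_manifold_flat smooth_at_flat[OF eopen_espace] by blast
    have "partial i (\<lambda>u. h (f (inv_into U \<phi> u))) u = (\<Sum>k<m. partial k h (f x) * partial i (rep k) u)" if i: "i < ?n" for i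
    proof (rule partialI)
      have "has_partial i (\<lambda>w. h (f (inv_into U \<phi> w))) (\<Sum>k<m. partial k h (f (inv_into U \<phi> u)) * partial i (rep k) u) u"
      proof (rule has_partial_compose[OF S u i _ _ W(1,3)])
        show "f (inv_into U \<phi> w) \<in> espace m" if "w \<in> \<phi> ` U" for w
          using f_espace chart_topspace[OF c] inv_into_into[OF that] by blast
        show "has_partial i (rep k) (partial i (rep k) u) u" if "k < m" for k
          by (rule smooth_on_has_partial[OF S smooth_on_rep[OF that] i u])
        show "f (inv_into U \<phi> u) \<in> W" using W by (simp add: x_def)
      qed
      then show "has_partial i (\<lambda>u. h (f (inv_into U \<phi> u))) (\<Sum>k<m. partial k h (f x) * partial i (rep k) u) u"
        by (simp add: x_def)
    qed
    then have "v (\<lambda>y. h (f y)) = (\<Sum>i<?n. a i * (\<Sum>k<m. partial k h (f x) * partial i (rep k) u))"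
      using True by (simp add: v_def coord_vector_def x)
    also have "\<dots> = (\<Sum>k<m. partial k h (f x) * (\<Sum>i<?n. a i * partial i (rep k) u))"
      unfolding sum_distrib_left by (subst sum.swap) (simp add: mult_ac)
    also have "\<dots> = 0" by (simp add: a)
    finally show ?thesis .
  qed (use tangent_not_smooth[OF vT] in blast)
  then have "differential M (euclidean_manifold m) f x v = differential M (euclidean_manifold m) f x (\<lambda>h. 0)"
    by (auto simp: differential_def fun_eq_iff)
  moreover have "inj_on (differential M (euclidean_manifold m) f x) (tangent_space M x)"
    using f xt by (simp add: isometric_immersion_def immersion_at_def)
  ultimately have "v = (\<lambda>h. 0)"
    using vT tangent_zero[of M x] by (meson inj_onD)
  then have "0 = v (\<lambda>y. \<phi> y j)" by simp
  also have "\<dots> = (\<Sum>i<?n. if j = i then a i else 0)"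
    unfolding v_def by (rule sum.cong) (auto simp: coord_vector_coord[OF M c x(1) j])
  finally show ?thesis using j by simp
qed

end

lemma chart_isometric_pair:
  assumes M: "smooth_manifold M" and f: "isometric_immersion M g m f" and f': "isometric_immersion M g m' f'"
    and c: "(U, \<phi>) \<in> charts M" and S: "eopen (mdim M) S" "S \<subseteq> \<phi> ` U"
  shows "isometric_pair (mdim M) S (comps 0 m) (comps 1 m') (chart_rep U \<phi> f f')"
proof -
  interpret f: immersion_chart M g m f U \<phi> using M f c by unfold_locales
  interpret f': immersion_chart M g m' f' U \<phi> using M f' c by unfold_locales
  let ?F = "chart_rep U \<phi> f f'"
  have F0: "?F (0, k) = (\<lambda>u. f (inv_into U \<phi> u) k)" and F1: "?F (Suc 0, k) = (\<lambda>u. f' (inv_into U \<phi> u) k)" for k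
    by (auto simp: chart_rep_def)
  have U: "eopen (mdim M) (\<phi> ` U)" using smooth_manifold_chartD[OF M c] by blast
  show ?thesis
  proof unfold_locales
    show "finite (comps 0 m)" "finite (comps 1 m')" by (rule finite_comps)+
    show "eopen (mdim M) S" by (rule S(1))
    show "smooth_on (mdim M) S (?F \<kappa>)" if "\<kappa> \<in> comps 0 m" for \<kappa>
      using that smooth_on_subset[OF U f.smooth_on_rep S(2)] by (auto simp: comps_def F0)
    show "smooth_on (mdim M) S (?F \<kappa>)" if "\<kappa> \<in> comps 1 m'" for \<kappa>
      using that smooth_on_subset[OF U f'.smooth_on_rep S(2)] by (auto simp: comps_def F1)
    show "comps 0 m \<inter> comps 1 m' = {}" by (auto simp: comps_def)
    fix u assume "u \<in> S"
    then have u: "u \<in> \<phi> ` U" using S by blast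
    show "dot (comps 0 m) (D1 ?F i u) (D1 ?F j u) = dot (comps 1 m') (D1 ?F i u) (D1 ?F j u)"
      if "i < mdim M" "j < mdim M" for i j
      using f.metric_coeff_rep[OF u that] f'.metric_coeff_rep[OF u that]
      by (simp add: dot_comps D1_def F0 F1)
    show "independent_family (mdim M) (comps 0 m) (\<lambda>i. D1 ?F i u)"
      using f.rep_independent[OF u] by (simp add: independent_family_def comps_def D1_def F0)
    show "independent_family (mdim M) (comps 1 m') (\<lambda>i. D1 ?F i u)"
      using f'.rep_independent[OF u] by (simp add: independent_family_def comps_def D1_def F1)
  qed
qed

lemma chart_metric_coeff:
  assumes M: "smooth_manifold M" and f: "isometric_immersion M g m f" and f': "isometric_immersion M g m' f'"
    and c: "(U, \<phi>) \<in> charts M" and u: "u \<in> \<phi> ` U" and ij: "i < mdim M" "j < mdim M"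
    and K: "K = comps 0 m \<or> K = comps 1 m'"
  shows "metric_coeff M g (U, \<phi>) i j u = dot K (D1 (chart_rep U \<phi> f f') i u) (D1 (chart_rep U \<phi> f f') j u)"
proof -
  interpret f: immersion_chart M g m f U \<phi> using M f c by unfold_locales
  interpret f': immersion_chart M g m' f' U \<phi> using M f' c by unfold_locales
  let ?F = "chart_rep U \<phi> f f'"
  have F0: "?F (0, k) = (\<lambda>u. f (inv_into U \<phi> u) k)" and F1: "?F (Suc 0, k) = (\<lambda>u. f' (inv_into U \<phi> u) k)" for k
    by (auto simp: chart_rep_def)
  show ?thesis
    using K f.metric_coeff_rep[OF u ij] f'.metric_coeff_rep[OF u ij]
    by (auto simp: dot_comps D1_def F0 F1)
qed

text \<open>If the second derivative in the direction \<open>Z\<close> were tangent, then \<open>\<alpha>(Z, Z) = 0\<close> and the Gauss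
  equation would give \<open>Ric(Z, Z) \<le> 0\<close>.\<close>

lemma positive_ricci_coeff:
  assumes M: "smooth_manifold M" and ric: "positive_ricci_curvature M g"
    and c: "(U, \<phi>) \<in> charts M" and u: "u \<in> \<phi> ` U" and Z: "j < mdim M" "Z j \<noteq> 0"
  shows "(\<Sum>j<mdim M. \<Sum>k<mdim M. ricci_coeff M g (U, \<phi>) j k u * Z j * Z k) > 0"
proof -
  let ?n = "mdim M"
  define x where "x = inv_into U \<phi> u"
  have x: "x \<in> U" "\<phi> x = u" using u by (auto simp: x_def inv_into_into f_inv_into_f)
  have xt: "x \<in> topspace (mtop M)" using x smooth_manifold_chartD(1)[OF M c] openin_subset by blast
  define v where "v = (\<lambda>h. \<Sum>i<?n. Z i * coord_vector M (U, \<phi>) x i h)"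
  have vT: "v \<in> tangent_space M x"
    unfolding v_def by (rule tangent_space_sum) (use coord_vector_tangent[OF M c x(1)] in auto)
  have v: "v (\<lambda>y. \<phi> y j) = Z j" if j: "j < ?n" for j
  proof -
    have "v (\<lambda>y. \<phi> y j) = (\<Sum>i<?n. if j = i then Z i else 0)"
      unfolding v_def by (rule sum.cong) (auto simp: coord_vector_coord[OF M c x(1) j])
    then show ?thesis using j by simp
  qed
  have "v \<noteq> (\<lambda>h. 0)" using v[OF Z(1)] Z(2) by auto
  then have "ricci M g (U, \<phi>) x v v > 0"
    using ric[unfolded positive_ricci_curvature_def, rule_format, OF xt c _ vT] x by simp
  also have "ricci M g (U, \<phi>) x v v = (\<Sum>j<?n. \<Sum>k<?n. ricci_coeff M g (U, \<phi>) j k u * Z j * Z k)"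
    unfolding ricci_def by (intro sum.cong refl) (simp add: v x)
  finally show ?thesis .
qed

lemma chart_preimage_open:
  assumes M: "smooth_manifold M" and c: "(U, \<phi>) \<in> charts M" and T: "eopen (mdim M) T"
  shows "openin (mtop M) {x\<in>U. \<phi> x \<in> T}"
proof -
  note ch = smooth_manifold_chartD[OF M c]
  have tU: "topspace (subtopology (mtop M) U) = U" using openin_subset[OF ch(1)] by auto
  have cm: "continuous_map (subtopology (mtop M) U) (Euclidean_space (mdim M)) \<phi>"
    using homeomorphic_imp_continuous_map[OF ch(4)] continuous_map_into_fulltopology by blast
  have "openin (subtopology (mtop M) U) {x\<in>topspace (subtopology (mtop M) U). \<phi> x \<in> T}"
    by (rule openin_continuous_map_preimage[OF cm T])
  then show ?thesis using ch(1) unfolding tU by (meson openin_trans_full)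
qed

text \<open>Three generic steps, the null field and nontangency for each immersion, each pass to a
  smaller nonempty open set. As \<open>W\<close> is arbitrary, the sets on which they succeed are
  dense. The bounds on \<open>\<phi> x 0\<close> prepare the translation into strips.\<close>

lemma local_extension_data:
  fixes M :: "'a manifold"
  assumes M: "smooth_manifold M" and ric: "positive_ricci_curvature M g"
    and f: "isometric_immersion M g m f" and f': "isometric_immersion M g m' f'"
    and dims: "m + m' < 3 * mdim M" and W: "openin (mtop M) W" "W \<noteq> {}"
  shows "\<exists>V U \<phi> Z r. openin (mtop M) V \<and> V \<noteq> {} \<and> V \<subseteq> W \<and> (U, \<phi>) \<in> charts M \<and> V \<subseteq> U \<and>
    extension_data (mdim M) (\<phi> ` V) (comps 0 m) (comps 1 m') (chart_rep U \<phi> f f') Z \<and>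
    (\<forall>x\<in>V. r < \<phi> x 0 \<and> \<phi> x 0 < r + 1)"
proof -
  let ?n = "mdim M" and ?K0 = "comps 0 m" and ?K1 = "comps 1 m'"
  obtain x0 where x0: "x0 \<in> W" using W by blast
  then obtain U \<phi> where c: "(U, \<phi>) \<in> charts M" and x0U: "x0 \<in> U"
    using smooth_manifold_chart_exists[OF M] openin_subset[OF W(1)] by blast
  let ?F = "chart_rep U \<phi> f f'"
  \<comment> \<open>Centres the unit strip at \<open>x0\<close>.\<close>
  define r where "r = \<phi> x0 0 - 1 / 2"
  define S0 where "S0 = \<phi> ` (U \<inter> W) \<inter> {u\<in>espace ?n. r < u 0 \<and> u 0 < r + 1}"
  have "open {u :: nat \<Rightarrow> real. r < u 0 \<and> u 0 < r + 1}"
    by (intro open_Collect_conj open_Collect_less continuous_intros continuous_on_coord)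
  then have "eopen ?n {u\<in>espace ?n. r < u 0 \<and> u 0 < r + 1}"
    unfolding Euclidean_space_top_of_set openin_open by blast
  then have S0: "eopen ?n S0"
    unfolding S0_def using chart_image_eopen[OF M c W(1)] by blast
  have "\<phi> x0 \<in> S0"
    using x0 x0U smooth_manifold_chartD(2)[OF M c] eopen_subset by (fastforce simp: S0_def r_def)
  then have S0n: "S0 \<noteq> {}" by blast
  have S0U: "S0 \<subseteq> \<phi> ` U" by (auto simp: S0_def)
  have pair: "isometric_pair ?n S ?K0 ?K1 ?F" if "eopen ?n S" "S \<subseteq> S0" for S
    by (rule chart_isometric_pair[OF M f f' c]) (use that S0U in auto)
  obtain S1 Z where S1: "eopen ?n S1" "S1 \<noteq> {}" "S1 \<subseteq> S0" and sZ: "\<forall>j<?n. smooth_on ?n S1 (Z j)"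
    and Z: "\<forall>u\<in>S1. (\<exists>j<?n. Z j u \<noteq> 0) \<and> (\<forall>i<?n. \<forall>l<?n.
      dot ?K0 (\<lambda>\<kappa>. \<Sum>j<?n. Z j u * D2 ?F i j u \<kappa>) (\<lambda>\<kappa>. \<Sum>j<?n. Z j u * D2 ?F l j u \<kappa>)
    = dot ?K1 (\<lambda>\<kappa>. \<Sum>j<?n. Z j u * D2 ?F i j u \<kappa>) (\<lambda>\<kappa>. \<Sum>j<?n. Z j u * D2 ?F l j u \<kappa>))"
    using isometric_pair.local_null_field[OF pair[OF S0 order_refl] _ S0n] dims
    unfolding card_comps by (elim meta_impE exE conjE) (assumption, rule that)
  \<comment> \<open>Stated for an arbitrary open subset and either immersion, since it is applied
    twice in succession: a tangent second derivative along the nonzero \<open>Z\<close> would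
    contradict positive Ricci curvature.\<close>
  have ricci: "\<exists>S'. eopen ?n S' \<and> S' \<noteq> {} \<and> S' \<subseteq> S \<and> (\<forall>u\<in>S'. nontangent ?n K ?F Z u)"
    if S: "eopen ?n S" "S \<noteq> {}" "S \<subseteq> S1" and K: "K = ?K0 \<or> K = ?K1" for S K
  proof -
    have SS: "S \<subseteq> S0" using S S1 by blast
    interpret P: isometric_pair ?n S ?K0 ?K1 ?F by (rule pair[OF S(1) SS])
    interpret I: immersed_family ?n S K ?F
    proof unfold_locales
      show "finite K" using K finite_comps by blast
      show "eopen ?n S" by fact
      show "smooth_on ?n S (?F \<kappa>)" if "\<kappa> \<in> K" for \<kappa> using K that P.f0.smooth P.f1.smooth by blast
      show "independent_family ?n K (\<lambda>i. D1 ?F i u)" if "u \<in> S" for u using K that P.indep0 P.indep1 by blast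
    qed
    have mc: "metric_coeff M g (U, \<phi>) i j u = I.gm i j u" if "u \<in> S" "i < ?n" "j < ?n" for i j u
      unfolding I.gm_def
      by (rule chart_metric_coeff[OF M f f' c _ that(2,3) K]) (use that(1) SS S0U in blast)
    obtain S' where S': "eopen ?n S'" "S' \<noteq> {}" "S' \<subseteq> S"
      and R: "\<forall>u\<in>S'. \<forall>Z d. (\<forall>\<kappa>\<in>K.
         (\<Sum>i<?n. \<Sum>j<?n. Z i * Z j * D2 ?F i j u \<kappa>) = (\<Sum>l<?n. d l * D1 ?F l u \<kappa>)) \<longrightarrow>
        (\<Sum>j<?n. \<Sum>k<?n. ricci_coeff M g (U, \<phi>) j k u * Z j * Z k) \<le> 0"
      by (rule I.generic_ricci_nonpos[OF S(2) refl mc])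
    have "nontangent ?n K ?F Z u" if u: "u \<in> S'" for u
      unfolding nontangent_def
    proof
      assume "\<exists>d. \<forall>\<kappa>\<in>K. (\<Sum>i<?n. \<Sum>j<?n. Z i u * Z j u * D2 ?F i j u \<kappa>) = (\<Sum>l<?n. d l * D1 ?F l u \<kappa>)"
      then obtain d where "\<forall>\<kappa>\<in>K. (\<Sum>i<?n. \<Sum>j<?n. Z i u * Z j u * D2 ?F i j u \<kappa>) = (\<Sum>l<?n. d l * D1 ?F l u \<kappa>)" ..
      then have "(\<Sum>j<?n. \<Sum>k<?n. ricci_coeff M g (U, \<phi>) j k u * Z j u * Z k u) \<le> 0"
        by (intro R[rule_format, OF u, of "\<lambda>i. Z i u" d]) auto
      moreover obtain j where "j < ?n" "Z j u \<noteq> 0" using Z u S' S by blast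
      moreover have "u \<in> \<phi> ` U" using u S' SS S0U by blast
      ultimately show False using positive_ricci_coeff[OF M ric c, of u j "\<lambda>i. Z i u"] by fastforce
    qed
    then show ?thesis using S' by blast
  qed
  obtain S2 where S2: "eopen ?n S2" "S2 \<noteq> {}" "S2 \<subseteq> S1" "\<forall>u\<in>S2. nontangent ?n ?K0 ?F Z u"
    using ricci[OF S1(1,2) order_refl disjI1[OF refl]] by (elim exE conjE) (rule that)
  obtain S3 where S3: "eopen ?n S3" "S3 \<noteq> {}" "S3 \<subseteq> S2" "\<forall>u\<in>S3. nontangent ?n ?K1 ?F Z u"
    using ricci[OF S2(1,2,3) disjI2[OF refl]] by (elim exE conjE) (rule that)
  have S30: "S3 \<subseteq> S0" using S3 S2 S1 by blast
  define V where "V = {x\<in>U. \<phi> x \<in> S3}"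
  have V: "openin (mtop M) V" unfolding V_def by (rule chart_preimage_open[OF M c S3(1)])
  have \<phi>V: "\<phi> ` V = S3" using S30 S0U by (auto simp: V_def)
  have VW: "V \<subseteq> W"
  proof
    fix x assume "x \<in> V"
    then have x: "x \<in> U" "\<phi> x \<in> \<phi> ` (U \<inter> W)" using S30 by (auto simp: V_def S0_def)
    then show "x \<in> W" using smooth_manifold_chartD(3)[OF M c] by (auto simp: inj_on_def)
  qed
  have "extension_data ?n S3 ?K0 ?K1 ?F Z"
  proof -
    interpret P: isometric_pair ?n S3 ?K0 ?K1 ?F by (rule pair[OF S3(1) S30])
    show ?thesis
    proof unfold_locales
      show "smooth_on ?n S3 (Z j)" if "j < ?n" for j
        by (rule smooth_on_subset[OF S1(1)]) (use sZ that S3 S2 in auto)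
      fix u assume u: "u \<in> S3"
      show "nontangent ?n ?K0 ?F Z u" "nontangent ?n ?K1 ?F Z u" using u S2 S3 by auto
      show "dot ?K0 (shape_vector ?n ?F Z i u) (shape_vector ?n ?F Z l u) =
        dot ?K1 (shape_vector ?n ?F Z i u) (shape_vector ?n ?F Z l u)" if "i < ?n" "l < ?n" for i l
        unfolding shape_vector_def using Z u S2 S3 that by blast
    qed
  qed
  moreover have "\<forall>x\<in>V. r < \<phi> x 0 \<and> \<phi> x 0 < r + 1"
    using S30 by (auto simp: V_def S0_def)
  moreover have "V \<noteq> {}" using \<phi>V S3(2) by auto
  ultimately show ?thesis
    using V VW c \<phi>V by (intro exI[of _ V] exI[of _ U] exI[of _ \<phi>] exI[of _ Z] exI[of _ r]) (auto simp: V_def)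
qed

section \<open>Gluing chart pieces\<close>

text \<open>Apart from smoothness, which is local, the locale constrains only \<open>Z\<close> and
  the first two derivatives of \<open>f\<close> at each point, and translations carry these over
  unchanged.\<close>

lemma extension_data_local:
  fixes f :: "'k \<Rightarrow> (nat \<Rightarrow> real) \<Rightarrow> real"
  assumes fin: "finite K0" "finite K1" and disj: "K0 \<inter> K1 = {}"
    and loc: "\<And>u. u \<in> O' \<Longrightarrow> \<exists>T c S f0 Z0. eopen n T \<and> u \<in> T \<and> T \<subseteq> O' \<and> extension_data n S K0 K1 f0 Z0 \<and>
      (\<forall>w\<in>T. shift_drop n c w \<in> S \<and> (\<forall>\<kappa>\<in>K0 \<union> K1. f \<kappa> w = f0 \<kappa> (shift_drop n c w)) \<and>
        (\<forall>j<n. Z j w = Z0 j (shift_drop n c w)))"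
  shows "extension_data n O' K0 K1 f Z"
proof -
  have O: "eopen n O'"
    by (subst openin_subopen) (meson loc)
  have key: "\<exists>T c S f0 Z0. eopen n T \<and> u \<in> T \<and> T \<subseteq> O' \<and> extension_data n S K0 K1 f0 Z0 \<and> shift_drop n c u \<in> S \<and>
      (\<forall>\<kappa>\<in>K0 \<union> K1. smooth_on n T (f \<kappa>)) \<and> (\<forall>j<n. smooth_on n T (Z j) \<and> Z j u = Z0 j (shift_drop n c u)) \<and>
      (\<forall>\<kappa>\<in>K0 \<union> K1. \<forall>i<n. D1 f i u \<kappa> = D1 f0 i (shift_drop n c u) \<kappa>) \<and>
      (\<forall>\<kappa>\<in>K0 \<union> K1. \<forall>i<n. \<forall>j<n. D2 f i j u \<kappa> = D2 f0 i j (shift_drop n c u) \<kappa>)"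
    if u: "u \<in> O'" for u
  proof -
    obtain T c S f0 Z0 where T: "eopen n T" "u \<in> T" "T \<subseteq> O'" and X: "extension_data n S K0 K1 f0 Z0"
      and sh: "\<forall>w\<in>T. shift_drop n c w \<in> S \<and> (\<forall>\<kappa>\<in>K0 \<union> K1. f \<kappa> w = f0 \<kappa> (shift_drop n c w)) \<and>
        (\<forall>j<n. Z j w = Z0 j (shift_drop n c w))"
      using loc[OF u] by (elim exE conjE) (rule that)
    interpret X: extension_data n S K0 K1 f0 Z0 by (rule X)
    let ?s = "shift_drop n c"
    let ?P = "{w\<in>espace n. ?s w \<in> S}"
    have P: "eopen n ?P" by (rule eopen_shift_drop[OF X.f0.S])
    have TP: "T \<subseteq> ?P" using eopen_subset[OF T(1)] sh by auto
    have sm: "smooth_on n T h" if "smooth_on n S h0" "\<And>w. w \<in> T \<Longrightarrow> h0 (?s w) = h w" for h h0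
      by (rule smooth_on_cong[OF T(1) smooth_on_subset[OF P smooth_on_shift_drop[OF X.f0.S that(1)] TP] that(2)])
    have pd: "partial i h w = partial i h0 (?s w)"
      if "smooth_on n S h0" "\<And>w. w \<in> T \<Longrightarrow> h w = h0 (?s w)" "w \<in> T" "i < n" for h h0 i w
    proof -
      have "partial i h w = partial i (\<lambda>w. h0 (?s w)) w"
        by (rule partial_cong[OF T(1) that(3,4,2)])
      also have "\<dots> = partial i h0 (?s w)"
        by (rule partialI[OF has_partial_splice[OF smooth_on_has_partial[OF X.f0.S that(1,4)] that(4)]]) (use sh that(3) in blast)
      finally show ?thesis .
    qed
    have d1: "partial i (f \<kappa>) w = partial i (f0 \<kappa>) (?s w)" if "\<kappa> \<in> K0 \<union> K1" "i < n" "w \<in> T" for \<kappa> i w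
      by (rule pd[OF X.smooth_f[OF that(1)] _ that(3,2)]) (use sh that in blast)
    have d2: "partial i (partial j (f \<kappa>)) w = partial i (partial j (f0 \<kappa>)) (?s w)"
      if "\<kappa> \<in> K0 \<union> K1" "i < n" "j < n" "w \<in> T" for \<kappa> i j w
      by (rule pd[OF smooth_on_partial[OF X.smooth_f[OF that(1)] that(3)] d1[OF that(1,3)] that(4,2)])
    show ?thesis
      by (rule exI[of _ T], rule exI[of _ c], rule exI[of _ S], rule exI[of _ f0], rule exI[of _ Z0], intro conjI ballI allI impI)
         (use T sh in \<open>auto simp: D1_def D2_def X d1 d2 intro: sm[OF X.smooth_f] sm[OF X.smooth_Z]\<close>)
  qed
  have sf: "smooth_on n O' (f \<kappa>)" if "\<kappa> \<in> K0 \<union> K1" for \<kappa>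
    by (rule smooth_on_local) (use key that in meson)
  have dots: "(i < n \<longrightarrow> j < n \<longrightarrow> dot K0 (D1 f i u) (D1 f j u) = dot K1 (D1 f i u) (D1 f j u)) \<and>
      independent_family n K0 (\<lambda>i. D1 f i u) \<and> independent_family n K1 (\<lambda>i. D1 f i u) \<and>
      (i < n \<longrightarrow> j < n \<longrightarrow> dot K0 (shape_vector n f Z i u) (shape_vector n f Z j u)
        = dot K1 (shape_vector n f Z i u) (shape_vector n f Z j u)) \<and>
      nontangent n K0 f Z u \<and> nontangent n K1 f Z u" if u: "u \<in> O'" for u i j
  proof -
    obtain T c S f0 Z0 where X: "extension_data n S K0 K1 f0 Z0" and w: "shift_drop n c u \<in> S"
      and Z: "\<forall>j<n. smooth_on n T (Z j) \<and> Z j u = Z0 j (shift_drop n c u)"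
      and d1: "\<forall>\<kappa>\<in>K0 \<union> K1. \<forall>i<n. D1 f i u \<kappa> = D1 f0 i (shift_drop n c u) \<kappa>"
      and d2: "\<forall>\<kappa>\<in>K0 \<union> K1. \<forall>i<n. \<forall>j<n. D2 f i j u \<kappa> = D2 f0 i j (shift_drop n c u) \<kappa>"
      using key[OF u] by (elim exE conjE) (rule that)
    interpret X: extension_data n S K0 K1 f0 Z0 by (rule X)
    let ?w = "shift_drop n c u"
    have sv: "shape_vector n f Z i u \<kappa> = shape_vector n f0 Z0 i ?w \<kappa>" if "\<kappa> \<in> K0 \<union> K1" "i < n" for i \<kappa>
      unfolding shape_vector_def by (rule sum.cong) (use Z d2 that in auto)
    have ind: "independent_family n K (\<lambda>i. D1 f i u) = independent_family n K (\<lambda>i. D1 f0 i ?w)"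
      if "K \<subseteq> K0 \<union> K1" for K
    proof -
      have "(\<Sum>i<n. a i * D1 f i u \<kappa>) = (\<Sum>i<n. a i * D1 f0 i ?w \<kappa>)" if "\<kappa> \<in> K" for a \<kappa>
        by (rule sum.cong) (use d1 that \<open>K \<subseteq> K0 \<union> K1\<close> in auto)
      then show ?thesis by (simp add: independent_family_def)
    qed
    have nt: "nontangent n K f Z u = nontangent n K f0 Z0 ?w" if "K \<subseteq> K0 \<union> K1" for K
    proof -
      have "(\<Sum>i<n. d i * D1 f i u \<kappa>) = (\<Sum>i<n. d i * D1 f0 i ?w \<kappa>)" if "\<kappa> \<in> K" for d \<kappa>
        by (rule sum.cong) (use d1 that \<open>K \<subseteq> K0 \<union> K1\<close> in auto)
      moreover have "(\<Sum>i<n. \<Sum>j<n. Z i u * Z j u * D2 f i j u \<kappa>) = (\<Sum>i<n. \<Sum>j<n. Z0 i ?w * Z0 j ?w * D2 f0 i j ?w \<kappa>)"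
        if "\<kappa> \<in> K" for \<kappa>
        by (intro sum.cong refl) (use d2 Z that \<open>K \<subseteq> K0 \<union> K1\<close> in auto)
      ultimately show ?thesis by (simp add: nontangent_def)
    qed
    have dd: "dot K (D1 f i u) (D1 f j u) = dot K (D1 f0 i ?w) (D1 f0 j ?w)" if "K \<subseteq> K0 \<union> K1" "i < n" "j < n" for K
      by (rule dot_cong) (use d1 that in auto)
    have ds: "dot K (shape_vector n f Z i u) (shape_vector n f Z j u) = dot K (shape_vector n f0 Z0 i ?w) (shape_vector n f0 Z0 j ?w)"
      if "K \<subseteq> K0 \<union> K1" "i < n" "j < n" for K
      by (rule dot_cong) (use sv that in auto)
    show ?thesis
      using X.metric[OF w] X.null[OF w] X.indep0[OF w] X.indep1[OF w] X.nontangent0[OF w] X.nontangent1[OF w]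
        dd[of K0] dd[of K1] ds[of K0] ds[of K1] ind[of K0] ind[of K1] nt[of K0] nt[of K1] by simp
  qed
  show ?thesis
  proof unfold_locales
    show "smooth_on n O' (f \<kappa>)" if "\<kappa> \<in> K0" for \<kappa> using sf that by blast
    show "smooth_on n O' (f \<kappa>)" if "\<kappa> \<in> K1" for \<kappa> using sf that by blast
    show "smooth_on n O' (Z j)" if "j < n" for j
      by (rule smooth_on_local) (use key that in meson)
    fix u assume u: "u \<in> O'"
    show "independent_family n K0 (\<lambda>i. D1 f i u)" "independent_family n K1 (\<lambda>i. D1 f i u)"
      "nontangent n K0 f Z u" "nontangent n K1 f Z u" using dots[OF u] by blast+
    fix i j assume "i < n" "j < n"
    then show "dot K0 (D1 f i u) (D1 f j u) = dot K1 (D1 f i u) (D1 f j u)"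
      "dot K0 (shape_vector n f Z i u) (shape_vector n f Z j u) = dot K1 (shape_vector n f Z i u) (shape_vector n f Z j u)"
      using dots[OF u] by blast+
  qed (rule fin disj O)+
qed

text \<open>Disjoint chart pieces are translated along the first coordinate into the disjoint strips
  \<open>2 k < u\<^sub>0 < 2 k + 1\<close>, so that their union becomes a single coordinate domain.\<close>

locale disjoint_charts =
  fixes M :: "'a manifold" and E :: "nat set" and V A :: "nat \<Rightarrow> 'a set"
    and \<phi> :: "nat \<Rightarrow> 'a \<Rightarrow> nat \<Rightarrow> real" and r :: "nat \<Rightarrow> real"
  assumes M: "smooth_manifold M" and pos: "mdim M > 0"
    and chart: "\<And>k. k \<in> E \<Longrightarrow> (A k, \<phi> k) \<in> charts M"
    and V_open: "\<And>k. k \<in> E \<Longrightarrow> openin (mtop M) (V k)"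
    and V_A: "\<And>k. k \<in> E \<Longrightarrow> V k \<subseteq> A k"
    and V_disj: "\<And>k l x. k \<in> E \<Longrightarrow> l \<in> E \<Longrightarrow> x \<in> V k \<Longrightarrow> x \<in> V l \<Longrightarrow> k = l"
    and strip: "\<And>k x. k \<in> E \<Longrightarrow> x \<in> V k \<Longrightarrow> r k < \<phi> k x 0 \<and> \<phi> k x 0 < r k + 1"
begin

abbreviation "n \<equiv> mdim M"

definition Utot :: "'a set" where "Utot = (\<Union>k\<in>E. V k)"

definition idx :: "'a \<Rightarrow> nat" where "idx x = (THE k. k \<in> E \<and> x \<in> V k)"

definition sh :: "nat \<Rightarrow> nat \<Rightarrow> real" where "sh k i = (if i = 0 then 2 * real k - r k else 0)"

definition \<Phi> :: "'a \<Rightarrow> nat \<Rightarrow> real" where "\<Phi> x = (\<lambda>i. \<phi> (idx x) x i + sh (idx x) i)"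

lemma Utot_open: "openin (mtop M) Utot"
  unfolding Utot_def using V_open by auto

lemma idx: "k \<in> E \<Longrightarrow> x \<in> V k \<Longrightarrow> idx x = k"
  unfolding idx_def using V_disj by blast

lemma \<Phi>_eq: "k \<in> E \<Longrightarrow> x \<in> V k \<Longrightarrow> \<Phi> x = (\<lambda>i. \<phi> k x i + sh k i)"
  by (simp add: \<Phi>_def idx)

lemma \<phi>_espace: "k \<in> E \<Longrightarrow> x \<in> V k \<Longrightarrow> \<phi> k x \<in> espace n"
  using smooth_manifold_chartD(2)[OF M chart] eopen_subset V_A by blast

lemma \<Phi>_espace: "x \<in> Utot \<Longrightarrow> \<Phi> x \<in> espace n"
  using \<phi>_espace pos by (auto simp: Utot_def \<Phi>_eq espace_def sh_def)

text \<open>\<open>splice\<close> subtracts its constants, so \<open>shift_drop n (sh k)\<close>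
  undoes the translation in \<Phi>.\<close>

lemma unshift: "k \<in> E \<Longrightarrow> x \<in> V k \<Longrightarrow> shift_drop n (sh k) (\<Phi> x) = \<phi> k x"
  using \<phi>_espace[of k x] by (auto simp: splice_def \<Phi>_eq espace_def)

lemma inj_\<Phi>: "inj_on \<Phi> Utot"
proof (rule inj_onI)
  fix x y assume "x \<in> Utot" "y \<in> Utot" and eq: "\<Phi> x = \<Phi> y"
  then obtain k l where k: "k \<in> E" "x \<in> V k" and l: "l \<in> E" "y \<in> V l" by (auto simp: Utot_def)
  have "\<Phi> x 0 = \<phi> k x 0 + (2 * real k - r k)" "\<Phi> y 0 = \<phi> l y 0 + (2 * real l - r l)"
    using k l by (simp_all add: \<Phi>_eq sh_def)
  \<comment> \<open>Coordinate 0 lies in both strips, and the intervals (2 k, 2 k + 1) are disjoint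
    for different k.\<close>
  then have "2 * real k < 2 * real l + 1" "2 * real l < 2 * real k + 1"
    using strip[OF k] strip[OF l] eq by auto
  then have "k = l" by linarith
  then have "\<phi> k x = \<phi> k y" using unshift[OF k] unshift[OF l] eq by simp
  then show "x = y"
    using smooth_manifold_chartD(3)[OF M chart[OF k(1)]] k l V_A \<open>k = l\<close> by (metis inj_onD subsetD)
qed

text \<open>Rewrites the image as a preimage under the inverse translation, to which
  \<open>eopen_shift_drop\<close> applies.\<close>

lemma \<Phi>_image:
  assumes k: "k \<in> E" and G: "G \<subseteq> V k"
  shows "\<Phi> ` G = {w\<in>espace n. shift_drop n (sh k) w \<in> \<phi> k ` G}"
proof
  show "\<Phi> ` G \<subseteq> {w\<in>espace n. shift_drop n (sh k) w \<in> \<phi> k ` G}"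
  proof clarify
    fix x assume x: "x \<in> G"
    then have "x \<in> V k" using G by blast
    then show "\<Phi> x \<in> espace n \<and> shift_drop n (sh k) (\<Phi> x) \<in> \<phi> k ` G"
      using \<Phi>_espace k x unshift[OF k] by (auto simp: Utot_def)
  qed
  show "{w\<in>espace n. shift_drop n (sh k) w \<in> \<phi> k ` G} \<subseteq> \<Phi> ` G"
  proof clarify
    fix w x assume w: "w \<in> espace n" and x: "x \<in> G" and eq: "shift_drop n (sh k) w = \<phi> k x"
    have xV: "x \<in> V k" using x G by blast
    have "\<Phi> x i = w i" for i
    proof (cases "i < n")
      case True
      then show ?thesis using fun_cong[OF eq, of i] by (simp add: \<Phi>_eq[OF k xV] splice_def)
    next
      case False
      have "\<Phi> x \<in> espace n" by (rule \<Phi>_espace) (use xV k in \<open>auto simp: Utot_def\<close>)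
      then show ?thesis using w False by (simp add: espace_def)
    qed
    then show "w \<in> \<Phi> ` G" using x by (metis ext imageI)
  qed
qed

lemma \<Phi>_open_piece:
  assumes k: "k \<in> E" and G: "openin (mtop M) G" "G \<subseteq> V k"
  shows "eopen n (\<Phi> ` G)"
proof -
  have "A k \<inter> G = G" using G V_A[OF k] by blast
  then have "eopen n (\<phi> k ` G)" using chart_image_eopen[OF M chart[OF k] G(1)] by simp
  then show ?thesis unfolding \<Phi>_image[OF k G(2)] by (rule eopen_shift_drop)
qed

lemma \<Phi>_open:
  assumes G: "openin (mtop M) G" "G \<subseteq> Utot"
  shows "eopen n (\<Phi> ` G)"
proof -
  have "G = (\<Union>k\<in>E. G \<inter> V k)" using G by (auto simp: Utot_def)
  then have "\<Phi> ` G = (\<Union>k\<in>E. \<Phi> ` (G \<inter> V k))" by (metis image_UN)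
  also have "eopen n \<dots>"
    using G V_open by (intro openin_Union ballI) (auto intro!: \<Phi>_open_piece)
  finally show ?thesis .
qed

lemma \<Phi>_preimage_open:
  assumes T: "eopen n T"
  shows "openin (mtop M) {x\<in>Utot. \<Phi> x \<in> T}"
proof -
  have sh': "w = shift_drop n (\<lambda>i. - sh k i) (shift_drop n (sh k) w)" if "w \<in> espace n" for w k
    using that by (auto simp: splice_def espace_def)
  have "{x\<in>Utot. \<Phi> x \<in> T} = (\<Union>k\<in>E. V k \<inter> {x\<in>A k. \<phi> k x \<in> {u\<in>espace n. shift_drop n (\<lambda>i. - sh k i) u \<in> T}})"
  proof -
    have "\<Phi> x \<in> T \<longleftrightarrow> x \<in> A k \<and> \<phi> k x \<in> {u\<in>espace n. shift_drop n (\<lambda>i. - sh k i) u \<in> T}" if "k \<in> E" "x \<in> V k" for k x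
    proof -
      have "\<Phi> x \<in> espace n" using that \<Phi>_espace by (auto simp: Utot_def)
      then have "\<Phi> x = shift_drop n (\<lambda>i. - sh k i) (\<phi> k x)" using sh'[of "\<Phi> x" k] unshift[OF that] by simp
      then show ?thesis using V_A \<phi>_espace that by auto
    qed
    then show ?thesis by (auto simp: Utot_def)
  qed
  also have "openin (mtop M) \<dots>"
    by (intro openin_Union ballI)
       (auto intro!: openin_Int V_open chart_preimage_open[OF M chart] eopen_shift_drop T simp del: mem_Collect_eq)
  finally show ?thesis .
qed

lemma chart_rep_\<Phi>:
  assumes k: "k \<in> E" and w: "w \<in> \<Phi> ` V k"
  shows "chart_rep Utot \<Phi> f f' \<kappa> w = chart_rep (A k) (\<phi> k) f f' \<kappa> (shift_drop n (sh k) w)"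
    "idx (inv_into Utot \<Phi> w) = k" "\<phi> k (inv_into Utot \<Phi> w) = shift_drop n (sh k) w"
proof -
  obtain x where x: "x \<in> V k" "w = \<Phi> x" using w by blast
  have xU: "x \<in> Utot" using x k by (auto simp: Utot_def)
  have 1: "inv_into Utot \<Phi> w = x" unfolding x by (rule inv_into_f_f[OF inj_\<Phi> xU])
  moreover have "inv_into (A k) (\<phi> k) (shift_drop n (sh k) w) = x"
    unfolding x unshift[OF k x(1)]
    by (rule inv_into_f_f[OF smooth_manifold_chartD(3)[OF M chart[OF k]]]) (use x V_A[OF k] in blast)
  ultimately show "chart_rep Utot \<Phi> f f' \<kappa> w = chart_rep (A k) (\<phi> k) f f' \<kappa> (shift_drop n (sh k) w)"
    by (simp add: chart_rep_def)
  show "idx (inv_into Utot \<Phi> w) = k" "\<phi> k (inv_into Utot \<Phi> w) = shift_drop n (sh k) w"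
    using 1 x idx[OF k x(1)] unshift[OF k x(1)] by auto
qed

text \<open>The data may live on a set larger than the image of \<open>V k\<close>, because the
  pieces are made disjoint after the data have been chosen.\<close>

lemma glued_extension_data:
  assumes data: "\<And>k. k \<in> E \<Longrightarrow> \<exists>S. \<phi> k ` V k \<subseteq> S \<and>
      extension_data n S (comps 0 m) (comps 1 m') (chart_rep (A k) (\<phi> k) f f') (Z k)"
  shows "extension_data n (\<Phi> ` Utot) (comps 0 m) (comps 1 m') (chart_rep Utot \<Phi> f f')
    (\<lambda>j u. Z (idx (inv_into Utot \<Phi> u)) j (\<phi> (idx (inv_into Utot \<Phi> u)) (inv_into Utot \<Phi> u)))"
proof (rule extension_data_local)
  show "finite (comps 0 m)" "finite (comps 1 m')" by (rule finite_comps)+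
  show "comps 0 m \<inter> comps 1 m' = {}" by (auto simp: comps_def)
  fix u assume "u \<in> \<Phi> ` Utot"
  then obtain k where k: "k \<in> E" and u: "u \<in> \<Phi> ` V k" by (auto simp: Utot_def)
  obtain S where S: "\<phi> k ` V k \<subseteq> S"
      "extension_data n S (comps 0 m) (comps 1 m') (chart_rep (A k) (\<phi> k) f f') (Z k)"
    using data[OF k] by blast
  show "\<exists>T c S f0 Z0. eopen n T \<and> u \<in> T \<and> T \<subseteq> \<Phi> ` Utot \<and> extension_data n S (comps 0 m) (comps 1 m') f0 Z0 \<and>
      (\<forall>w\<in>T. shift_drop n c w \<in> S \<and>
        (\<forall>\<kappa>\<in>comps 0 m \<union> comps 1 m'. chart_rep Utot \<Phi> f f' \<kappa> w = f0 \<kappa> (shift_drop n c w)) \<and>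
        (\<forall>j<n. Z (idx (inv_into Utot \<Phi> w)) j (\<phi> (idx (inv_into Utot \<Phi> w)) (inv_into Utot \<Phi> w)) = Z0 j (shift_drop n c w)))"
  proof (intro exI conjI ballI allI impI)
    show "eopen n (\<Phi> ` V k)" by (rule \<Phi>_open_piece[OF k V_open[OF k] order_refl])
    show "u \<in> \<Phi> ` V k" by (rule u)
    show "\<Phi> ` V k \<subseteq> \<Phi> ` Utot" using k by (auto simp: Utot_def)
    show "extension_data n S (comps 0 m) (comps 1 m') (chart_rep (A k) (\<phi> k) f f') (Z k)" by (rule S(2))
    fix w assume w: "w \<in> \<Phi> ` V k"
    show "shift_drop n (sh k) w \<in> S" using w S(1) \<Phi>_image[OF k order_refl] by blast
    show "chart_rep Utot \<Phi> f f' \<kappa> w = chart_rep (A k) (\<phi> k) f f' \<kappa> (shift_drop n (sh k) w)" for \<kappa>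
      by (rule chart_rep_\<Phi>(1)[OF k w])
    show "Z (idx (inv_into Utot \<Phi> w)) j (\<phi> (idx (inv_into Utot \<Phi> w)) (inv_into Utot \<Phi> w)) = Z k j (shift_drop n (sh k) w)" for j
      by (simp add: chart_rep_\<Phi>(2,3)[OF k w])
  qed
qed

lemma topspace_sub: "topspace (mtop (open_submanifold M Utot)) = Utot"
  using openin_subset[OF Utot_open] by (auto simp: open_submanifold_def)

text \<open>As a map to the slice t = 0, \<Phi> is a chart of the union of the pieces: continuous,
  open and injective. The target of one dimension more only adds the coordinate 0.\<close>

lemma \<Phi>_embedding:
  assumes N: "eopen (Suc n) N" "\<Phi> ` Utot \<subseteq> N"
  shows "smooth_embedding (open_submanifold M Utot) (flat (Suc n) N) \<Phi>"
  unfolding smooth_embedding_def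
proof (intro conjI ballI)
  let ?X = "subtopology (mtop M) Utot"
  have tX: "topspace ?X = Utot" using topspace_sub by (simp add: open_submanifold_def)
  have cont: "continuous_map ?X (Euclidean_space n) \<Phi>"
    unfolding continuous_map_def
  proof (intro conjI allI impI)
    show "\<Phi> \<in> topspace ?X \<rightarrow> topspace (Euclidean_space n)"
      using \<Phi>_espace unfolding tX topspace_espace by auto
    fix T assume "eopen n T"
    then show "openin ?X {x\<in>topspace ?X. \<Phi> x \<in> T}"
      unfolding tX using \<Phi>_preimage_open Utot_open by (simp add: openin_open_subtopology Collect_conj_eq)
  qed
  have "embedding_map ?X (Euclidean_space n) \<Phi>"
  proof (rule injective_open_imp_embedding_map[OF cont])
    show "open_map ?X (Euclidean_space n) \<Phi>"
      unfolding open_map_def using \<Phi>_open Utot_open by (auto simp: openin_open_subtopology)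
    show "inj_on \<Phi> (topspace ?X)" unfolding tX by (rule inj_\<Phi>)
  qed
  \<comment> \<open>The embedding property depends only on the subspace topology of the image, which
    is the same in \<open>\<real>\<^sup>n\<close> and in \<open>N\<close>.\<close>
  moreover have "subtopology (mtop (flat (Suc n) N)) (\<Phi> ` Utot) = subtopology (Euclidean_space n) (\<Phi> ` Utot)"
  proof -
    have "espace (Suc n) \<inter> N \<inter> \<Phi> ` Utot = \<Phi> ` Utot" "espace n \<inter> \<Phi> ` Utot = \<Phi> ` Utot"
      using N eopen_subset[OF N(1)] \<Phi>_espace by auto
    then show ?thesis
      by (simp add: flat_def Euclidean_space_top_of_set subtopology_subtopology Int_assoc)
  qed
  ultimately have "embedding_map ?X (mtop (flat (Suc n) N)) \<Phi>"
    unfolding embedding_map_def tX by (simp only:)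
  then show emb: "embedding_map (mtop (open_submanifold M Utot)) (mtop (flat (Suc n) N)) \<Phi>"
    by (simp add: open_submanifold_def)
  show "smooth_map (open_submanifold M Utot) (flat (Suc n) N) \<Phi>"
    unfolding smooth_map_def
  proof (intro conjI)
    show "continuous_map (mtop (open_submanifold M Utot)) (mtop (flat (Suc n) N)) \<Phi>"
      using emb unfolding embedding_map_def
      by (meson homeomorphic_imp_continuous_map continuous_map_into_fulltopology)
    have "smooth_on n (\<psi> ` (B \<inter> Utot \<inter> \<Phi> -` N)) (\<lambda>u. \<Phi> (inv_into (B \<inter> Utot) \<psi> u) i)"
      if B: "(B, \<psi>) \<in> charts M" and i: "i < Suc n" for B \<psi> i
    proof -
      have eqB: "B \<inter> Utot \<inter> \<Phi> -` N = B \<inter> Utot" using N(2) by auto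
      show ?thesis
        unfolding eqB
      proof (rule smooth_on_local)
        fix u assume "u \<in> \<psi> ` (B \<inter> Utot)"
        then obtain k where k: "k \<in> E" "u \<in> \<psi> ` (B \<inter> V k)" by (auto simp: Utot_def)
        have T: "eopen n (\<psi> ` (B \<inter> V k))" by (rule chart_image_eopen[OF M B V_open[OF k(1)]])
        have inv: "inv_into (B \<inter> Utot) \<psi> w \<in> V k \<and> inv_into (B \<inter> Utot) \<psi> w = inv_into B \<psi> w"
          if w: "w \<in> \<psi> ` (B \<inter> V k)" for w
        proof -
          have inj: "inj_on \<psi> B" by (rule smooth_manifold_chartD(3)[OF M B])
          obtain x where x: "x \<in> B" "x \<in> V k" "w = \<psi> x" using w by auto
          have "x \<in> B \<inter> Utot" using x k by (auto simp: Utot_def)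
          then have "inv_into (B \<inter> Utot) \<psi> w = x"
            unfolding x(3) by (intro inv_into_f_f inj_on_subset[OF inj]) auto
          moreover have "inv_into B \<psi> w = x" unfolding x(3) by (rule inv_into_f_f[OF inj x(1)])
          ultimately show ?thesis using x by simp
        qed
        have "smooth_on n (\<psi> ` (B \<inter> V k)) (\<lambda>u. \<Phi> (inv_into (B \<inter> Utot) \<psi> u) i)"
        proof (cases "i < n")
          case True
          have sm: "smooth_on n (\<psi> ` (B \<inter> A k)) (\<lambda>u. \<phi> k (inv_into B \<psi> u) i)"
            by (rule smooth_manifold_transition[OF M B chart[OF k(1)] True])
          have op: "eopen n (\<psi> ` (B \<inter> A k))"
            using chart_image_eopen[OF M B] smooth_manifold_chartD(1)[OF M chart[OF k(1)]] by blast
          have "smooth_on n (\<psi> ` (B \<inter> V k)) (\<lambda>u. \<phi> k (inv_into B \<psi> u) i)"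
            by (rule smooth_on_subset[OF op sm]) (use V_A[OF k(1)] in auto)
          then have "smooth_on n (\<psi> ` (B \<inter> V k)) (\<lambda>u. \<phi> k (inv_into B \<psi> u) i + sh k i)"
            by (intro smooth_on_add smooth_on_const T)
          then show ?thesis
          proof (rule smooth_on_cong[OF T])
            fix w assume "w \<in> \<psi> ` (B \<inter> V k)"
            from inv[OF this] show "\<phi> k (inv_into B \<psi> w) i + sh k i = \<Phi> (inv_into (B \<inter> Utot) \<psi> w) i"
              by (metis \<Phi>_eq[OF k(1)])
          qed
        next
          case False
          show ?thesis
          proof (rule smooth_on_cong[OF T smooth_on_const[OF T, of 0]])
            fix w assume "w \<in> \<psi> ` (B \<inter> V k)"
            then have "inv_into (B \<inter> Utot) \<psi> w \<in> V k" using inv by blast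
            then have "inv_into (B \<inter> Utot) \<psi> w \<in> Utot" using k(1) unfolding Utot_def by blast
            then have "\<Phi> (inv_into (B \<inter> Utot) \<psi> w) \<in> espace n" by (rule \<Phi>_espace)
            then show "0 = \<Phi> (inv_into (B \<inter> Utot) \<psi> w) i" using False by (simp add: espace_def)
          qed
        qed
        then show "\<exists>T. eopen n T \<and> u \<in> T \<and> T \<subseteq> \<psi> ` (B \<inter> Utot) \<and> smooth_on n T (\<lambda>u. \<Phi> (inv_into (B \<inter> Utot) \<psi> u) i)"
          using T k by (intro exI[of _ "\<psi> ` (B \<inter> V k)"]) (auto simp: Utot_def)
      qed
    qed
    then show "\<forall>(U, \<phi>)\<in>charts (open_submanifold M Utot). \<forall>(V, \<psi>)\<in>charts (flat (Suc n) N). \<forall>k<mdim (flat (Suc n) N).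
        smooth_on (mdim (open_submanifold M Utot)) (\<phi> ` (U \<inter> \<Phi> -` V)) (\<lambda>u. \<psi> (\<Phi> (inv_into U \<phi> u)) k)"
      by (auto simp: open_submanifold_def flat_def)
  qed
  fix x assume "x \<in> topspace (mtop (open_submanifold M Utot))"
  then have xU: "x \<in> Utot" by (simp add: topspace_sub)
  then obtain k where k: "k \<in> E" "x \<in> V k" by (auto simp: Utot_def)
  have T: "tangent_space (open_submanifold M Utot) x = tangent_space M x"
    by (rule tangent_space_open_submanifold[OF M Utot_open xU])
  show "immersion_at (open_submanifold M Utot) (flat (Suc n) N) \<Phi> x"
    unfolding immersion_at_def T
  proof (rule inj_onI, rule ext)
    fix v w h
    assume v: "v \<in> tangent_space M x" and w: "w \<in> tangent_space M x"
      and eq: "differential (open_submanifold M Utot) (flat (Suc n) N) \<Phi> x v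
        = differential (open_submanifold M Utot) (flat (Suc n) N) \<Phi> x w"
    show "v h = w h"
    proof (cases "smooth_at M x h")
      case True
      \<comment> \<open>Extends the germ \<open>h\<close>, read in the chart, constantly in t. Every
        smooth germ at \<open>x\<close> is thus a pullback under \<Phi>, so the differential
        separates derivations.\<close>
      define h' where "h' y = h (inv_into (A k) (\<phi> k) (shift_drop n (sh k) y))" for y
      have xA: "x \<in> A k" using k V_A by blast
      obtain S where S: "eopen n S" "\<phi> k x \<in> S" "S \<subseteq> \<phi> k ` A k" "smooth_on n S (\<lambda>u. h (inv_into (A k) (\<phi> k) u))"
        by (rule smooth_at_chart[OF M chart[OF k(1)] xA True])
      have P: "eopen (Suc n) {y\<in>espace (Suc n). shift_drop n (sh k) y \<in> S}"
        by (rule eopen_shift_drop[OF S(1)])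
      have "smooth_on (Suc n) {y\<in>espace (Suc n). shift_drop n (sh k) y \<in> S} h'"
        unfolding h'_def by (rule smooth_on_shift_drop[OF S(1,4)])
      then have "smooth_on (Suc n) ({y\<in>espace (Suc n). shift_drop n (sh k) y \<in> S} \<inter> N) h'"
        by (rule smooth_on_subset[OF P]) auto
      moreover have "\<Phi> x \<in> {y\<in>espace (Suc n). shift_drop n (sh k) y \<in> S} \<inter> N"
        using S(2) unshift[OF k] \<Phi>_espace[OF xU] N(2) xU by (auto simp: espace_def)
      ultimately have sm: "smooth_at (flat (Suc n) N) (\<Phi> x) h'"
        unfolding smooth_at_flat[OF N(1)] using P N(1)
        by (intro exI[of _ "{y\<in>espace (Suc n). shift_drop n (sh k) y \<in> S} \<inter> N"]) auto
      have hh: "h y = h' (\<Phi> y)" if y: "y \<in> V k" for y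
        unfolding h'_def unshift[OF k(1) y]
        using inv_into_f_f[OF smooth_manifold_chartD(3)[OF M chart[OF k(1)]]] y V_A[OF k(1)] by (metis subsetD)
      have "v (\<lambda>y. h' (\<Phi> y)) = w (\<lambda>y. h' (\<Phi> y))"
        using fun_cong[OF eq, of h'] sm by (simp add: differential_def)
      moreover have "v h = v (\<lambda>y. h' (\<Phi> y))" "w h = w (\<lambda>y. h' (\<Phi> y))"
        using tangent_germ[OF M v True V_open[OF k(1)] k(2), of "\<lambda>y. h' (\<Phi> y)"]
          tangent_germ[OF M w True V_open[OF k(1)] k(2), of "\<lambda>y. h' (\<Phi> y)"] hh by auto
      ultimately show ?thesis by simp
    next
      case False
      then show ?thesis using tangent_not_smooth v w by metis
    qed
  qed
qed

text \<open>Singular points have last coordinate 0 by \<open>immersed_F\<close>. A point of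
  \<open>N\<close> with last coordinate 0 is its own projection and hence lies in the image of
  \<Phi>.\<close>

lemma singular_extension:
  assumes f: "isometric_immersion M g m f" and f': "isometric_immersion M g m' f'"
    and data: "\<And>k. k \<in> E \<Longrightarrow> \<exists>S. \<phi> k ` V k \<subseteq> S \<and>
      extension_data n S (comps 0 m) (comps 1 m') (chart_rep (A k) (\<phi> k) f f') (Z k)"
  shows "singularly_extend_isometrically (open_submanifold M Utot) m f m' f'"
proof -
  let ?K0 = "comps 0 m" and ?K1 = "comps 1 m'"
  let ?Z = "\<lambda>j u. Z (idx (inv_into Utot \<Phi> u)) j (\<phi> (idx (inv_into Utot \<Phi> u)) (inv_into Utot \<Phi> u))"
  interpret X: extension_data n "\<Phi> ` Utot" ?K0 ?K1 "chart_rep Utot \<Phi> f f'" ?Z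
    by (rule glued_extension_data[OF data])
  let ?N = "flat (Suc n) X.N"
  \<comment> \<open>Assembles the components of \<open>F\<close> into a point of
    \<open>\<real>\<^sup>m\<close>; the value 0 from \<open>m\<close> on puts it into
    \<open>espace m\<close>.\<close>
  define G where "G b m y = (\<lambda>k. if k < m then X.F (b, k) y else 0)" for b m y
  have GE: "G b m y \<in> espace m" for b m y by (simp add: G_def espace_def)
  have Gk: "(\<lambda>u. G b m u k) = X.F (b, k)" if "k < m" for b m k
    using that by (simp add: G_def)
  have tN: "topspace (mtop ?N) = X.N" by (rule topspace_flat[OF X.eopen_N])
  have sF: "smooth_on (Suc n) X.N (X.F \<kappa>)" if "\<kappa> \<in> ?K0 \<union> ?K1" for \<kappa>
    by (rule smooth_on_subset[OF X.eopen_Dom X.smooth_F[OF that] X.N_Dom])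
  have sG: "smooth_on (Suc n) X.N (\<lambda>u. G b m'' u k)" if "k < m''" "(b, k) \<in> ?K0 \<union> ?K1" for b k m''
    unfolding Gk[OF that(1)] by (rule sF[OF that(2)])
  have sG0: "smooth_on (Suc n) X.N (\<lambda>u. G 0 m u k)" if "k < m" for k
    by (rule sG[OF that]) (use that in \<open>simp add: comps_def\<close>)
  have sG1: "smooth_on (Suc n) X.N (\<lambda>u. G 1 m' u k)" if "k < m'" for k
    by (rule sG[OF that]) (use that in \<open>simp add: comps_def\<close>)
  have ind: "induced_metric ?N m'' (G b m'') y v w
      = (\<Sum>a<Suc n. v (\<lambda>u. u a) * (\<Sum>c<Suc n. w (\<lambda>u. u c) * dot (comps b m'') (D1 X.F a y) (D1 X.F c y)))"
    if y: "y \<in> X.N" and v: "v \<in> tangent_space ?N y" and w: "w \<in> tangent_space ?N y"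
      and s: "\<forall>k<m''. smooth_on (Suc n) X.N (\<lambda>u. G b m'' u k)" for b m'' y v w
  proof -
    have c: "z (\<lambda>u. G b m'' u k) = (\<Sum>a<Suc n. z (\<lambda>u. u a) * D1 X.F a y (b, k))"
      if z: "z \<in> tangent_space ?N y" and k: "k < m''" for z k
      using tangent_flat_coordinates[OF X.eopen_N y z smooth_at_flat_open[OF X.eopen_N y s[rule_format, OF k]]]
      by (simp only: Gk[OF k] D1_def)
    have "induced_metric ?N m'' (G b m'') y v w
      = dot (comps b m'') (\<lambda>\<kappa>. \<Sum>a<Suc n. v (\<lambda>u. u a) * D1 X.F a y \<kappa>) (\<lambda>\<kappa>. \<Sum>a<Suc n. w (\<lambda>u. u a) * D1 X.F a y \<kappa>)"
      unfolding induced_metric_coord[of "G b m''" y m'', OF GE] dot_comps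
      by (rule sum.cong) (simp_all only: c v w lessThan_iff)
    also have "\<dots> = (\<Sum>a<Suc n. v (\<lambda>u. u a) * (\<Sum>c<Suc n. w (\<lambda>u. u c) * dot (comps b m'') (D1 X.F a y) (D1 X.F c y)))"
      by (subst dot_sum_left) (simp only: dot_sum_right)
    finally show ?thesis .
  qed
  have imm: "immersion_at ?N (euclidean_manifold m'') (G b m'') y"
    if y: "y \<in> X.N" "y n \<noteq> 0" and s: "\<And>k. k < m'' \<Longrightarrow> smooth_on (Suc n) X.N (\<lambda>u. G b m'' u k)"
      and K: "comps b m'' = ?K0 \<or> comps b m'' = ?K1" for b m'' y
  proof (rule immersion_at_flat[OF X.eopen_N y(1) GE s])
    fix a assume a: "\<And>k. k < m'' \<Longrightarrow> (\<Sum>i<Suc n. a i * partial i (\<lambda>u. G b m'' u k) y) = 0"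
    have "\<forall>\<kappa>\<in>comps b m''. (\<Sum>i<Suc n. a i * D1 X.F i y \<kappa>) = 0"
    proof
      fix \<kappa> assume "\<kappa> \<in> comps b m''"
      then obtain k where "k < m''" "\<kappa> = (b, k)" by (auto simp: comps_def)
      then show "(\<Sum>i<Suc n. a i * D1 X.F i y \<kappa>) = 0"
        using a[of k] by (simp only: Gk D1_def)
    qed
    then show "\<forall>i<Suc n. a i = 0"
      using X.immersed_F[OF y K] unfolding independent_family_def by blast
  qed
  have fE: "f x \<in> espace m \<and> f' x \<in> espace m'" if x: "x \<in> Utot" for x
  proof -
    have "x \<in> topspace (mtop M)" using x openin_subset[OF Utot_open] by blast
    moreover obtain k where "k \<in> E" using x by (auto simp: Utot_def)
    ultimately show ?thesis
      using immersion_chart.f_espace[of M g m f "A k" "\<phi> k"] immersion_chart.f_espace[of M g m' f' "A k" "\<phi> k"]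
        M f f' chart by (simp add: immersion_chart_def)
  qed
  show ?thesis
    unfolding singularly_extend_isometrically_def
  proof (rule exI[of _ ?N], rule exI[of _ 1], rule exI[of _ \<Phi>], rule exI[of _ "G 0 m"], rule exI[of _ "G 1 m'"],
      intro conjI ballI impI)
    show "smooth_manifold ?N" by (rule smooth_manifold_flat[OF X.eopen_N])
    show "0 < (1::nat)" by simp
    show "mdim ?N = mdim (open_submanifold M Utot) + 1" by (simp add: flat_def open_submanifold_def)
    show "smooth_embedding (open_submanifold M Utot) ?N \<Phi>"
      by (rule \<Phi>_embedding[OF X.eopen_N X.S_N])
    show "smooth_map ?N (euclidean_manifold m) (G 0 m)" by (rule smooth_map_flat[OF X.eopen_N sG0 GE])
    show "smooth_map ?N (euclidean_manifold m') (G 1 m')" by (rule smooth_map_flat[OF X.eopen_N sG1 GE])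
    show "induced_metric ?N m (G 0 m) y v w = induced_metric ?N m' (G 1 m') y v w"
      if "y \<in> topspace (mtop ?N)" and vw: "v \<in> tangent_space ?N y" "w \<in> tangent_space ?N y" for y v w
    proof -
      have y: "y \<in> X.N" using that tN by simp
      then have yD: "y \<in> X.Dom" using X.N_Dom by blast
      show ?thesis
        by (subst ind[OF y vw], use sG0 in blast, subst ind[OF y vw], use sG1 in blast)
           (intro sum.cong refl arg_cong2[where f = "(*)"] X.isometric_F[OF yD]; simp)
    qed
    fix x assume "x \<in> topspace (mtop (open_submanifold M Utot))"
    then have x: "x \<in> Utot" by (simp add: topspace_sub)
    have F: "X.F \<kappa> (\<Phi> x) = (if fst \<kappa> = 0 then f else f') x (snd \<kappa>)" for \<kappa>
      using X.F_on_S[of "\<Phi> x" \<kappa>] x inv_into_f_f[OF inj_\<Phi> x] by (simp add: chart_rep_def)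
    show "f x = G 0 m (\<Phi> x)" "f' x = G 1 m' (\<Phi> x)"
      using fE[OF x] by (auto simp: G_def F espace_def fun_eq_iff)
  next
    fix y assume "y \<in> topspace (mtop ?N)" and
      sing: "\<not> immersion_at ?N (euclidean_manifold m) (G 0 m) y \<or> \<not> immersion_at ?N (euclidean_manifold m') (G 1 m') y"
    then have y: "y \<in> X.N" using tN by simp
    have "y n = 0" using sing imm[OF y _ sG0] imm[OF y _ sG1] by blast
    have D: "y \<in> espace (Suc n)" "X.\<pi> y \<in> \<Phi> ` Utot" using y X.N_Dom by (auto simp: X.Dom_def)
    have "y \<in> espace n" using D(1) \<open>y n = 0\<close> by (auto simp: espace_def) (metis Suc_leI le_neq_implies_less)
    then have "y \<in> \<Phi> ` Utot" using D(2) X.\<pi>_ident by simp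
    then show "y \<in> \<Phi> ` topspace (mtop (open_submanifold M Utot))" by (simp add: topspace_sub)
  qed
qed

end

section \<open>Disjoint chart pieces with dense union\<close>

theorem corollary6:
  fixes M :: "'a manifold" and g :: "'a metric" and f :: "'a \<Rightarrow> nat \<Rightarrow> real" and n p :: nat
  assumes "riemannian_manifold M g" and "mdim M = n"
    and "positive_ricci_curvature M g"
    and "isometric_immersion M g (n + p) f"
  shows "\<forall>q::int. 0 \<le> int n + q \<and> q < int n - int p \<longrightarrow>
           singularly_genuinely_rigid M g (n + p) f q"
proof (intro allI impI)
  fix q :: int assume q: "0 \<le> int n + q \<and> q < int n - int p"
  have M: "smooth_manifold M" using assms(1) by (simp add: riemannian_manifold_def)
  define m' where "m' = nat (int (mdim M) + q)"
  \<comment> \<open>Both follow from q < n - p, as \<open>m'\<close> = n + q: the sum of the target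
    dimensions is 2 n + p + q.\<close>
  have pos: "mdim M > 0" and dims: "(n + p) + m' < 3 * mdim M"
    using q assms(2) by (auto simp: m'_def)
  show "singularly_genuinely_rigid M g (n + p) f q"
    unfolding singularly_genuinely_rigid_def Let_def m'_def[symmetric]
  proof (intro allI impI)
    fix f' assume f': "isometric_immersion M g m' f'"
    let ?P = "\<lambda>B U \<phi> Z r. (U, \<phi>) \<in> charts M \<and> B \<subseteq> U \<and>
      extension_data (mdim M) (\<phi> ` B) (comps 0 (n + p)) (comps 1 m') (chart_rep U \<phi> f f') Z \<and>
      (\<forall>x\<in>B. r < \<phi> x 0 \<and> \<phi> x 0 < r + 1)"
    have "second_countable (mtop M)" using M by (simp add: smooth_manifold_def)
    then obtain \<B> where \<B>: "countable \<B>" "\<forall>B\<in>\<B>. openin (mtop M) B"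
      "\<forall>W x. openin (mtop M) W \<and> x \<in> W \<longrightarrow> (\<exists>B\<in>\<B>. x \<in> B \<and> B \<subseteq> W)"
      unfolding second_countable_def by (elim exE conjE) (rule that)
    \<comment> \<open>Members of a countable base lying inside some piece that carries data; the
      base makes the choice of pieces countable.\<close>
    define \<G> where "\<G> = {B\<in>\<B>. \<exists>V U \<phi> Z r. B \<subseteq> V \<and> ?P V U \<phi> Z r}"
    have \<G>c: "countable \<G>" using \<B>(1) by (rule countable_subset[rotated]) (auto simp: \<G>_def)
    have dense: "\<exists>B\<in>\<G>. B \<noteq> {} \<and> B \<subseteq> W" if W: "openin (mtop M) W" "W \<noteq> {}" for W
    proof -
      obtain V U \<phi> Z r where V: "openin (mtop M) V" "V \<noteq> {}" "V \<subseteq> W" and P: "?P V U \<phi> Z r"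
        using local_extension_data[OF M assms(3,4) f' dims W] by (elim exE conjE) (rule that, auto)
      obtain x where "x \<in> V" using V(2) by blast
      then obtain B where B: "B \<in> \<B>" "x \<in> B" "B \<subseteq> V" using \<B>(3) V(1) by blast
      then have "B \<in> \<G>" using P unfolding \<G>_def by blast
      then show ?thesis using B V by blast
    qed
    define e where "e = to_nat_on \<G>"
    have e: "inj_on e \<G>" unfolding e_def by (rule inj_on_to_nat_on[OF \<G>c])
    define E where "E = e ` \<G>"
    define Bs where "Bs k = inv_into \<G> e k" for k
    have Bs: "Bs k \<in> \<G>" if "k \<in> E" for k using that inv_into_into[of k e \<G>] by (simp add: E_def Bs_def)
    have Bs_e: "Bs (e B) = B" if "B \<in> \<G>" for B using inv_into_f_f[OF e that] by (simp add: Bs_def)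
    \<comment> \<open>Subtracting the closure of the earlier sets, rather than the sets, keeps the
      pieces open as well as disjoint.\<close>
    define V where "V k = Bs k - mtop M closure_of (\<Union>l\<in>{l\<in>E. l < k}. Bs l)" for k
    have Bo: "openin (mtop M) (Bs k)" if "k \<in> E" for k using Bs[OF that] \<B>(2) by (auto simp: \<G>_def)
    have "\<forall>k\<in>E. \<exists>V U \<phi> Z r. Bs k \<subseteq> V \<and> ?P V U \<phi> Z r" using Bs by (auto simp: \<G>_def)
    then obtain V' A \<phi> Z r where data: "\<forall>k\<in>E. Bs k \<subseteq> V' k \<and> ?P (V' k) (A k) (\<phi> k) (Z k) (r k)"
      by metis
    interpret D: disjoint_charts M E V A \<phi> r
    proof unfold_locales
      show "smooth_manifold M" "0 < mdim M" by fact+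
      fix k assume k: "k \<in> E"
      show "(A k, \<phi> k) \<in> charts M" using data k by blast
      show "openin (mtop M) (V k)"
        unfolding V_def by (rule openin_diff[OF Bo[OF k] closedin_closure_of])
      show "V k \<subseteq> A k" using data k by (auto simp: V_def)
      show "r k < \<phi> k x 0 \<and> \<phi> k x 0 < r k + 1" if "x \<in> V k" for x
        using data k that unfolding V_def by blast
    next
      have less: False if k: "k \<in> E" "l \<in> E" "x \<in> V k" "x \<in> V l" and "k < l" for k l x
      proof -
        have "x \<in> (\<Union>l\<in>{k\<in>E. k < l}. Bs l)" using that by (auto simp: V_def)
        moreover have "(\<Union>l\<in>{k\<in>E. k < l}. Bs l) \<subseteq> topspace (mtop M)"
          using Bo openin_subset by blast
        ultimately have "x \<in> mtop M closure_of (\<Union>l\<in>{k\<in>E. k < l}. Bs l)"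
          using closure_of_subset by blast
        then show False using that by (simp add: V_def)
      qed
      show "k = l" if "k \<in> E" "l \<in> E" "x \<in> V k" "x \<in> V l" for k l x
        using less[of k l x] less[of l k x] that by (meson linorder_neqE_nat)
    qed
    have "mtop M closure_of D.Utot = topspace (mtop M)"
    proof -
      have "D.Utot \<inter> W \<noteq> {}" if W: "openin (mtop M) W" "W \<noteq> {}" for W
      proof -
        obtain B where B: "B \<in> \<G>" "B \<noteq> {}" "B \<subseteq> W" using dense[OF W] by blast
        have ex: "\<exists>k. k \<in> E \<and> W \<inter> Bs k \<noteq> {}"
          using B Bs_e[OF B(1)] by (intro exI[of _ "e B"]) (auto simp: E_def)
        \<comment> \<open>For the first \<open>Bs k\<close> that meets the open set
          \<open>W\<close>, the earlier ones and hence their closure miss \<open>W\<close>. So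
          within \<open>W\<close> nothing has been subtracted from \<open>Bs k\<close>.\<close>
        define k where "k = (LEAST k. k \<in> E \<and> W \<inter> Bs k \<noteq> {})"
        have k: "k \<in> E" "W \<inter> Bs k \<noteq> {}" using LeastI_ex[OF ex] by (auto simp: k_def)
        have "W \<inter> Bs l = {}" if "l \<in> E" "l < k" for l
          using not_less_Least[of l "\<lambda>k. k \<in> E \<and> W \<inter> Bs k \<noteq> {}"] that by (auto simp: k_def)
        then have "W \<inter> (\<Union>l\<in>{l\<in>E. l < k}. Bs l) = {}" by blast
        then have "W \<inter> mtop M closure_of (\<Union>l\<in>{l\<in>E. l < k}. Bs l) = {}"
          using openin_Int_closure_of_eq_empty[OF W(1)] by blast
        then have "W \<inter> V k = W \<inter> Bs k" by (auto simp: V_def)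
        then show ?thesis using k by (auto simp: D.Utot_def)
      qed
      then show ?thesis by (metis dense_intersects_open)
    qed
    moreover have "singularly_extend_isometrically (open_submanifold M D.Utot) (n + p) f m' f'"
    proof (rule D.singular_extension[OF assms(4) f'])
      fix k assume k: "k \<in> E"
      show "\<exists>S. \<phi> k ` V k \<subseteq> S \<and>
        extension_data (mdim M) S (comps 0 (n + p)) (comps 1 m') (chart_rep (A k) (\<phi> k) f f') (Z k)"
      proof (intro exI conjI)
        show "extension_data (mdim M) (\<phi> k ` V' k) (comps 0 (n + p)) (comps 1 m') (chart_rep (A k) (\<phi> k) f f') (Z k)"
          using data k by blast
        have "V k \<subseteq> V' k" using data k by (auto simp: V_def)
        then show "\<phi> k ` V k \<subseteq> \<phi> k ` V' k" by blast
      qed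
    qed
    ultimately show "\<exists>U. openin (mtop M) U \<and> mtop M closure_of U = topspace (mtop M) \<and>
        singularly_extend_isometrically (open_submanifold M U) (n + p) f m' f'"
      using D.Utot_open by blast
  qed
qed

end
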